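(* Suppose $u$ is a parallel refractor and the target $\Sigma$ is regular from $X^\star=(x^\star,u(x^\star))\in C_\Omega$. Then there exist positive constants $\delta,C_1,C_2$ depending on $X^\star$ and a structural constant $C$, with $B_\delta(x^\star)\subset\Omega$, such that both (i) and (ii) hold. (i) If $\bar x,\hat x\in B_\delta(x^\star)$, $\bar Y\in F_u(\bar x)$, $\hat Y\in F_u(\hat x)$ and $|\bar Y-\hat Y|\ge|\bar x-\hat x|$, then there exists $x_0$ on the segment from $\bar x$ to $\hat x$ such that, with $X_0^\star=(x_0,u(x_0))$, $$u(x)-\phi(x,Y,X_0^\star)\le C|\bar Y-\hat Y|\,|\bar x-\hat x|+C|Y(\lambda)-Y|\,|x-x_0|-C_1|\bar Y-\hat Y|^2|x-x_0|^2$$ for all $Y(\lambda)\in[\bar Y,\hat Y]_{X_0^\star}$ with $1/4\le\lambda\le3/4$, all $Y\in\Sigma$ and all $x\in\Omega\cap B_{C_2}(x_0)$. (ii) There exists a constant $M>0$ depending on $C$ and $C_1$ such that if $\hat x,\bar x\in B_{\delta/2}(x^\star)$, $\hat x\ne\bar x$, $\bar Y\in F_u(\bar x)$, $\hat Y\in F_u(\hat x)$ satisfy $$\frac{|\bar Y-\hat Y|}{|\bar x-\hat x|}\ge\max\left\{1,\left(\frac{2M}{\delta}\right)^2,\left(\frac{2M}{C_2}\right)^2\right\},$$ then there exists $x_0$ on the straight segment from $\bar x$ to $\hat x$ such that $$N_\mu\big(\{Y(\lambda)\in[\bar Y,\hat Y]_{X_0^\star}:\lambda\in[1/4,3/4]\}\big)\cap\Sigma\subseteq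 F_u(B_\eta(x_0)),$$ where $X_0^\star=(x_0,u(x_0))$, $\mu=|\bar Y-\hat Y|^{3/2}|\bar x-\hat x|^{1/2}$ and $\eta=M\,\dfrac{|\bar x-\hat x|^{1/2}}{|\bar Y-\hat Y|^{1/2}}$.
   Context: Fix an integer $n\ge1$, constants $0<\kappa<1$, $M_0>0$, $0<\delta_0<1$, and a bounded domain $\Omega\subset\mathbb{R}^n$. Points of $\mathbb{R}^{n+1}$ are written $X=(x,x_{n+1})$ with $x\in\mathbb{R}^n$ (likewise $Y=(y,y_{n+1})$, $Z=(z,z_{n+1})$, $X_0=(x_0,x_{0,n+1})$); $B_r(a)$ is the ball of radius $r$ centered at $a$, and $N_\mu(E)$ is the $\mu$-neighborhood of $E$ in $\mathbb{R}^{n+1}$. Set $C_\Omega=\Omega\times(0,M_0)$, $$c(X,Y)=|X-Y|+\kappa(x_{n+1}-y_{n+1}),$$ $$\phi(x,Y,X_0)=y_{n+1}-\frac{\kappa\,c(X_0,Y)}{1-\kappa^2}-\sqrt{\frac{c(X_0,Y)^2}{(1-\kappa^2)^2}-\frac{|x-y|^2}{1-\kappa^2}}\quad\text{for } |x-y|\le \frac{c(X_0,Y)}{\sqrt{1-\kappa^2}}.$$ $D_x\phi$ is the gradient in $x$. Let $\mathcal T$ be the set of $Y\in\mathbb{R}^{n+1}$ such that for every $X_0\in C_\Omega$: $x_{0,n+1}\le y_{n+1}-\frac{\kappa c(X_0,Y)}{1-\kappa^2}$ and $\Omega\subset B_{\delta_0c(X_0,Y)/\sqrt{1-\kappa^2}}(y)$.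 For $v\in\mathbb{R}^n$ let $$Q(v)=\frac{\sqrt{1+(1-\kappa^2)|v|^2}-\kappa}{1+|v|^2},\qquad \Lambda(v)=(-Q(v)v,\;Q(v)+\kappa),$$ a unit vector. Target: $\Sigma\subset\mathbb{R}^{n+1}$ is a domain contained in an $n$-dimensional surface, its convex hull is contained in $\mathcal T$, and for each $X\in C_\Omega$ every $Y\in\Sigma$ is represented parametrically from $X$ as $Y=X+s_X(\Lambda)\Lambda$, $|\Lambda|=1$, where the positive function $s_X$ varies with $X$ and, for each $X\in C_\Omega$, is Lipschitz in $\Lambda$. For $\bar Y,\hat Y\in\Sigma$ and $Z\in C_\Omega$ put $\bar v=D_x\phi(z,\bar Y,Z)$, $\hat v=D_x\phi(z,\hat Y,Z)$, $v(\lambda)=(1-\lambda)\bar v+\lambda\hat v$, $Y_Z(\lambda)=Z+s_Z(\Lambda(v(\lambda)))\Lambda(v(\lambda))$, and $[\bar Y,\hat Y]_Z=\Sigma\cap\{Z+s\Lambda(v(\lambda)):s>0,\lambda\in[0,1]\}$. Points of $[\bar Y,\hat Y]_Z$ have the form $Y_Z(\lambda)$, $0\le\lambda\le1$; in the claim $Y(\lambda)$ denotes $Y_{X_0^\star}(\lambda)$. Regularity of the target: $\Sigma$ is regular from $X_0\in C_\Omega$ if there exist a neighborhood $U_{X_0}$ of $X_0$ and positive constants $c_1,c_2$, depending on $U_{X_0}$, such that for all $\bar Y,\hat Y\in\Sigma$, $Z\in U_{X_0}$, $1/4\le\lambda\le3/4$ and $x\in\Omega$ with $|x-z|\le c_2$,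 $$\phi(x,Y_Z(\lambda),Z)\ge\min\{\phi(x,\bar Y,Z),\phi(x,\hat Y,Z)\}+c_1|\bar Y-\hat Y|^2|x-z|^2.$$ Parallel refractor: a function $u:\Omega\to[0,M_0]$ such that for every $x_0\in\Omega$ the set $F_u(x_0)=\{Y\in\Sigma: u(x)\le\phi(x,Y,X_0)\ \text{for all }x\in\Omega\}$, $X_0=(x_0,u(x_0))$, is nonempty. For $B\subset\Omega$, $F_u(B)=\bigcup_{x\in B}F_u(x)$. A structural constant here depends only on the bounds for the derivatives of $\phi$. *)

theory Defs
  imports "HOL-Analysis.Analysis"
begin

text \<open>Points \<open>X = (x, x\<^sub>n\<^sub>+\<^sub>1)\<close> of \<open>(n+1)\<close>-dimensional space are pairs of type \<open>(real ^ 'n) \<times> real\<close>; the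
  norm of the product type is the Euclidean one.\<close>

type_synonym 'n point = "(real ^ 'n) \<times> real"

definition cyl :: "real \<Rightarrow> (real ^ 'n::finite) set \<Rightarrow> 'n point set" where
  "cyl M\<^sub>0 \<Omega> = \<Omega> \<times> {0<..<M\<^sub>0}"

definition cost :: "real \<Rightarrow> 'n::finite point \<Rightarrow> 'n point \<Rightarrow> real" where
  "cost \<kappa> X Y = norm (X - Y) + \<kappa> * (snd X - snd Y)"

text \<open>The formula is meaningful only for \<open>norm (x - fst Y) \<le> cost \<kappa> X0 Y / sqrt (1 - \<kappa>\<^sup>2)\<close>. This holds
  whenever \<open>x \<in> \<Omega>\<close>, \<open>Y \<in> admissible \<kappa> M\<^sub>0 \<delta>\<^sub>0 \<Omega>\<close> and \<open>X0\<close> lies in the closure of \<open>cyl M\<^sub>0 \<Omega>\<close>, and \<open>phi\<close>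
  is evaluated below only at such arguments (or near them, to take the gradient).\<close>

definition phi :: "real \<Rightarrow> real ^ 'n::finite \<Rightarrow> 'n point \<Rightarrow> 'n point \<Rightarrow> real" where
  "phi \<kappa> x Y X0 =
     snd Y - \<kappa> * cost \<kappa> X0 Y / (1 - \<kappa>\<^sup>2)
       - sqrt ((cost \<kappa> X0 Y)\<^sup>2 / (1 - \<kappa>\<^sup>2)\<^sup>2 - (norm (x - fst Y))\<^sup>2 / (1 - \<kappa>\<^sup>2))"

definition grad :: "('a::real_inner \<Rightarrow> real) \<Rightarrow> 'a \<Rightarrow> 'a" where
  "grad f x = (THE D. GDERIV f x :> D)"

definition admissible :: "real \<Rightarrow> real \<Rightarrow> real \<Rightarrow> (real ^ 'n::finite) set \<Rightarrow> 'n point set" where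
  "admissible \<kappa> M\<^sub>0 \<delta>\<^sub>0 \<Omega> =
     {Y. \<forall>X0 \<in> cyl M\<^sub>0 \<Omega>.
           snd X0 \<le> snd Y - \<kappa> * cost \<kappa> X0 Y / (1 - \<kappa>\<^sup>2) \<and>
           \<Omega> \<subseteq> ball (fst Y) (\<delta>\<^sub>0 * cost \<kappa> X0 Y / sqrt (1 - \<kappa>\<^sup>2))}"

definition Q :: "real \<Rightarrow> real ^ 'n::finite \<Rightarrow> real" where
  "Q \<kappa> v = (sqrt (1 + (1 - \<kappa>\<^sup>2) * (norm v)\<^sup>2) - \<kappa>) / (1 + (norm v)\<^sup>2)"

definition Lam :: "real \<Rightarrow> real ^ 'n::finite \<Rightarrow> 'n point" where
  "Lam \<kappa> v = (- (Q \<kappa> v *\<^sub>R v), Q \<kappa> v + \<kappa>)"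

text \<open>An \<open>n\<close>-dimensional surface is a subset that is locally homeomorphic to \<open>n\<close>-dimensional space; no
  smoothness is imposed. A domain in it is a nonempty, connected, relatively open subset.\<close>

definition hypersurface :: "'n::finite point set \<Rightarrow> bool" where
  "hypersurface S \<longleftrightarrow>
     (\<forall>P\<in>S. \<exists>V (W :: (real ^ 'n) set).
        openin (top_of_set S) V \<and> P \<in> V \<and> open W \<and> V homeomorphic W)"

definition domain_in_hypersurface :: "'n::finite point set \<Rightarrow> bool" where
  "domain_in_hypersurface \<Sigma> \<longleftrightarrow>
     (\<exists>S. hypersurface S \<and> openin (top_of_set S) \<Sigma> \<and> connected \<Sigma> \<and> \<Sigma> \<noteq> {})"

text \<open>The unit directions in which a point of \<open>\<Sigma>\<close> is seen from \<open>X\<close>: the domain of \<open>s\<^sub>X\<close>. Values of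
  \<open>s X\<close> off this set are irrelevant throughout.\<close>

definition dirs :: "'n::finite point set \<Rightarrow> 'n point \<Rightarrow> 'n point set" where
  "dirs \<Sigma> X = {\<Lambda>. norm \<Lambda> = 1 \<and> (\<exists>t>0. X + t *\<^sub>R \<Lambda> \<in> \<Sigma>)}"

definition target ::
  "real \<Rightarrow> real \<Rightarrow> real \<Rightarrow> (real ^ 'n) set \<Rightarrow> 'n::finite point set \<Rightarrow> ('n point \<Rightarrow> 'n point \<Rightarrow> real) \<Rightarrow> bool"
where
  "target \<kappa> M\<^sub>0 \<delta>\<^sub>0 \<Omega> \<Sigma> s \<longleftrightarrow>
     domain_in_hypersurface \<Sigma> \<and>
     convex hull \<Sigma> \<subseteq> admissible \<kappa> M\<^sub>0 \<delta>\<^sub>0 \<Omega> \<and>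
     (\<forall>X \<in> cyl M\<^sub>0 \<Omega>.
        (\<forall>\<Lambda> \<in> dirs \<Sigma> X. 0 < s X \<Lambda>) \<and>
        (\<exists>L. L-lipschitz_on (dirs \<Sigma> X) (s X)) \<and>
        (\<forall>Y \<in> \<Sigma>. \<exists>\<Lambda> \<in> dirs \<Sigma> X. Y = X + s X \<Lambda> *\<^sub>R \<Lambda>))"

definition vseg :: "real \<Rightarrow> 'n::finite point \<Rightarrow> 'n point \<Rightarrow> 'n point \<Rightarrow> real \<Rightarrow> real ^ 'n" where
  "vseg \<kappa> Ya Yb Z l =
     (1 - l) *\<^sub>R grad (\<lambda>x. phi \<kappa> x Ya Z) (fst Z) + l *\<^sub>R grad (\<lambda>x. phi \<kappa> x Yb Z) (fst Z)"

definition Ycurve ::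
  "real \<Rightarrow> ('n point \<Rightarrow> 'n point \<Rightarrow> real) \<Rightarrow> 'n::finite point \<Rightarrow> 'n point \<Rightarrow> 'n point \<Rightarrow> real \<Rightarrow> 'n point" where
  "Ycurve \<kappa> s Ya Yb Z l =
     (let \<Lambda> = Lam \<kappa> (vseg \<kappa> Ya Yb Z l) in Z + s Z \<Lambda> *\<^sub>R \<Lambda>)"

definition Yseg ::
  "real \<Rightarrow> 'n::finite point set \<Rightarrow> 'n point \<Rightarrow> 'n point \<Rightarrow> 'n point \<Rightarrow> 'n point set" where
  "Yseg \<kappa> \<Sigma> Ya Yb Z =
     \<Sigma> \<inter> {Z + t *\<^sub>R Lam \<kappa> (vseg \<kappa> Ya Yb Z l) | t l. 0 < t \<and> l \<in> {0..1}}"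

text \<open>For given \<open>l\<close> the point \<open>Ycurve \<kappa> s Ya Yb Z l\<close> is defined only if the corresponding direction
  meets \<open>\<Sigma>\<close>, i.e. if the point lies in \<open>Yseg \<kappa> \<Sigma> Ya Yb Z\<close>; the inequality is required for those \<open>l\<close>.\<close>

definition regular_from ::
  "real \<Rightarrow> real \<Rightarrow> (real ^ 'n) set \<Rightarrow> 'n::finite point set \<Rightarrow> ('n point \<Rightarrow> 'n point \<Rightarrow> real) \<Rightarrow> 'n point \<Rightarrow> bool"
where
  "regular_from \<kappa> M\<^sub>0 \<Omega> \<Sigma> s X0 \<longleftrightarrow>
     (\<exists>U c1 c2. open U \<and> X0 \<in> U \<and> 0 < c1 \<and> 0 < c2 \<and>
        (\<forall>Ya\<in>\<Sigma>. \<forall>Yb\<in>\<Sigma>. \<forall>Z \<in> U \<inter> cyl M\<^sub>0 \<Omega>. \<forall>l\<in>{1/4..3/4}. \<forall>x\<in>\<Omega>.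
           Ycurve \<kappa> s Ya Yb Z l \<in> Yseg \<kappa> \<Sigma> Ya Yb Z \<longrightarrow> norm (x - fst Z) \<le> c2 \<longrightarrow>
           phi \<kappa> x (Ycurve \<kappa> s Ya Yb Z l) Z
             \<ge> min (phi \<kappa> x Ya Z) (phi \<kappa> x Yb Z) + c1 * (norm (Ya - Yb))\<^sup>2 * (norm (x - fst Z))\<^sup>2))"

definition F ::
  "real \<Rightarrow> (real ^ 'n) set \<Rightarrow> 'n::finite point set \<Rightarrow> (real ^ 'n \<Rightarrow> real) \<Rightarrow> real ^ 'n \<Rightarrow> 'n point set" where
  "F \<kappa> \<Omega> \<Sigma> u x0 = {Y \<in> \<Sigma>. \<forall>x\<in>\<Omega>. u x \<le> phi \<kappa> x Y (x0, u x0)}"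

definition parallel_refractor ::
  "real \<Rightarrow> real \<Rightarrow> (real ^ 'n) set \<Rightarrow> 'n::finite point set \<Rightarrow> (real ^ 'n \<Rightarrow> real) \<Rightarrow> bool" where
  "parallel_refractor \<kappa> M\<^sub>0 \<Omega> \<Sigma> u \<longleftrightarrow> u ` \<Omega> \<subseteq> {0..M\<^sub>0} \<and> (\<forall>x0\<in>\<Omega>. F \<kappa> \<Omega> \<Sigma> u x0 \<noteq> {})"

definition nbhd :: "real \<Rightarrow> 'a::metric_space set \<Rightarrow> 'a set" where
  "nbhd \<mu> E = (\<Union>P\<in>E. ball P \<mu>)"

end

theory Submission
  imports Defs
begin

text \<open>For a target point \<open>Y\<close> seen from \<open>X = (x, t)\<close> let \<open>\<sigma> = y\<^sub>n\<^sub>+\<^sub>1 - t - \<kappa> |X - Y|\<close>, \<open>v = (x - y) / \<sigma>\<close>, which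
is the gradient of \<open>\<phi>(-, Y, X)\<close> at \<open>x\<close>, and \<open>k = 1 - \<kappa>\<^sup>2\<close>. Squaring the equation
\<open>c(X\<^sub>1, Y) = c(X, Y)\<close> of the ellipsoid with focus \<open>Y\<close> through \<open>X\<close> turns it into \<open>gap = 0\<close>, where
for \<open>X\<^sub>1 = (x\<^sub>1, t\<^sub>1)\<close>
  \<open>gap = (x\<^sub>1 - x) \<bullet> v + (|x\<^sub>1 - x|\<^sup>2 + k (t\<^sub>1 - t)\<^sup>2) / (2 \<sigma>) - (t\<^sub>1 - t)\<close>.
The three quantities \<open>\<phi>(x\<^sub>1, Y, X) - t\<^sub>1\<close>, \<open>c(X\<^sub>1, Y) - c(X, Y)\<close> and \<open>gap\<close> have the same sign and
are comparable with structural constants (\<open>phi_cost_ratio\<close>, \<open>cost_gap_ratio\<close>). In particular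
\<open>F\<^sub>u(x)\<close> consists of those \<open>Y\<close> for which the cost \<open>c(-, Y)\<close>, restricted to the graph of \<open>u\<close>, is
minimal over \<open>x\<close> (\<open>F_iff_cost\<close>), and \<open>u\<close> is Lipschitz with a structural constant.

The estimate. One may take for \<open>x\<^sub>0\<close> the first of the two given points, \<open>x\<^sub>a\<close>. The support
of \<open>u\<close> at \<open>x\<^sub>a\<close> with target \<open>Y\<^sub>a\<close> passes through \<open>X\<^sub>a = (x\<^sub>a, u x\<^sub>a)\<close>. For the other target \<open>Y\<^sub>b\<close>, the support
that passes through \<open>X\<^sub>b\<close> differs from the one through \<open>X\<^sub>a\<close> by the mixed second difference of
\<open>|X - Y|\<close>, hence by at most \<open>C |Y\<^sub>a - Y\<^sub>b| |x\<^sub>a - x\<^sub>b|\<close> (\<open>support_cost_comparison\<close>). So both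
\<open>\<phi>(-, Y\<^sub>a, X\<^sub>a)\<close> and \<open>\<phi>(-, Y\<^sub>b, X\<^sub>a)\<close> bound \<open>u\<close> up to this error, regularity of the target bounds
\<open>u\<close> by \<open>\<phi>(-, Y(\<lambda>), X\<^sub>a)\<close> with a quadratic gain, and replacing \<open>Y(\<lambda>)\<close> by \<open>Y\<close> changes the gap by
at most \<open>C |Y(\<lambda>) - Y| |x - x\<^sub>0|\<close> (\<open>gap_change_target\<close>).

The inclusion. With \<open>M = 1 + 2 C / C\<^sub>1\<close> the estimate makes \<open>u - \<phi>(-, Y, X\<^sub>a)\<close> negative at distance
at least \<open>\<eta>\<close> from \<open>x\<^sub>0\<close> (\<open>quadratic_dominates\<close>). Then the cost \<open>c(-, Y)\<close> on the graph of \<open>u\<close>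
attains its minimum over the closed \<open>\<eta>\<close>-ball in the open ball, and this minimum is global, so
\<open>Y\<close> supports \<open>u\<close> there (\<open>support_by_sliding\<close>).

This needs the negativity on all of \<open>\<Omega>\<close>, whereas regularity speaks only about \<open>x\<close> near \<open>x\<^sub>0\<close>. The
step from local to global has two different reasons.

If \<open>n \<ge> 2\<close>, the gap is affine in the pair \<open>(v, 1 / (2 \<sigma>))\<close>. Small spheres are connected, so
arbitrarily near \<open>x\<^sub>0\<close> the supports with targets \<open>Y\<^sub>a\<close> and \<open>Y\<^sub>b\<close> cross. Regularity at such a point
gives that \<open>1 / (2 \<sigma>)\<close> at \<open>Y(\<lambda>)\<close> exceeds the interpolated value by a multiple of
\<open>|Y\<^sub>a - Y\<^sub>b|\<^sup>2\<close> (\<open>curvature_concave\<close>). The point \<open>x\<close> does not occur in this condition, which therefore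
gives the gap estimate for every \<open>x\<close> (\<open>gap_lower_global\<close>).

If \<open>n = 1\<close>, the visibility of the target decides. If the cost \<open>c(-, Y)\<close> on the graph of \<open>u\<close> were
larger at an interior point of an interval than at both ends, the ellipse with focus \<open>Y\<close> and a
supporting ellipse of \<open>u\<close> with focus \<open>Y'\<close> would meet in two points \<open>A\<close>, \<open>B\<close>. Then \<open>Y\<close> and \<open>Y'\<close> lie
on one branch of a hyperbola with foci \<open>A\<close>, \<open>B\<close>, and the line through them meets the open segment
\<open>AB\<close> (\<open>hyperbola_secant\<close>): some point of the cylinder sees \<open>Y\<close> and \<open>Y'\<close> in the same direction,
which the parametrisation of the target excludes (\<open>one_dim_cost_no_interior_max\<close>).\<close>

section \<open>Distances, gradients and visibility\<close>

lemma norm_point_sq: "(norm (X :: 'n::finite point))\<^sup>2 = (norm (fst X))\<^sup>2 + (snd X)\<^sup>2"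
  by (simp add: norm_prod_def)

text \<open>\<open>|X - Y| - |X' - Y|\<close> is the inner product of \<open>X - X'\<close> with a vector that depends on \<open>Y\<close> in a
Lipschitz way as long as \<open>Y\<close> keeps the distance \<open>s\<close> from \<open>X\<close> and \<open>X'\<close>. This bilinear bound is
the source of the product \<open>|Y\<^sub>a - Y\<^sub>b| |x\<^sub>a - x\<^sub>b|\<close> in the estimate.\<close>

lemma norm_mixed_difference:
  fixes X X' Y Y' :: "'a::real_inner"
  assumes "0 < s" "s \<le> norm (X - Y')" "s \<le> norm (X' - Y')" "s \<le> norm (X - Y)"
  shows "(norm (X - Y) - norm (X' - Y)) - (norm (X - Y') - norm (X' - Y'))
           \<le> 2 / s * norm (X - X') * norm (Y - Y')"
proof -
  define D where "D Z = norm (X - Z) + norm (X' - Z)" for Z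
  define N where "N Z = (X - Z) + (X' - Z)" for Z
  define q where "q Z = (1 / D Z) *\<^sub>R N Z" for Z
  have DY: "D Y > 0" "D Y' \<ge> 2 * s" "D Y' > 0"
    using assms norm_ge_zero[of "X' - Y"] unfolding D_def by linarith+
  have split: "norm (X - Z) - norm (X' - Z) = inner (X - X') (q Z)" if "D Z > 0" for Z
  proof -
    have "inner (X - X') (N Z) = (norm (X - Z))\<^sup>2 - (norm (X' - Z))\<^sup>2"
      by (simp add: N_def power2_norm_eq_inner inner_diff_left inner_diff_right inner_add_right inner_commute)
    also have "\<dots> = (norm (X - Z) - norm (X' - Z)) * D Z"
      by (simp add: D_def power2_eq_square algebra_simps)
    finally show ?thesis using that by (simp add: q_def field_simps)
  qed
  have NZ: "norm (N Y) \<le> D Y" by (simp add: N_def D_def norm_triangle_ineq)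
  have NN: "norm (N Y - N Y') \<le> 2 * norm (Y - Y')"
  proof -
    have "N Y - N Y' = - (2 *\<^sub>R (Y - Y'))" by (simp add: N_def scaleR_2)
    then show ?thesis by simp
  qed
  have DD: "\<bar>D Y' - D Y\<bar> \<le> 2 * norm (Y - Y')"
    using norm_triangle_ineq3[of "X - Y'" "X - Y"] norm_triangle_ineq3[of "X' - Y'" "X' - Y"]
    unfolding D_def by simp
  have "1 / D Y = 1 / D Y' + (D Y' - D Y) / (D Y * D Y')"
    using DY by (simp add: field_simps)
  then have "q Y = (1 / D Y') *\<^sub>R N Y + ((D Y' - D Y) / (D Y * D Y')) *\<^sub>R N Y"
    unfolding q_def by (metis scaleR_left_distrib)
  then have "q Y - q Y' = (1 / D Y') *\<^sub>R (N Y - N Y') + ((D Y' - D Y) / (D Y * D Y')) *\<^sub>R N Y"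
    by (simp add: q_def[of Y'] scaleR_right_diff_distrib)
  then have "norm (q Y - q Y') \<le> norm (N Y - N Y') / D Y' + \<bar>D Y' - D Y\<bar> * norm (N Y) / (D Y * D Y')"
    using norm_triangle_ineq[of "(1 / D Y') *\<^sub>R (N Y - N Y')" "((D Y' - D Y) / (D Y * D Y')) *\<^sub>R N Y"] DY
    by (simp add: abs_mult)
  also have "\<dots> \<le> 2 * norm (Y - Y') / D Y' + 2 * norm (Y - Y') * D Y / (D Y * D Y')"
    using DY NN NZ DD by (intro add_mono divide_right_mono mult_mono) auto
  also have "\<dots> = 4 * norm (Y - Y') / D Y'" using DY by simp
  also have "\<dots> \<le> 4 * norm (Y - Y') / (2 * s)" using DY assms by (intro divide_left_mono) auto
  finally have q: "norm (q Y - q Y') \<le> 2 / s * norm (Y - Y')" by (simp add: mult.commute)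
  have "(norm (X - Y) - norm (X' - Y)) - (norm (X - Y') - norm (X' - Y')) = inner (X - X') (q Y - q Y')"
    using split DY by (simp add: inner_diff_right)
  also have "\<dots> \<le> norm (X - X') * norm (q Y - q Y')" by (rule norm_cauchy_schwarz)
  also have "\<dots> \<le> norm (X - X') * (2 / s * norm (Y - Y'))" using q by (intro mult_left_mono) auto
  finally show ?thesis by (simp add: mult_ac)
qed

lemma grad_eqI: "GDERIV f x :> D \<Longrightarrow> grad f x = D"
  unfolding grad_def
proof (rule the_equality)
  fix D' assume "GDERIV f x :> D" "GDERIV f x :> D'"
  then have "(\<lambda>h. inner h D) = (\<lambda>h. inner h D')"
    unfolding gderiv_def by (rule has_derivative_unique)
  then have "inner (D' - D) (D' - D) = 0" by (metis inner_diff_right diff_self)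
  then show "D' = D" by simp
qed

lemma continuous_on_phi: "continuous_on S (\<lambda>x. phi \<kappa> x Y X)"
  unfolding phi_def divide_inverse by (intro continuous_intros)

text \<open>\<open>s X\<close> is a function of the direction, so a ray from a point of the cylinder meets the target at
most once.\<close>

lemma visible_point_unique:
  assumes "target \<kappa> M\<^sub>0 \<delta>\<^sub>0 \<Omega> \<Sigma> s" "X \<in> cyl M\<^sub>0 \<Omega>" "Y \<in> \<Sigma>" "Y' \<in> \<Sigma>"
    and "0 < r" "Y' - X = r *\<^sub>R (Y - X)"
  shows "Y' = Y"
proof -
  have tgt: "\<forall>\<Lambda>\<in>dirs \<Sigma> X. 0 < s X \<Lambda>" "\<forall>Y\<in>\<Sigma>. \<exists>\<Lambda>\<in>dirs \<Sigma> X. Y = X + s X \<Lambda> *\<^sub>R \<Lambda>"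
    using assms(1,2) by (simp_all add: target_def)
  have dir: "sgn (Z - X) \<in> dirs \<Sigma> X \<and> Z = X + s X (sgn (Z - X)) *\<^sub>R sgn (Z - X)" if "Z \<in> \<Sigma>" for Z
  proof -
    from tgt(2) that obtain \<Lambda> where \<Lambda>: "\<Lambda> \<in> dirs \<Sigma> X" "Z = X + s X \<Lambda> *\<^sub>R \<Lambda>"
      by (elim ballE bexE) auto
    note L = \<Lambda> tgt(1)[rule_format, OF \<Lambda>(1)]
    have "norm \<Lambda> = 1" using L(1) by (simp add: dirs_def)
    moreover have "Z - X = s X \<Lambda> *\<^sub>R \<Lambda>" using L(2) by (metis add_diff_cancel_left')
    ultimately have "sgn (Z - X) = \<Lambda>" using L(3) by (simp add: sgn_div_norm)
    with L show ?thesis by metis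
  qed
  have "sgn (Y' - X) = sgn (Y - X)" using assms(5,6) by (simp add: sgn_scaleR)
  with dir assms(3,4) show ?thesis by metis
qed

section \<open>Chords of a hyperbola\<close>

text \<open>The foci are \<open>0\<close> and \<open>(z, w)\<close> at distance \<open>p\<close>; \<open>d\<close> and \<open>g\<close> are \<open>p\<close> times the coordinates of
\<open>(y, h)\<close> across and along the focal axis, and \<open>R\<close> is its focal distance shifted so that the branch
becomes \<open>d\<^sup>2 = E (R\<^sup>2 - p\<^sup>2 / 4)\<close>, \<open>g = p\<^sup>2 / 2 + q R\<close>. The line through two points of the branch cuts
the axis where \<open>d = 0\<close>, that is at \<open>g = p\<^sup>2 / 2 + q N\<close> with \<open>N\<close> the zero of the chord in the
\<open>(R, d)\<close>-plane. As a function of \<open>R \<ge> p / 2\<close>, \<open>d\<close> is concave and vanishes at \<open>p / 2\<close>, whence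
\<open>N \<le> p / 2\<close>, while \<open>d / R\<close> is increasing, whence \<open>N \<ge> 0\<close>. Finally \<open>|q| < p\<close> places the
intersection strictly between the foci.\<close>

lemma hyperbola_secant_aux:
  fixes z w y h y' h' :: real
  defines "p \<equiv> sqrt (z\<^sup>2 + w\<^sup>2)" and "d \<equiv> z * h - w * y" and "g \<equiv> z * y + w * h"
    and "d' \<equiv> z * h' - w * y'" and "g' \<equiv> z * y' + w * h'"
  assumes p: "0 < p" and q: "\<bar>q\<bar> < p" and E: "E = p\<^sup>2 - q\<^sup>2"
    and R: "p / 2 < R" "R < R'" and dpos: "0 < d" "0 < d'"
    and d: "d\<^sup>2 = E * (R\<^sup>2 - p\<^sup>2 / 4)" "d'\<^sup>2 = E * (R'\<^sup>2 - p\<^sup>2 / 4)"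
    and g: "g = p\<^sup>2 / 2 + q * R" "g' = p\<^sup>2 / 2 + q * R'"
  shows "\<exists>t r. 0 < t \<and> t < 1 \<and> 0 < r \<and> y' - t * z = r * (y - t * z) \<and> h' - t * w = r * (h - t * w)"
proof -
  have pp: "z\<^sup>2 + w\<^sup>2 = p\<^sup>2" by (simp add: p_def)
  have q2: "q\<^sup>2 < p\<^sup>2" using q p by (metis abs_ge_zero power2_abs power_strict_mono zero_less_numeral pos2)
  have E0: "0 < E" using q2 E by simp
  have R0: "0 < R" "0 < R'" using p R by linarith+
  have RR: "R\<^sup>2 < R'\<^sup>2" using R R0 by (intro power_strict_mono) auto
  have "d\<^sup>2 < d'\<^sup>2" unfolding d using E0 RR by simp
  then have dd: "d < d'" using dpos by (simp add: power2_less_imp_less)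
  define N where "N = (R * d' - R' * d) / (d' - d)"
  have N0: "0 \<le> N"
  proof -
    have "(R' * d)\<^sup>2 \<le> (R * d')\<^sup>2"
    proof -
      have "(R * d')\<^sup>2 - (R' * d)\<^sup>2 = E * (p\<^sup>2 / 4) * (R'\<^sup>2 - R\<^sup>2)"
        unfolding power_mult_distrib d by (simp add: algebra_simps)
      moreover have "0 \<le> E * (p\<^sup>2 / 4) * (R'\<^sup>2 - R\<^sup>2)" using E0 RR by simp
      ultimately show ?thesis by linarith
    qed
    moreover have "0 \<le> R * d'" using R0(1) dpos(2) by (simp only: mult_nonneg_nonneg less_imp_le)
    ultimately have "R' * d \<le> R * d'" by (rule power2_le_imp_le)
    then show ?thesis unfolding N_def using dd by (intro divide_nonneg_nonneg) linarith+
  qed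
  have Np: "N \<le> p / 2"
  proof -
    have "((R - p / 2) * d')\<^sup>2 \<le> ((R' - p / 2) * d)\<^sup>2"
    proof -
      have "((R' - p / 2) * d)\<^sup>2 - ((R - p / 2) * d')\<^sup>2
          = E * ((R' - p / 2) * (R - p / 2)) * (p * (R' - R))"
        unfolding power_mult_distrib d by (simp add: power2_eq_square field_simps)
      moreover have "0 \<le> E * ((R' - p / 2) * (R - p / 2)) * (p * (R' - R))" using E0 R p by simp
      ultimately show ?thesis by linarith
    qed
    moreover have "0 \<le> (R' - p / 2) * d" using R dpos(1) by (intro mult_nonneg_nonneg) linarith+
    ultimately have "(R - p / 2) * d' \<le> (R' - p / 2) * d" by (rule power2_le_imp_le)
    then have "R * d' - R' * d \<le> p / 2 * (d' - d)" by (simp add: left_diff_distrib right_diff_distrib)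
    then show ?thesis unfolding N_def using dd by (simp only: pos_divide_le_eq diff_gt_0_iff_gt)
  qed
  define T where "T = p\<^sup>2 / 2 + q * N"
  have "\<bar>q * N\<bar> < p * (p / 2)"
  proof (cases "N = 0")
    case False
    then have "\<bar>q\<bar> * \<bar>N\<bar> < p * N" using q N0 by simp
    also have "\<dots> \<le> p * (p / 2)" using Np p by (intro mult_left_mono) auto
    finally show ?thesis by (simp add: abs_mult)
  qed (use p in simp)
  then have T: "0 < T" "T < p\<^sup>2" unfolding T_def by (simp_all add: power2_eq_square abs_less_iff)
  have p2: "0 < p\<^sup>2" using p by simp
  define t where "t = T / p\<^sup>2"
  have tp: "t * p\<^sup>2 = T" using p2 by (simp add: t_def)
  define r where "r = d' / d"
  have key: "g' - T = r * (g - T)"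
  proof -
    have Nd: "N * (d' - d) = R * d' - R' * d" using dd by (simp add: N_def)
    have "(g' - T) * d - d' * (g - T) = q * (N * (d' - d) - (R * d' - R' * d))"
      by (simp add: g T_def algebra_simps)
    then have "(g' - T) * d = d' * (g - T)" by (simp add: Nd)
    then show ?thesis using dpos by (simp add: r_def field_simps)
  qed
  have rd: "d' = r * d" using dpos by (simp add: r_def)
  \<comment> \<open>The coordinates \<open>(y, h)\<close> are recovered from the components along and across the axis.\<close>
  have dec: "(y - t * z) * p\<^sup>2 = (g - T) * z - d * w" "(h - t * w) * p\<^sup>2 = (g - T) * w + d * z"
    "(y' - t * z) * p\<^sup>2 = (g' - T) * z - d' * w" "(h' - t * w) * p\<^sup>2 = (g' - T) * w + d' * z"
    unfolding tp[symmetric] pp[symmetric] g_def d_def g'_def d'_def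
    by (simp_all add: power2_eq_square algebra_simps)
  have "(y' - t * z) * p\<^sup>2 = (r * (y - t * z)) * p\<^sup>2" "(h' - t * w) * p\<^sup>2 = (r * (h - t * w)) * p\<^sup>2"
    unfolding mult.assoc dec unfolding key rd by (simp_all add: algebra_simps)
  then have "y' - t * z = r * (y - t * z)" "h' - t * w = r * (h - t * w)" using p2 by simp_all
  moreover have "0 < t" "t < 1" "0 < r" using T p2 dpos by (simp_all add: t_def r_def)
  ultimately show ?thesis by blast
qed

text \<open>The two cost equalities say that both points lie on one branch of the hyperbola with foci \<open>0\<close> and
\<open>(z, w)\<close> and difference of focal distances \<open>\<kappa> w\<close>. The inequalities, which for admissible points
express the positivity of \<open>\<sigma>\<close>, place both on the same side of the focal axis, namely above it;
without this the chord could pass beyond a focus.\<close>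

lemma hyperbola_secant:
  fixes z w y h y' h' \<kappa> :: real
  assumes z: "0 < z" and kap: "0 < \<kappa>" "\<kappa> < 1"
    and c: "sqrt (y\<^sup>2 + h\<^sup>2) = sqrt ((z - y)\<^sup>2 + (w - h)\<^sup>2) + \<kappa> * w"
    and c': "sqrt (y'\<^sup>2 + h'\<^sup>2) = sqrt ((z - y')\<^sup>2 + (w - h')\<^sup>2) + \<kappa> * w"
    and s: "\<kappa> * sqrt (y\<^sup>2 + h\<^sup>2) < h" "\<kappa> * sqrt ((z - y)\<^sup>2 + (w - h)\<^sup>2) < h - w"
    and s': "\<kappa> * sqrt (y'\<^sup>2 + h'\<^sup>2) < h'" "\<kappa> * sqrt ((z - y')\<^sup>2 + (w - h')\<^sup>2) < h' - w"
    and ne: "y \<noteq> y' \<or> h \<noteq> h'"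
  shows "\<exists>t r. 0 < t \<and> t < 1 \<and> 0 < r \<and> y' - t * z = r * (y - t * z) \<and> h' - t * w = r * (h - t * w)"
proof -
  define p where "p = sqrt (z\<^sup>2 + w\<^sup>2)"
  define q where "q = \<kappa> * w"
  define E where "E = p\<^sup>2 - q\<^sup>2"
  have pp: "p\<^sup>2 = z\<^sup>2 + w\<^sup>2" by (simp add: p_def)
  have p: "0 < p" using z by (simp add: p_def add_pos_nonneg)
  have wp: "\<bar>w\<bar> \<le> p" unfolding p_def by (rule real_le_rsqrt) simp
  have q: "\<bar>q\<bar> < p"
  proof (cases "w = 0")
    case False
    then have "\<kappa> * \<bar>w\<bar> < 1 * \<bar>w\<bar>" using kap by (intro mult_strict_right_mono) auto
    then show ?thesis using wp kap by (simp add: q_def abs_mult)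
  qed (use p in \<open>simp add: q_def\<close>)
  have Epos: "0 < E" using q p unfolding E_def
    by (metis abs_of_pos diff_gt_0_iff_gt abs_less_iff power2_abs abs_ge_zero power_strict_mono pos2)
  have main: "g = p\<^sup>2 / 2 + q * R \<and> d\<^sup>2 = E * (R\<^sup>2 - p\<^sup>2 / 4) \<and> 0 < d \<and> p / 2 < R"
    if c: "sqrt (y\<^sup>2 + h\<^sup>2) = sqrt ((z - y)\<^sup>2 + (w - h)\<^sup>2) + \<kappa> * w"
      and s: "\<kappa> * sqrt (y\<^sup>2 + h\<^sup>2) < h" "\<kappa> * sqrt ((z - y)\<^sup>2 + (w - h)\<^sup>2) < h - w"
      and defs: "R = sqrt (y\<^sup>2 + h\<^sup>2) - q / 2" "d = z * h - w * y" "g = z * y + w * h"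
    for y h R d g
  proof -
    define S where "S = sqrt (y\<^sup>2 + h\<^sup>2)"
    define S1 where "S1 = sqrt ((z - y)\<^sup>2 + (w - h)\<^sup>2)"
    have SS: "S\<^sup>2 = y\<^sup>2 + h\<^sup>2" "S1\<^sup>2 = (z - y)\<^sup>2 + (w - h)\<^sup>2" "0 \<le> S" "0 \<le> S1"
      by (simp_all add: S_def S1_def)
    have S1: "S1 = S - q" using c by (simp add: S_def S1_def q_def)
    have "(S - q)\<^sup>2 = S\<^sup>2 - 2 * g + p\<^sup>2"
      using SS(1,2) unfolding S1 defs pp by (simp add: power2_eq_square algebra_simps)
    then have g2: "2 * g = E + 2 * (q * S)" by (simp add: E_def power2_eq_square algebra_simps)
    then have g: "g = E / 2 + q * S" by simp
    have RS: "S = R + q / 2" by (simp add: defs S_def)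
    have g': "g = p\<^sup>2 / 2 + q * R" unfolding g RS E_def by (simp add: power2_eq_square field_simps)
    have "d\<^sup>2 + g\<^sup>2 = p\<^sup>2 * S\<^sup>2" unfolding SS(1) pp defs by (simp add: power2_eq_square algebra_simps)
    then have "d\<^sup>2 = p\<^sup>2 * (R + q / 2)\<^sup>2 - (p\<^sup>2 / 2 + q * R)\<^sup>2" unfolding g' RS by simp
    also have "\<dots> = E * (R\<^sup>2 - p\<^sup>2 / 4)" by (simp add: E_def power2_eq_square field_simps)
    finally have d2: "d\<^sup>2 = E * (R\<^sup>2 - p\<^sup>2 / 4)" .
    have sg: "0 < h - \<kappa> * S" "0 < h - w - \<kappa> * S1" using s by (auto simp: S_def S1_def)
    have hw: "0 < h" "0 < h - w"
      using sg SS(3,4) kap by (meson diff_gt_0_iff_gt le_less_trans less_imp_le mult_nonneg_nonneg)+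
    have "0 < d"
    proof (cases "0 \<le> w")
      case True
      have "2 * (z * (z - y)) = E + 2 * w * (h - w - \<kappa> * S1)"
        using g2 unfolding S1 E_def pp defs q_def by (simp add: power2_eq_square algebra_simps)
      moreover have "0 \<le> 2 * w * (h - w - \<kappa> * S1)" using True sg by simp
      ultimately have "0 < z * (z - y)" using Epos by linarith
      then have "y < z" using z by (simp add: zero_less_mult_iff)
      then have "w * y \<le> w * z" using True by (intro mult_left_mono) auto
      also have "\<dots> < h * z" using hw z by simp
      finally show ?thesis by (simp add: defs mult.commute)
    next
      case False
      have "2 * (z * y) = E - 2 * w * (h - \<kappa> * S)"
        using g2 unfolding defs q_def by (simp add: algebra_simps)
      moreover have "w * (h - \<kappa> * S) < 0" using False sg by (simp add: mult_neg_pos)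
      ultimately have "0 < z * y" using Epos by linarith
      then have "0 < y" using z by (simp add: zero_less_mult_iff)
      then have "w * y < 0" using False by (simp add: mult_neg_pos)
      moreover have "0 < z * h" using z hw by simp
      ultimately show ?thesis by (simp add: defs)
    qed
    have "0 < E * (R\<^sup>2 - p\<^sup>2 / 4)" using \<open>0 < d\<close> d2 by (metis zero_less_power)
    then have "(p / 2)\<^sup>2 < R\<^sup>2" using Epos by (simp add: zero_less_mult_iff power_divide)
    then have "p / 2 < \<bar>R\<bar>" using p by (metis abs_of_pos half_gt_zero power2_abs power2_less_imp_less abs_ge_zero)
    moreover have "- (p / 2) < R" using RS SS(3) q by linarith
    ultimately show ?thesis using g' d2 \<open>0 < d\<close> by linarith
  qed
  define R where "R = sqrt (y\<^sup>2 + h\<^sup>2) - q / 2"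
  define R' where "R' = sqrt (y'\<^sup>2 + h'\<^sup>2) - q / 2"
  note m = main[OF c s R_def refl refl]
  note m' = main[OF c' s' R'_def refl refl]
  \<comment> \<open>\<open>R\<close> determines both coordinates, so equal values of \<open>R\<close> would mean equal points.\<close>
  consider "R < R'" | "R' < R" | "R = R'" by linarith
  then show ?thesis
  proof cases
    case 1
    then show ?thesis
      using m m' p q E_def by (intro hyperbola_secant_aux[of z w q E R R']) (auto simp: p_def)
  next
    case 2
    then obtain t r where tr: "0 < t" "t < 1" "0 < r" "y - t * z = r * (y' - t * z)" "h - t * w = r * (h' - t * w)"
      using hyperbola_secant_aux[of z w q E R' R h' y' h y] m m' p q E_def unfolding p_def by blast
    then show ?thesis by (intro exI[of _ t] exI[of _ "1 / r"]) auto
  next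
    case 3
    then have "(z * h - w * y)\<^sup>2 = (z * h' - w * y')\<^sup>2" using m m' by metis
    then have d: "z * h - w * y = z * h' - w * y'"
      using m m' by (intro power2_eq_imp_eq[OF \<open>(z * h - w * y)\<^sup>2 = (z * h' - w * y')\<^sup>2\<close>]) (simp_all add: less_imp_le)
    have g: "z * y + w * h = z * y' + w * h'" using m m' 3 by metis
    have "(y - y') * p\<^sup>2 = z * ((z * y + w * h) - (z * y' + w * h')) - w * ((z * h - w * y) - (z * h' - w * y'))"
      "(h - h') * p\<^sup>2 = w * ((z * y + w * h) - (z * y' + w * h')) + z * ((z * h - w * y) - (z * h' - w * y'))"
      unfolding pp by (simp_all add: power2_eq_square algebra_simps)
    then have "y = y'" "h = h'" using p unfolding d g by auto
    then show ?thesis using ne by simp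
  qed
qed

lemma one_dim_expand:
  fixes v e :: "real ^ 'n::finite"
  assumes "CARD('n) = 1" "norm e = 1"
  shows "v = inner v e *\<^sub>R e"
proof -
  obtain i :: 'n where i: "UNIV = {i}" using assms(1) by (rule card_1_singletonE)
  have "inner e e = 1" using assms(2) by (simp add: norm_eq_1)
  then have ee: "e $ i * e $ i = 1" by (simp add: inner_vec_def i)
  have "v $ j = (inner v e *\<^sub>R e) $ j" for j
  proof -
    have "j = i" using i by auto
    then show ?thesis using ee by (simp add: inner_vec_def i mult.assoc)
  qed
  then show ?thesis by (simp add: vec_eq_iff)
qed

section \<open>Cost, slope and gap\<close>

locale cylinder =
  fixes \<kappa> M\<^sub>0 \<delta>\<^sub>0 :: real and \<Omega> :: "(real ^ 'n::finite) set"
  assumes kap: "0 < \<kappa>" "\<kappa> < 1" and M0: "0 < M\<^sub>0" and del0: "0 < \<delta>\<^sub>0" "\<delta>\<^sub>0 < 1"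
    and dom: "open \<Omega>" "connected \<Omega>" "\<Omega> \<noteq> {}" "bounded \<Omega>"

begin

abbreviation k :: real where "k \<equiv> 1 - \<kappa>\<^sup>2"

abbreviation c :: "'n point \<Rightarrow> 'n point \<Rightarrow> real" where "c \<equiv> cost \<kappa>"

abbreviation adm :: "'n point set" where "adm \<equiv> admissible \<kappa> M\<^sub>0 \<delta>\<^sub>0 \<Omega>"

text \<open>The refractor may touch the bottom and the top of the cylinder, so heights range over the closed
interval.\<close>

abbreviation ccyl :: "'n point set" where "ccyl \<equiv> \<Omega> \<times> {0..M\<^sub>0}"

text \<open>For admissible \<open>Y\<close>, \<open>sig X Y\<close> is \<open>k\<close> times the square root in \<open>\<phi>(fst X, Y, X)\<close> (\<open>sig_sq\<close>); \<open>2 sig\<close> is the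
reciprocal of the coefficient of the quadratic term in the equation of the ellipsoid.\<close>

definition sig :: "'n point \<Rightarrow> 'n point \<Rightarrow> real" where
  "sig X Y = snd Y - snd X - \<kappa> * norm (X - Y)"

text \<open>The gradient of \<open>\<phi>(-, Y, X)\<close> at \<open>fst X\<close> (\<open>phi_gderiv\<close>).\<close>

definition slope :: "'n point \<Rightarrow> 'n point \<Rightarrow> real ^ 'n" where
  "slope X Y = (1 / sig X Y) *\<^sub>R (fst X - fst Y)"

text \<open>Its zero set is the ellipsoid \<open>c(-, Y) = c(X, Y)\<close> (\<open>gap_identity\<close>). It is affine in
\<open>(slope X Y, 1 / (2 sig X Y))\<close>, the only way in which it depends on \<open>Y\<close>.\<close>

definition gap :: "'n point \<Rightarrow> 'n point \<Rightarrow> 'n point \<Rightarrow> real" where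
  "gap X Y X1 = inner (fst X1 - fst X) (slope X Y)
     + ((norm (fst X1 - fst X))\<^sup>2 + k * (snd X1 - snd X)\<^sup>2) / (2 * sig X Y) - (snd X1 - snd X)"

text \<open>Lower bound for \<open>sig X Y / |X - Y|\<close>, the margin by which admissible points stay away from the
directions in which \<open>\<phi>\<close> becomes singular.\<close>

definition \<theta> :: real where "\<theta> = sqrt (1 - \<delta>\<^sub>0\<^sup>2) * (1 - \<kappa>)"

lemma k_bounds: "0 < k" "k < 1"
  using kap by (auto simp: power_less_one_iff abs_square_less_1)

lemma del_sq: "0 < 1 - \<delta>\<^sub>0\<^sup>2"
  using del0 by (auto simp: abs_square_less_1)

lemma theta_pos: "0 < \<theta>"
  using kap del_sq by (simp add: \<theta>_def)

lemma target_admissible: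
  assumes "target \<kappa> M\<^sub>0 \<delta>\<^sub>0 \<Omega> \<Sigma> s"
  shows "\<Sigma> \<subseteq> adm"
  using assms hull_subset[of \<Sigma> convex] by (auto simp: target_def)

lemma admissible_closed_cylinder:
  assumes "Y \<in> adm" "X \<in> ccyl"
  shows "snd X \<le> snd Y - \<kappa> * c X Y / k"
    and "p \<in> \<Omega> \<Longrightarrow> norm (p - fst Y) \<le> \<delta>\<^sub>0 * c X Y / sqrt k"
proof -
  obtain x t where X: "X = (x, t)" "x \<in> \<Omega>" "t \<in> closure {0<..<M\<^sub>0}"
    using assms(2) M0 by (cases X) auto
  have *: "(x, r) \<in> cyl M\<^sub>0 \<Omega>" if "r \<in> {0<..<M\<^sub>0}" for r
    using that X by (simp add: cyl_def)
  have "0 \<le> snd Y - \<kappa> * c (x, t) Y / k - t"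
  proof (rule continuous_ge_on_closure[OF _ X(3)])
    show "continuous_on (closure {0<..<M\<^sub>0}) (\<lambda>t. snd Y - \<kappa> * c (x, t) Y / k - t)"
      unfolding cost_def using k_bounds by (intro continuous_intros) auto
    show "0 \<le> snd Y - \<kappa> * c (x, r) Y / k - r" if "r \<in> {0<..<M\<^sub>0}" for r
      using *[OF that] assms(1) by (force simp: admissible_def)
  qed
  then show "snd X \<le> snd Y - \<kappa> * c X Y / k" by (simp add: X)
  assume p: "p \<in> \<Omega>"
  have "0 \<le> \<delta>\<^sub>0 * c (x, t) Y / sqrt k - norm (p - fst Y)"
  proof (rule continuous_ge_on_closure[OF _ X(3)])
    show "continuous_on (closure {0<..<M\<^sub>0}) (\<lambda>t. \<delta>\<^sub>0 * c (x, t) Y / sqrt k - norm (p - fst Y))"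
      unfolding cost_def using k_bounds by (intro continuous_intros) auto
    show "0 \<le> \<delta>\<^sub>0 * c (x, r) Y / sqrt k - norm (p - fst Y)" if "r \<in> {0<..<M\<^sub>0}" for r
      using *[OF that] assms(1) p by (force simp: admissible_def dist_norm norm_minus_commute)
  qed
  then show "norm (p - fst Y) \<le> \<delta>\<^sub>0 * c X Y / sqrt k" by (simp add: X)
qed

lemma sig_alt: "sig X Y = k * (snd Y - snd X) - \<kappa> * c X Y"
  by (simp add: sig_def cost_def algebra_simps power2_eq_square)

lemma sig_sq: "(sig X Y)\<^sup>2 = (c X Y)\<^sup>2 - k * (norm (fst X - fst Y))\<^sup>2"
proof -
  have "(norm (X - Y))\<^sup>2 = (norm (fst X - fst Y))\<^sup>2 + (snd X - snd Y)\<^sup>2"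
    by (simp add: norm_point_sq)
  then have e: "(norm (fst X - fst Y))\<^sup>2 = (norm (X - Y))\<^sup>2 - (snd X - snd Y)\<^sup>2" by simp
  show ?thesis unfolding e by (simp add: sig_def cost_def power2_eq_square algebra_simps)
qed

lemma snd_le_norm: "\<bar>snd X - snd Y\<bar> \<le> norm (X - Y)" for X Y :: "'n point"
  by (metis norm_snd_le prod.collapse real_norm_def snd_diff)

lemma cost_bounds: "(1 - \<kappa>) * norm (X - Y) \<le> c X Y" "c X Y \<le> 2 * norm (X - Y)"
proof -
  have "\<kappa> * \<bar>snd X - snd Y\<bar> \<le> \<kappa> * norm (X - Y)" "\<kappa> * norm (X - Y) \<le> norm (X - Y)"
    using snd_le_norm[of X Y] kap by (auto intro: mult_left_mono mult_left_le_one_le)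
  moreover have "\<bar>\<kappa> * (snd X - snd Y)\<bar> = \<kappa> * \<bar>snd X - snd Y\<bar>" using kap by (simp add: abs_mult)
  ultimately show "(1 - \<kappa>) * norm (X - Y) \<le> c X Y" "c X Y \<le> 2 * norm (X - Y)"
    unfolding cost_def left_diff_distrib abs_le_iff by linarith+
qed

lemma admissible_sqrt_arg:
  assumes "Y \<in> adm" "X \<in> ccyl" "p \<in> \<Omega>"
  shows "(1 - \<delta>\<^sub>0\<^sup>2) * (c X Y)\<^sup>2 \<le> (c X Y)\<^sup>2 - k * (norm (p - fst Y))\<^sup>2"
proof -
  have "(norm (p - fst Y))\<^sup>2 \<le> (\<delta>\<^sub>0 * c X Y / sqrt k)\<^sup>2"
    using admissible_closed_cylinder(2)[OF assms] by (intro power_mono) auto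
  also have "\<dots> = \<delta>\<^sub>0\<^sup>2 * (c X Y)\<^sup>2 / k"
    using k_bounds by (simp add: power_divide power_mult_distrib)
  finally have "k * (norm (p - fst Y))\<^sup>2 \<le> \<delta>\<^sub>0\<^sup>2 * (c X Y)\<^sup>2"
    using k_bounds by (simp add: field_simps)
  then show ?thesis by (simp add: algebra_simps)
qed

lemma sig_lower:
  assumes "Y \<in> adm" "X \<in> ccyl"
  shows "\<theta> * norm (X - Y) \<le> sig X Y"
proof -
  have x: "fst X \<in> \<Omega>" using assms by auto
  have s0: "0 \<le> sig X Y"
    using admissible_closed_cylinder(1)[OF assms] k_bounds unfolding sig_alt by (simp add: field_simps)
  have c0: "0 \<le> c X Y" using cost_bounds(1)[of X Y] kap
    by (meson norm_ge_zero diff_ge_0_iff_ge less_imp_le mult_nonneg_nonneg order_trans)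
  have "(sqrt (1 - \<delta>\<^sub>0\<^sup>2) * c X Y)\<^sup>2 \<le> (sig X Y)\<^sup>2"
    using admissible_sqrt_arg[OF assms x] del_sq by (simp add: sig_sq power_mult_distrib)
  then have "sqrt (1 - \<delta>\<^sub>0\<^sup>2) * c X Y \<le> sig X Y"
    using s0 by (rule power2_le_imp_le)
  moreover have "\<theta> * norm (X - Y) \<le> sqrt (1 - \<delta>\<^sub>0\<^sup>2) * c X Y"
    unfolding \<theta>_def mult.assoc using cost_bounds(1)[of X Y] del_sq by (intro mult_left_mono) auto
  ultimately show ?thesis by linarith
qed

text \<open>The right-hand side is \<open>|X\<^sub>1 - Y|\<^sup>2 - (|X - Y| - \<kappa> (t\<^sub>1 - t))\<^sup>2\<close>, the squared equation of the
ellipsoid, in which the terms quadratic in \<open>Y\<close> cancel.\<close>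

lemma gap_identity:
  assumes "sig X Y \<noteq> 0"
  shows "2 * sig X Y * gap X Y X1
           = (c X1 Y - c X Y) * (norm (X1 - Y) + norm (X - Y) - \<kappa> * (snd X1 - snd X))"
proof -
  define d where "d = fst X1 - fst X"
  define w where "w = snd X1 - snd X"
  have e: "fst X1 = fst X + d" "snd X1 = snd X + w" by (auto simp: d_def w_def)
  have n1: "(norm (X1 - Y))\<^sup>2 = (norm d)\<^sup>2 + 2 * inner d (fst X - fst Y) + (norm (fst X - fst Y))\<^sup>2
      + (snd X + w - snd Y)\<^sup>2"
    by (simp add: norm_point_sq e power2_norm_eq_inner inner_add_left inner_add_right
        inner_diff_left inner_diff_right inner_commute)
  have n0: "(norm (X - Y))\<^sup>2 = (norm (fst X - fst Y))\<^sup>2 + (snd X - snd Y)\<^sup>2"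
    by (simp add: norm_point_sq)
  have "(c X1 Y - c X Y) * (norm (X1 - Y) + norm (X - Y) - \<kappa> * w)
      = (norm (X1 - Y))\<^sup>2 - (norm (X - Y) - \<kappa> * w)\<^sup>2"
    by (simp add: cost_def e power2_eq_square algebra_simps)
  also have "\<dots> = (norm d)\<^sup>2 + k * w\<^sup>2 + 2 * inner d (fst X - fst Y) - 2 * sig X Y * w"
    unfolding n1 power2_diff n0 by (simp add: sig_def power2_eq_square algebra_simps)
  also have "\<dots> = 2 * sig X Y * gap X Y X1"
    using assms by (simp add: gap_def slope_def flip: d_def w_def) (simp add: field_simps)
  finally show ?thesis by (simp add: w_def)
qed

lemma phi_self:
  assumes "Y \<in> adm" "X \<in> ccyl"
  shows "phi \<kappa> (fst X) Y X = snd X"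
proof -
  have "(c X Y)\<^sup>2 / k\<^sup>2 - (norm (fst X - fst Y))\<^sup>2 / k = (sig X Y / k)\<^sup>2"
    using k_bounds unfolding power_divide sig_sq by (simp add: diff_divide_distrib power2_eq_square)
  moreover have "0 \<le> sig X Y / k"
    using sig_lower[OF assms] theta_pos k_bounds
    by (meson divide_nonneg_pos mult_nonneg_nonneg less_imp_le norm_ge_zero order_trans)
  ultimately have "phi \<kappa> (fst X) Y X = snd Y - \<kappa> * c X Y / k - sig X Y / k"
    unfolding phi_def by (metis real_sqrt_abs abs_of_nonneg)
  then show ?thesis using k_bounds by (simp add: sig_alt diff_divide_distrib)
qed

text \<open>Two points of \<open>\<Omega>\<close> at distance \<open>r\<close> both lie within \<open>\<delta>\<^sub>0 c(X, Y) / sqrt k\<close> of the base point of \<open>Y\<close>, so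
the cost, and with it the distance, cannot be small.\<close>

lemma far_from_target: "\<exists>s0>0. \<forall>Y\<in>adm. \<forall>X\<in>ccyl. s0 \<le> norm (X - Y)"
proof -
  obtain p r where p: "p \<in> \<Omega>" "0 < r" "cball p r \<subseteq> \<Omega>"
    using dom open_contains_cball by blast
  obtain q where q: "q \<in> \<Omega>" "norm (p - q) = r"
  proof
    have "p + r *\<^sub>R axis undefined 1 \<in> cball p r" using p(2) by (simp add: dist_norm norm_axis_1)
    then show "p + r *\<^sub>R axis undefined 1 \<in> \<Omega>" using p(3) by blast
    show "norm (p - (p + r *\<^sub>R axis undefined 1)) = r" using p by (simp add: norm_axis_1)
  qed
  show ?thesis
  proof (intro exI[of _ "sqrt k * r / (4 * \<delta>\<^sub>0)"] conjI ballI)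
    show "0 < sqrt k * r / (4 * \<delta>\<^sub>0)" using p k_bounds del0 by simp
    fix Y X assume YX: "Y \<in> adm" "X \<in> ccyl"
    have "r \<le> norm (p - fst Y) + norm (q - fst Y)"
      using norm_triangle_ineq4[of "p - fst Y" "q - fst Y"] q(2) by simp
    also have "\<dots> \<le> 2 * (\<delta>\<^sub>0 * c X Y / sqrt k)"
      using admissible_closed_cylinder(2)[OF YX p(1)] admissible_closed_cylinder(2)[OF YX q(1)] by linarith
    also have "\<dots> \<le> 2 * (\<delta>\<^sub>0 * (2 * norm (X - Y)) / sqrt k)"
      using cost_bounds(2)[of X Y] del0 k_bounds by (intro mult_left_mono divide_right_mono) auto
    finally show "sqrt k * r / (4 * \<delta>\<^sub>0) \<le> norm (X - Y)"
      using k_bounds del0 by (simp add: field_simps)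
  qed
qed

text \<open>The cost decreases with the height at rate at least \<open>\<theta>\<close> and varies horizontally at rate at most one,
so level surfaces of the cost, and refractors, are Lipschitz graphs.\<close>

lemma cost_sublevel_lipschitz:
  assumes "Y \<in> adm" "X \<in> ccyl" "X' \<in> ccyl" "c X Y \<le> c X' Y"
  shows "\<theta> * (snd X' - snd X) \<le> norm (fst X' - fst X)"
proof (cases "snd X' \<le> snd X")
  case True
  then show ?thesis using theta_pos
    by (meson diff_le_0_iff_le less_imp_le mult_nonneg_nonpos norm_ge_zero order_trans)
next
  case False
  define P where "P = (fst X', snd X)"
  have P: "P \<in> ccyl" using assms by (auto simp: P_def)
  define h where "h = snd Y - snd X"
  define h' where "h' = snd Y - snd X'"
  \<comment> \<open>\<open>P\<close> lies on the vertical line of \<open>X'\<close> at the height of \<open>X\<close>.\<close>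
  have sq: "(norm (P - Y))\<^sup>2 - (norm (X' - Y))\<^sup>2 = h\<^sup>2 - h'\<^sup>2"
    by (simp add: norm_point_sq P_def h_def h'_def power2_commute)
  have h: "(\<kappa> + \<theta>) * norm (P - Y) \<le> h" "(\<kappa> + \<theta>) * norm (X' - Y) \<le> h'"
    using sig_lower[OF assms(1) P] sig_lower[OF assms(1,3)]
    by (simp_all add: sig_def P_def h_def h'_def algebra_simps)
  have "(h - h') * ((\<kappa> + \<theta>) * (norm (P - Y) + norm (X' - Y))) \<le> (h - h') * (h + h')"
    using h False by (intro mult_left_mono) (auto simp: h_def h'_def algebra_simps)
  also have "\<dots> = (norm (P - Y) - norm (X' - Y)) * (norm (P - Y) + norm (X' - Y))"
    using sq by (simp add: power2_eq_square algebra_simps)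
  finally have main: "((h - h') * (\<kappa> + \<theta>)) * (norm (P - Y) + norm (X' - Y))
      \<le> (norm (P - Y) - norm (X' - Y)) * (norm (P - Y) + norm (X' - Y))" by (simp add: mult_ac)
  have ne: "P \<noteq> X'" using False by (metis P_def order_refl snd_conv)
  then have "0 < norm (P - X')" by simp
  also have "norm (P - X') \<le> norm (P - Y) + norm (X' - Y)"
    using norm_triangle_ineq4[of "P - Y" "X' - Y"] by simp
  finally have "(h - h') * (\<kappa> + \<theta>) \<le> norm (P - Y) - norm (X' - Y)"
    using main by (simp add: mult_le_cancel_right)
  moreover have "h - h' = snd X' - snd X" by (simp add: h_def h'_def)
  moreover have "norm (P - Y) \<le> norm (X - Y) + norm (fst X' - fst X)"
    using norm_triangle_ineq[of "X - Y" "P - X"] by (simp add: P_def norm_prod_def)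
  ultimately show ?thesis using assms(4) by (simp add: cost_def algebra_simps)
qed

text \<open>With \<open>\<rho> = |X - Y| / sig X Y\<close> one has \<open>Y - X = sig X Y (-v, 1 + \<kappa> \<rho>)\<close>, and \<open>\<rho>\<close> is the unique
nonnegative root of a quadratic equation whose coefficients depend only on \<open>v\<close>.\<close>

lemma slope_determines_ray:
  assumes "0 < sig X Y" "0 < sig X Y'" "slope X Y = slope X Y'"
  shows "Y' - X = (sig X Y' / sig X Y) *\<^sub>R (Y - X)"
proof -
  define v where "v = slope X Y"
  have root: "k * \<rho>\<^sup>2 = 2 * \<kappa> * \<rho> + (1 + (norm v)\<^sup>2) \<and> 0 \<le> \<rho> \<and> fst Z - fst X = - (sig X Z *\<^sub>R v)
      \<and> snd Z - snd X = sig X Z * (1 + \<kappa> * \<rho>)"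
    if Z: "0 < sig X Z" "slope X Z = v" "\<rho> = norm (X - Z) / sig X Z" for Z \<rho>
  proof -
    have f: "fst X - fst Z = sig X Z *\<^sub>R v"
      using Z(1) by (simp add: Z(2)[symmetric] slope_def)
    have nn: "norm (X - Z) = \<rho> * sig X Z" using Z(1,3) by simp
    have s: "snd Z - snd X = sig X Z * (1 + \<kappa> * \<rho>)"
    proof -
      have "snd Z - snd X = sig X Z + \<kappa> * norm (X - Z)" by (simp add: sig_def)
      then show ?thesis unfolding nn by (simp add: algebra_simps)
    qed
    have "(\<rho> * sig X Z)\<^sup>2 = (norm (sig X Z *\<^sub>R v))\<^sup>2 + (sig X Z * (1 + \<kappa> * \<rho>))\<^sup>2"
      unfolding nn[symmetric] norm_point_sq
      using f s power2_commute[of "snd X" "snd Z"] by simp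
    then have "(sig X Z)\<^sup>2 * \<rho>\<^sup>2 = (sig X Z)\<^sup>2 * ((norm v)\<^sup>2 + (1 + \<kappa> * \<rho>)\<^sup>2)"
      by (simp add: power_mult_distrib distrib_left[of "(sig X Z)\<^sup>2"] mult.commute)
    then have "\<rho>\<^sup>2 = (norm v)\<^sup>2 + (1 + \<kappa> * \<rho>)\<^sup>2" using Z(1) by simp
    then have "k * \<rho>\<^sup>2 = 2 * \<kappa> * \<rho> + (1 + (norm v)\<^sup>2)"
      by (simp add: power2_eq_square algebra_simps)
    moreover have "fst Z - fst X = - (sig X Z *\<^sub>R v)" using f by (metis minus_diff_eq)
    moreover have "0 \<le> \<rho>" using Z(1,3) by simp
    ultimately show ?thesis using s by blast
  qed
  define \<rho> where "\<rho> = norm (X - Y) / sig X Y"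
  define \<rho>' where "\<rho>' = norm (X - Y') / sig X Y'"
  note r = root[OF assms(1) v_def[symmetric] \<rho>_def]
  note r' = root[OF assms(2) _ \<rho>'_def, unfolded v_def, OF assms(3)[symmetric], folded v_def]
  \<comment> \<open>Two different roots would add up to \<open>2 \<kappa> / k\<close>, which each nonnegative root exceeds.\<close>
  have big: "2 * \<kappa> < k * x" if "k * x\<^sup>2 = 2 * \<kappa> * x + (1 + (norm v)\<^sup>2) \<and> 0 \<le> x" for x
  proof -
    have "0 < (k * x - 2 * \<kappa>) * x" using that by (simp add: algebra_simps power2_eq_square)
      (smt (verit) zero_le_square)
    then show ?thesis using that by (simp add: zero_less_mult_iff)
  qed
  have "(\<rho> - \<rho>') * (k * \<rho> + k * \<rho>' - 2 * \<kappa>) = 0"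
    using r r' by (simp add: algebra_simps power2_eq_square)
  moreover have "k * \<rho> + k * \<rho>' - 2 * \<kappa> > 0"
    using big[of \<rho>] big[of \<rho>'] r r' kap by linarith
  ultimately have "\<rho> = \<rho>'" by simp
  show ?thesis
  proof (rule prod_eqI)
    show "fst (Y' - X) = fst ((sig X Y' / sig X Y) *\<^sub>R (Y - X))"
      using r r' assms by simp
    show "snd (Y' - X) = snd ((sig X Y' / sig X Y) *\<^sub>R (Y - X))"
      using r r' assms \<open>\<rho> = \<rho>'\<close> by simp
  qed
qed

text \<open>\<open>Lam\<close> inverts \<open>slope\<close>: the point at distance \<open>t\<close> in the direction \<open>Lam \<kappa> v\<close> has slope \<open>v\<close>.\<close>

lemma Lam_ray:
  assumes "0 < t"
  shows "sig X (X + t *\<^sub>R Lam \<kappa> v) = t * Q \<kappa> v" "slope X (X + t *\<^sub>R Lam \<kappa> v) = v"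
proof -
  define S where "S = sqrt (1 + k * (norm v)\<^sup>2)"
  have S1: "1 \<le> S" using k_bounds by (simp add: S_def)
  have SS: "S\<^sup>2 = 1 + k * (norm v)\<^sup>2"
    using k_bounds by (simp add: S_def add_nonneg_nonneg)
  have N: "0 < 1 + (norm v)\<^sup>2" by (simp add: add_pos_nonneg)
  have Qe: "Q \<kappa> v = (S - \<kappa>) / (1 + (norm v)\<^sup>2)" by (simp add: Q_def S_def)
  have Qp: "0 < Q \<kappa> v" using S1 N kap unfolding Qe by simp
  have QN: "Q \<kappa> v * (1 + (norm v)\<^sup>2) = S - \<kappa>" using N by (simp add: Qe)
  have "(norm (Lam \<kappa> v))\<^sup>2 = (Q \<kappa> v)\<^sup>2 * (norm v)\<^sup>2 + (Q \<kappa> v + \<kappa>)\<^sup>2"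
    by (simp add: norm_point_sq Lam_def power_mult_distrib)
  also have "\<dots> = Q \<kappa> v * (Q \<kappa> v * (1 + (norm v)\<^sup>2)) + 2 * \<kappa> * Q \<kappa> v + \<kappa>\<^sup>2"
    by (simp add: power2_eq_square algebra_simps)
  also have "\<dots> = Q \<kappa> v * (S + \<kappa>) + \<kappa>\<^sup>2" unfolding QN by (simp add: algebra_simps)
  also have "Q \<kappa> v * (S + \<kappa>) = (S\<^sup>2 - \<kappa>\<^sup>2) / (1 + (norm v)\<^sup>2)"
    by (simp add: Qe power2_eq_square algebra_simps)
  also have "S\<^sup>2 - \<kappa>\<^sup>2 = k * (1 + (norm v)\<^sup>2)" by (simp add: SS algebra_simps)
  finally have "(norm (Lam \<kappa> v))\<^sup>2 = 1" using N by simp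
  then have n1: "norm (Lam \<kappa> v) = 1"
    by (metis norm_ge_zero power2_eq_1_iff one_neq_neg_one order.trans not_one_le_zero neg_0_le_iff_le)
  show s: "sig X (X + t *\<^sub>R Lam \<kappa> v) = t * Q \<kappa> v"
    using assms n1 by (simp add: sig_def norm_minus_commute) (simp add: Lam_def algebra_simps)
  show "slope X (X + t *\<^sub>R Lam \<kappa> v) = v"
    using assms Qp unfolding slope_def s by (simp add: Lam_def)
qed

lemma Lam_snd_pos: "0 < snd (Lam \<kappa> v)"
proof -
  have "1 \<le> sqrt (1 + k * (norm v)\<^sup>2)" using k_bounds by simp
  then have "0 \<le> sqrt (1 + k * (norm v)\<^sup>2) - \<kappa>" using kap by linarith
  then have "0 \<le> Q \<kappa> v" by (simp add: Q_def)
  then show ?thesis using kap by (simp add: Lam_def)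
qed

lemma phi_gderiv:
  assumes "0 < sig X Y"
  shows "GDERIV (\<lambda>x. phi \<kappa> x Y X) (fst X) :> slope X Y"
proof -
  define A where "A x = (c X Y)\<^sup>2 / k\<^sup>2 - (norm (x - fst Y))\<^sup>2 / k" for x
  have kne: "k \<noteq> 0" using k_bounds by linarith
  have A0: "A (fst X) = (sig X Y / k)\<^sup>2"
    using kne unfolding A_def power_divide sig_sq diff_divide_distrib by (simp add: power2_eq_square[of k])
  have sA: "sqrt (A (fst X)) = sig X Y / k" unfolding A0 using assms k_bounds by simp
  have pos: "0 < A (fst X)" unfolding A0 using assms k_bounds by simp
  have dA: "(A has_derivative (\<lambda>h. - (2 * inner (fst X - fst Y) h / k))) (at (fst X))"
    unfolding A_def power2_norm_eq_inner
    by (auto intro!: derivative_eq_intros kne simp: inner_commute)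
  have "((\<lambda>x. phi \<kappa> x Y X) has_derivative
      (\<lambda>h. - (- (2 * inner (fst X - fst Y) h / k) * (inverse (sqrt (A (fst X))) / 2)))) (at (fst X))"
    unfolding phi_def A_def[symmetric]
    by (auto intro!: derivative_eq_intros dA pos)
  moreover have "(\<lambda>h. - (- (2 * inner (fst X - fst Y) h / k) * (inverse (sqrt (A (fst X))) / 2)))
      = (\<lambda>h. inner h (slope X Y))"
    unfolding sA using k_bounds assms by (simp add: fun_eq_iff slope_def inner_commute)
  ultimately show ?thesis by (simp add: gderiv_def)
qed

lemma cost_convex:
  assumes "0 \<le> t" "t \<le> 1"
  shows "c ((1 - t) *\<^sub>R A + t *\<^sub>R B) Y \<le> (1 - t) * c A Y + t * c B Y"
proof -
  have "(1 - t) *\<^sub>R A + t *\<^sub>R B - Y = (1 - t) *\<^sub>R (A - Y) + t *\<^sub>R (B - Y)"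
    by (simp add: algebra_simps)
  then have "norm ((1 - t) *\<^sub>R A + t *\<^sub>R B - Y) \<le> (1 - t) * norm (A - Y) + t * norm (B - Y)"
    using norm_triangle_ineq[of "(1 - t) *\<^sub>R (A - Y)" "t *\<^sub>R (B - Y)"] assms by simp
  then show ?thesis by (simp add: cost_def algebra_simps)
qed

end

section \<open>Structural comparison of refractor value, cost and gap\<close>

text \<open>\<open>s0\<close> separates the cylinder from all admissible points and \<open>D\<close> bounds the diameter of \<open>\<Omega>\<close>. All
constants defined below are built from \<open>\<kappa>\<close>, \<open>M\<^sub>0\<close>, \<open>\<delta>\<^sub>0\<close>, \<open>s0\<close> and \<open>D\<close>, and are therefore independent of
the target.\<close>

locale cylinder_bounds = cylinder \<kappa> M\<^sub>0 \<delta>\<^sub>0 \<Omega>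
  for \<kappa> M\<^sub>0 \<delta>\<^sub>0 :: real and \<Omega> :: "(real ^ 'n::finite) set" +
  fixes s0 D :: real
  assumes s0: "0 < s0" "\<And>X Y. Y \<in> adm \<Longrightarrow> X \<in> ccyl \<Longrightarrow> s0 \<le> norm (X - Y)"
    and D: "0 \<le> D" "\<And>x x'. x \<in> \<Omega> \<Longrightarrow> x' \<in> \<Omega> \<Longrightarrow> norm (x - x') \<le> D"

begin

lemma sig_pos:
  assumes "Y \<in> adm" "X \<in> ccyl"
  shows "\<theta> * s0 \<le> sig X Y" "0 < sig X Y"
proof -
  have "\<theta> * s0 \<le> \<theta> * norm (X - Y)"
    using s0(2)[OF assms] theta_pos by (intro mult_left_mono) auto
  then show "\<theta> * s0 \<le> sig X Y" using sig_lower[OF assms] by linarith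
  then show "0 < sig X Y" using theta_pos s0(1) by (meson less_le_trans mult_pos_pos)
qed

lemma cost_pos: "Y \<in> adm \<Longrightarrow> X \<in> ccyl \<Longrightarrow> 0 < c X Y"
  using s0 cost_bounds(1)[of X Y] kap
  by (smt (verit) mult_pos_pos)

lemma grad_phi: "Y \<in> adm \<Longrightarrow> X \<in> ccyl \<Longrightarrow> grad (\<lambda>x. phi \<kappa> x Y X) (fst X) = slope X Y"
  using phi_gderiv sig_pos(2) grad_eqI by blast

definition \<beta>\<^sub>c :: real where "\<beta>\<^sub>c = \<kappa> / k + 1 / (k * sqrt (1 - \<delta>\<^sub>0\<^sup>2))"

text \<open>\<open>\<phi>(x\<^sub>1, Y, X)\<close> depends on \<open>X\<close> only through \<open>c(X, Y)\<close>, and \<open>t\<^sub>1 = \<phi>(x\<^sub>1, Y, X\<^sub>1)\<close>. The factor is a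
difference quotient of \<open>\<phi>\<close> in the cost variable; \<open>admissible_sqrt_arg\<close> keeps its denominator away
from zero.\<close>

lemma phi_cost_ratio:
  assumes "Y \<in> adm" "X0 \<in> ccyl" "X1 \<in> ccyl"
  obtains m where "1 \<le> m" "m \<le> \<beta>\<^sub>c" "phi \<kappa> (fst X1) Y X0 - snd X1 = m * (c X1 Y - c X0 Y)"
proof -
  define n where "n = norm (fst X1 - fst Y)"
  define R where "R X = sqrt ((c X Y)\<^sup>2 / k\<^sup>2 - n\<^sup>2 / k)" for X
  define q where "q = sqrt (1 - \<delta>\<^sub>0\<^sup>2)"
  have q: "0 < q" "q \<le> 1" using del_sq by (auto simp: q_def)
  have x1: "fst X1 \<in> \<Omega>" using assms by auto
  have kne: "k \<noteq> 0" using k_bounds by linarith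
  have R: "q * c X Y / k \<le> R X" "R X \<le> c X Y / k" "0 < R X" "(R X)\<^sup>2 = (c X Y)\<^sup>2 / k\<^sup>2 - n\<^sup>2 / k"
    if X: "X \<in> ccyl" for X
  proof -
    have cp: "0 < c X Y" by (rule cost_pos[OF assms(1) X])
    have e: "(c X Y)\<^sup>2 / k\<^sup>2 - n\<^sup>2 / k = ((c X Y)\<^sup>2 - k * n\<^sup>2) / k\<^sup>2"
      using kne by (simp add: diff_divide_distrib power2_eq_square[of k])
    have "(q * c X Y / k)\<^sup>2 = ((1 - \<delta>\<^sub>0\<^sup>2) * (c X Y)\<^sup>2) / k\<^sup>2"
      using del_sq by (simp add: q_def power_divide power_mult_distrib)
    also have "\<dots> \<le> ((c X Y)\<^sup>2 - k * n\<^sup>2) / k\<^sup>2"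
      using admissible_sqrt_arg[OF assms(1) X x1] unfolding n_def by (intro divide_right_mono) auto
    finally have l: "(q * c X Y / k)\<^sup>2 \<le> (c X Y)\<^sup>2 / k\<^sup>2 - n\<^sup>2 / k" unfolding e .
    then show 1: "q * c X Y / k \<le> R X" unfolding R_def by (rule real_le_rsqrt)
    then show "0 < R X" using q cp k_bounds by (meson divide_pos_pos less_le_trans mult_pos_pos)
    have "(c X Y)\<^sup>2 / k\<^sup>2 - n\<^sup>2 / k \<le> (c X Y / k)\<^sup>2" using k_bounds by (simp add: power_divide)
    then show "R X \<le> c X Y / k" unfolding R_def
      using cp k_bounds by (intro real_le_lsqrt) auto
    have "0 \<le> (c X Y)\<^sup>2 / k\<^sup>2 - n\<^sup>2 / k" using l by (meson order_trans zero_le_power2)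
    then show "(R X)\<^sup>2 = (c X Y)\<^sup>2 / k\<^sup>2 - n\<^sup>2 / k" by (simp add: R_def)
  qed
  define S where "S = R X0 + R X1"
  define T where "T = c X0 Y + c X1 Y"
  have S: "0 < S" "q * T / k \<le> S" "S \<le> T / k"
    using R[OF assms(2)] R[OF assms(3)] by (auto simp: S_def T_def add_divide_distrib distrib_left)
  define r where "r = T / (k\<^sup>2 * S)"
  have "S * (R X1 - R X0) = (R X1)\<^sup>2 - (R X0)\<^sup>2" by (simp add: S_def power2_eq_square algebra_simps)
  also have "\<dots> = ((c X1 Y)\<^sup>2 - (c X0 Y)\<^sup>2) / k\<^sup>2"
    using R(4)[OF assms(2)] R(4)[OF assms(3)] by (simp add: diff_divide_distrib)
  also have "\<dots> = T * (c X1 Y - c X0 Y) / k\<^sup>2" by (simp add: T_def power2_eq_square algebra_simps)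
  finally have diff: "R X1 - R X0 = r * (c X1 Y - c X0 Y)"
    using S(1) kne by (simp add: r_def field_simps)
  have r1: "1 / k \<le> r" "r \<le> 1 / (k * q)"
  proof -
    have kS: "k * S \<le> T" "q * T \<le> k * S" "0 < k * S"
      using S k_bounds by (simp_all add: pos_le_divide_eq pos_divide_le_eq mult.commute)
    have re: "r = (T / (k * S)) / k" by (simp add: r_def power2_eq_square mult_ac)
    have "1 \<le> T / (k * S)" using kS by (simp only: le_divide_eq_1_pos)
    then show "1 / k \<le> r" unfolding re using k_bounds by (intro divide_right_mono) auto
    have "T / (k * S) \<le> 1 / q" using kS q by (simp add: pos_divide_le_eq pos_le_divide_eq mult.commute)
    then have "r \<le> 1 / q / k" unfolding re using k_bounds by (intro divide_right_mono) auto
    then show "r \<le> 1 / (k * q)" by (simp add: mult.commute)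
  qed
  show thesis
  proof
    have "1 \<le> 1 / k" using k_bounds by simp
    moreover have "0 \<le> \<kappa> / k" using kap k_bounds by simp
    ultimately show "1 \<le> \<kappa> / k + r" using r1 by linarith
    show "\<kappa> / k + r \<le> \<beta>\<^sub>c" using r1 by (simp add: \<beta>\<^sub>c_def q_def)
    have "snd X1 = phi \<kappa> (fst X1) Y X1" using phi_self assms by simp
    then show "phi \<kappa> (fst X1) Y X0 - snd X1 = (\<kappa> / k + r) * (c X1 Y - c X0 Y)"
      using diff by (simp add: phi_def R_def n_def algebra_simps diff_divide_distrib)
  qed
qed

lemma phi_le_iff_cost:
  assumes "Y \<in> adm" "X0 \<in> ccyl" "X1 \<in> ccyl"
  shows "phi \<kappa> (fst X1) Y X0 \<le> snd X1 \<longleftrightarrow> c X1 Y \<le> c X0 Y"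
proof -
  obtain m where "1 \<le> m" "m \<le> \<beta>\<^sub>c" "phi \<kappa> (fst X1) Y X0 - snd X1 = m * (c X1 Y - c X0 Y)"
    using phi_cost_ratio[OF assms] .
  then have "phi \<kappa> (fst X1) Y X0 \<le> snd X1 \<longleftrightarrow> m * (c X1 Y - c X0 Y) \<le> 0" by linarith
  also have "\<dots> \<longleftrightarrow> c X1 Y \<le> c X0 Y" using \<open>1 \<le> m\<close> by (simp add: mult_le_0_iff)
  finally show ?thesis .
qed

definition \<alpha>\<^sub>g :: real where "\<alpha>\<^sub>g = 2 * \<theta> / (2 + 2 * (D + M\<^sub>0) / s0)"

lemma alpha_pos: "0 < \<alpha>\<^sub>g"
  unfolding \<alpha>\<^sub>g_def using theta_pos s0(1) D(1) M0 by (intro divide_pos_pos add_pos_nonneg) auto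

text \<open>In \<open>gap_identity\<close> both factors that accompany the gap and the difference of costs are comparable to
\<open>|X\<^sub>0 - Y|\<close>. This scale may be arbitrarily large, because the admissible set is unbounded, but it
drops out of the ratio.\<close>

lemma cost_gap_ratio:
  assumes "Y \<in> adm" "X0 \<in> ccyl" "X1 \<in> ccyl"
  obtains r where "\<alpha>\<^sub>g \<le> r" "r \<le> 2 / (1 - \<kappa>)" "c X1 Y - c X0 Y = r * gap X0 Y X1"
proof -
  define s where "s = norm (X0 - Y)"
  define w where "w = snd X1 - snd X0"
  define den where "den = norm (X1 - Y) + s - \<kappa> * w"
  have s: "s0 \<le> s" using s0(2) assms unfolding s_def by blast
  then have s: "s0 \<le> s" "0 < s" using s0(1) by auto
  have sg: "0 < sig X0 Y" "\<theta> * s \<le> sig X0 Y" "sig X0 Y \<le> s"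
  proof -
    show "0 < sig X0 Y" using sig_pos assms by blast
    show "\<theta> * s \<le> sig X0 Y" using sig_lower assms by (simp add: s_def)
    have "0 \<le> \<kappa> * s" using s kap by simp
    then show "sig X0 Y \<le> s"
      using snd_le_norm[of X0 Y] by (simp add: sig_def s_def)
  qed
  have "0 \<le> \<kappa> * norm (X1 - Y)" using kap by simp
  then have "w \<le> snd Y - snd X0" using sig_pos(2)[OF assms(1,3)] by (simp add: sig_def w_def)
  also have "\<dots> \<le> s" using snd_le_norm[of X0 Y] by (simp add: s_def)
  finally have "\<kappa> * w \<le> \<kappa> * s" using kap by (intro mult_left_mono) auto
  then have den1: "(1 - \<kappa>) * s \<le> den" unfolding den_def left_diff_distrib
    using norm_ge_zero[of "X1 - Y"] by linarith
  have den0: "0 < den" using den1 s kap by (smt (verit) mult_pos_pos)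
  have "norm (X1 - X0) \<le> norm (fst X1 - fst X0) + \<bar>w\<bar>"
    using norm_Pair_le[of "fst X1 - fst X0" w] by (cases X1; cases X0) (simp add: w_def)
  moreover have "norm (fst X1 - fst X0) \<le> D" using assms D(2) by auto
  moreover have w: "\<bar>w\<bar> \<le> M\<^sub>0" using assms by (auto simp: w_def)
  moreover have "norm (X1 - Y) \<le> s + norm (X1 - X0)"
    using norm_triangle_ineq[of "X0 - Y" "X1 - X0"] by (simp add: s_def)
  ultimately have X1Y: "norm (X1 - Y) \<le> s + (D + M\<^sub>0)" by linarith
  have kw: "- (\<kappa> * w) \<le> M\<^sub>0"
  proof -
    have "\<bar>\<kappa> * w\<bar> \<le> \<bar>w\<bar>" using kap by (simp add: abs_mult mult_left_le_one_le)
    then show ?thesis using w by linarith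
  qed
  have "den = norm (X1 - Y) + s + (- (\<kappa> * w))" by (simp add: den_def)
  with X1Y kw have "den \<le> 2 * s + 2 * (D + M\<^sub>0)" using D(1) by argo
  also have "2 * (D + M\<^sub>0) \<le> 2 * (D + M\<^sub>0) / s0 * s"
  proof -
    have "2 * (D + M\<^sub>0) / s0 * s0 \<le> 2 * (D + M\<^sub>0) / s0 * s"
      using s s0(1) D(1) M0 by (intro mult_left_mono) auto
    then show ?thesis using s0(1) by simp
  qed
  finally have den2: "den \<le> (2 + 2 * (D + M\<^sub>0) / s0) * s" by (simp add: algebra_simps)
  show thesis
  proof
    have e: "2 * sig X0 Y * gap X0 Y X1 = (c X1 Y - c X0 Y) * den"
      using gap_identity[of X0 Y X1] sg(1) by (simp add: den_def s_def w_def)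
    then show "c X1 Y - c X0 Y = (2 * sig X0 Y / den) * gap X0 Y X1"
      using den0 by (simp add: field_simps)
    have "2 * sig X0 Y / den \<le> 2 * s / ((1 - \<kappa>) * s)"
      using sg den1 den0 s kap by (intro frac_le) auto
    then show "2 * sig X0 Y / den \<le> 2 / (1 - \<kappa>)" using s by simp
    have p: "0 < 2 + 2 * (D + M\<^sub>0) / s0" using s0(1) D(1) M0 by (intro add_pos_nonneg) auto
    have "\<alpha>\<^sub>g = 2 * (\<theta> * s) / ((2 + 2 * (D + M\<^sub>0) / s0) * s)" using s by (simp add: \<alpha>\<^sub>g_def)
    also have "\<dots> \<le> 2 * sig X0 Y / den"
      using sg den2 den0 s theta_pos by (intro frac_le) auto
    finally show "\<alpha>\<^sub>g \<le> 2 * sig X0 Y / den" .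
  qed
qed

definition \<beta> :: real where "\<beta> = \<beta>\<^sub>c * (2 / (1 - \<kappa>))"

lemma phi_gap_ratio:
  assumes "Y \<in> adm" "X0 \<in> ccyl" "X1 \<in> ccyl"
  obtains m where "\<alpha>\<^sub>g \<le> m" "m \<le> \<beta>" "phi \<kappa> (fst X1) Y X0 - snd X1 = m * gap X0 Y X1"
proof -
  obtain m where m: "1 \<le> m" "m \<le> \<beta>\<^sub>c" "phi \<kappa> (fst X1) Y X0 - snd X1 = m * (c X1 Y - c X0 Y)"
    using phi_cost_ratio[OF assms] .
  obtain r where r: "\<alpha>\<^sub>g \<le> r" "r \<le> 2 / (1 - \<kappa>)" "c X1 Y - c X0 Y = r * gap X0 Y X1"
    using cost_gap_ratio[OF assms] .
  show thesis
  proof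
    have "1 * \<alpha>\<^sub>g \<le> m * r" using m r alpha_pos by (intro mult_mono) auto
    then show "\<alpha>\<^sub>g \<le> m * r" by simp
    show "m * r \<le> \<beta>" unfolding \<beta>_def using m r alpha_pos by (intro mult_mono) auto
  qed (simp add: m r)
qed

lemma beta_pos: "0 < \<beta>" "1 \<le> \<beta>\<^sub>c"
proof -
  have q: "0 < sqrt (1 - \<delta>\<^sub>0\<^sup>2)" "sqrt (1 - \<delta>\<^sub>0\<^sup>2) \<le> 1" using del_sq by auto
  have "k * sqrt (1 - \<delta>\<^sub>0\<^sup>2) \<le> 1 * 1" using k_bounds q by (intro mult_mono) auto
  moreover have "0 < k * sqrt (1 - \<delta>\<^sub>0\<^sup>2)" using k_bounds q by simp
  ultimately have "1 \<le> 1 / (k * sqrt (1 - \<delta>\<^sub>0\<^sup>2))" by simp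
  moreover have "0 \<le> \<kappa> / k" using kap k_bounds by simp
  ultimately show 1: "1 \<le> \<beta>\<^sub>c" unfolding \<beta>\<^sub>c_def by linarith
  then show "0 < \<beta>" unfolding \<beta>_def using kap by simp
qed

lemma on_support_graph:
  assumes "Y \<in> adm" "X0 \<in> ccyl" "X1 \<in> ccyl" "phi \<kappa> (fst X1) Y X0 = snd X1"
  shows "gap X0 Y X1 = 0" "c X1 Y = c X0 Y"
proof -
  obtain m where "\<alpha>\<^sub>g \<le> m" "m \<le> \<beta>" "phi \<kappa> (fst X1) Y X0 - snd X1 = m * gap X0 Y X1"
    using phi_gap_ratio[OF assms(1-3)] .
  then show "gap X0 Y X1 = 0" using assms(4) alpha_pos by auto
  obtain m where "1 \<le> m" "m \<le> \<beta>\<^sub>c" "phi \<kappa> (fst X1) Y X0 - snd X1 = m * (c X1 Y - c X0 Y)"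
    using phi_cost_ratio[OF assms(1-3)] .
  then show "c X1 Y = c X0 Y" using assms(4) by auto
qed

lemma gap_cost_sign:
  assumes "Y \<in> adm" "X0 \<in> ccyl" "X1 \<in> ccyl" "- e \<le> c X1 Y - c X0 Y" "0 \<le> e"
  shows "- (e / \<alpha>\<^sub>g) \<le> gap X0 Y X1"
proof -
  obtain r where r: "\<alpha>\<^sub>g \<le> r" "r \<le> 2 / (1 - \<kappa>)" "c X1 Y - c X0 Y = r * gap X0 Y X1"
    using cost_gap_ratio[OF assms(1-3)] .
  have "- e \<le> \<alpha>\<^sub>g * gap X0 Y X1"
  proof (cases "0 \<le> gap X0 Y X1")
    case True
    then have "0 \<le> \<alpha>\<^sub>g * gap X0 Y X1" using alpha_pos by simp
    then show ?thesis using assms(5) by linarith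
  next
    case False
    then have "r * gap X0 Y X1 \<le> \<alpha>\<^sub>g * gap X0 Y X1" using r(1) by (simp add: mult_right_mono_neg)
    then show ?thesis using assms(4) r(3) by linarith
  qed
  then show ?thesis
    using alpha_pos by (metis minus_divide_left mult.commute pos_divide_le_eq)
qed

section \<open>Dependence of the gap on the target point\<close>

definition K\<^sub>T :: real where
  "K\<^sub>T = (1 + 2 / \<theta>) / (\<theta> * s0) + D * (1 + 1 / \<theta>\<^sup>2) / (\<theta> * s0)\<^sup>2"

lemma KT_nonneg: "0 \<le> K\<^sub>T"
proof -
  have 1: "0 \<le> (1 + 2 / \<theta>) / (\<theta> * s0)" using theta_pos s0(1) by (simp add: add_nonneg_nonneg)
  have 2: "0 \<le> 1 + 1 / \<theta>\<^sup>2" by (simp add: add_nonneg_nonneg)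
  have "0 \<le> D * (1 + 1 / \<theta>\<^sup>2) / (\<theta> * s0)\<^sup>2"
    by (rule divide_nonneg_nonneg[OF mult_nonneg_nonneg[OF D(1) 2] zero_le_power2])
  with 1 show ?thesis unfolding K\<^sub>T_def by (rule add_nonneg_nonneg)
qed

text \<open>Bounds the coefficient of \<open>1 / (2 sig)\<close> in the gap for pairs of points that satisfy the Lipschitz bound of
a refractor.\<close>

lemma energy_bound:
  assumes "\<theta> * \<bar>w\<bar> \<le> n" "0 \<le> n"
  shows "n\<^sup>2 + k * w\<^sup>2 \<le> n\<^sup>2 * (1 + 1 / \<theta>\<^sup>2)"
proof -
  have "(\<theta> * \<bar>w\<bar>)\<^sup>2 \<le> n\<^sup>2" using assms theta_pos by (intro power_mono) auto
  then have "w\<^sup>2 \<le> n\<^sup>2 / \<theta>\<^sup>2" using theta_pos by (simp add: power_mult_distrib pos_le_divide_eq mult.commute)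
  moreover have "k * w\<^sup>2 \<le> w\<^sup>2" using k_bounds by (intro mult_left_le_one_le) auto
  ultimately show ?thesis unfolding distrib_left by simp
qed

text \<open>Slope and \<open>1 / (2 sig)\<close> are Lipschitz in \<open>Y\<close>. The quadratic term of the gap carries the factor
\<open>|x\<^sub>1 - x\<^sub>0|\<^sup>2\<close>, one power of which is absorbed by the diameter.\<close>

lemma gap_change_target:
  assumes "Y \<in> adm" "Y' \<in> adm" "X0 \<in> ccyl" "X1 \<in> ccyl"
    and "\<theta> * \<bar>snd X1 - snd X0\<bar> \<le> norm (fst X1 - fst X0)"
  shows "\<bar>gap X0 Y X1 - gap X0 Y' X1\<bar> \<le> K\<^sub>T * norm (Y - Y') * norm (fst X1 - fst X0)"
proof -
  define \<sigma> where "\<sigma> = sig X0 Y"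
  define \<sigma>' where "\<sigma>' = sig X0 Y'"
  define a where "a = norm (Y - Y')"
  define d where "d = fst X1 - fst X0"
  define E where "E = (norm d)\<^sup>2 + k * (snd X1 - snd X0)\<^sup>2"
  have S: "\<theta> * s0 \<le> \<sigma>" "\<theta> * s0 \<le> \<sigma>'" "0 < \<sigma>" "0 < \<sigma>'" "0 < \<theta> * s0"
    using sig_pos assms theta_pos s0 by (auto simp: \<sigma>_def \<sigma>'_def)
  have a0: "0 \<le> a" by (simp add: a_def)
  have ds: "\<bar>\<sigma>' - \<sigma>\<bar> \<le> 2 * a"
  proof -
    have "\<bar>norm (X0 - Y) - norm (X0 - Y')\<bar> \<le> a"
      using norm_triangle_ineq3[of "X0 - Y" "X0 - Y'"] by (simp add: a_def norm_minus_commute)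
    then have "\<bar>\<kappa> * (norm (X0 - Y) - norm (X0 - Y'))\<bar> \<le> 1 * a"
      unfolding abs_mult using kap by (intro mult_mono) auto
    moreover have "\<bar>snd Y' - snd Y\<bar> \<le> a"
      using snd_le_norm[of Y' Y] by (simp add: a_def norm_minus_commute)
    moreover have "\<sigma>' - \<sigma> = (snd Y' - snd Y) + \<kappa> * (norm (X0 - Y) - norm (X0 - Y'))"
      by (simp add: \<sigma>_def \<sigma>'_def sig_def algebra_simps)
    ultimately show ?thesis by linarith
  qed
  have split: "1 / \<sigma> = 1 / \<sigma>' + (\<sigma>' - \<sigma>) / (\<sigma> * \<sigma>')" using S by (simp add: field_simps)
  have "slope X0 Y = (1 / \<sigma>) *\<^sub>R (fst Y' - fst Y) + (1 / \<sigma>) *\<^sub>R (fst X0 - fst Y')"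
    by (simp add: slope_def \<sigma>_def flip: scaleR_right_distrib)
  also have "(1 / \<sigma>) *\<^sub>R (fst X0 - fst Y') = slope X0 Y' + ((\<sigma>' - \<sigma>) / (\<sigma> * \<sigma>')) *\<^sub>R (fst X0 - fst Y')"
    unfolding split by (simp add: slope_def \<sigma>'_def scaleR_left_distrib)
  finally have "slope X0 Y - slope X0 Y'
      = (1 / \<sigma>) *\<^sub>R (fst Y' - fst Y) + ((\<sigma>' - \<sigma>) / (\<sigma> * \<sigma>')) *\<^sub>R (fst X0 - fst Y')"
    by simp
  then have "norm (slope X0 Y - slope X0 Y')
      \<le> norm (fst Y' - fst Y) / \<sigma> + \<bar>\<sigma>' - \<sigma>\<bar> / \<sigma> * (norm (fst X0 - fst Y') / \<sigma>')"
    using norm_triangle_ineq[of "(1 / \<sigma>) *\<^sub>R (fst Y' - fst Y)"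
        "((\<sigma>' - \<sigma>) / (\<sigma> * \<sigma>')) *\<^sub>R (fst X0 - fst Y')"] S by (simp add: abs_mult)
  also have "\<dots> \<le> a / (\<theta> * s0) + 2 * a / (\<theta> * s0) * (1 / \<theta>)"
  proof (intro add_mono mult_mono)
    have "norm (fst Y' - fst Y) \<le> a"
      unfolding a_def by (metis fst_diff norm_fst_le norm_minus_commute prod.collapse)
    then show "norm (fst Y' - fst Y) / \<sigma> \<le> a / (\<theta> * s0)" using S a0 by (intro frac_le) auto
    show "\<bar>\<sigma>' - \<sigma>\<bar> / \<sigma> \<le> 2 * a / (\<theta> * s0)" using S a0 ds by (intro frac_le) auto
    have "norm (fst X0 - fst Y') \<le> norm (X0 - Y')"
      by (metis fst_diff norm_fst_le prod.collapse)
    moreover have "\<theta> * norm (X0 - Y') \<le> \<sigma>'" unfolding \<sigma>'_def using sig_lower assms by blast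
    ultimately have "\<theta> * norm (fst X0 - fst Y') \<le> \<sigma>'"
      using theta_pos by (meson less_imp_le mult_left_mono order_trans)
    then show "norm (fst X0 - fst Y') / \<sigma>' \<le> 1 / \<theta>"
      using S theta_pos by (simp add: pos_divide_le_eq pos_le_divide_eq mult.commute)
    show "0 \<le> 2 * a / (\<theta> * s0)" using S a0 by simp
    show "0 \<le> norm (fst X0 - fst Y') / \<sigma>'" using S by simp
  qed
  also have "\<dots> = (1 + 2 / \<theta>) / (\<theta> * s0) * a" by (simp add: add_divide_distrib algebra_simps)
  finally have slope: "norm (slope X0 Y - slope X0 Y') \<le> (1 + 2 / \<theta>) / (\<theta> * s0) * a" .
  have dD: "norm d \<le> D" unfolding d_def using assms D(2) by auto
  have E0: "0 \<le> E" using k_bounds by (simp add: E_def)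
  have "E \<le> (norm d)\<^sup>2 * (1 + 1 / \<theta>\<^sup>2)"
    unfolding E_def using assms(5) by (intro energy_bound) (auto simp: d_def)
  also have "\<dots> \<le> (norm d * D) * (1 + 1 / \<theta>\<^sup>2)"
    using dD by (intro mult_right_mono) (auto simp: power2_eq_square mult_left_mono)
  finally have E: "E \<le> norm d * D * (1 + 1 / \<theta>\<^sup>2)" .
  have "\<bar>E / (2 * \<sigma>) - E / (2 * \<sigma>')\<bar> = E * \<bar>\<sigma>' - \<sigma>\<bar> / (2 * (\<sigma> * \<sigma>'))"
  proof -
    have "E / (2 * \<sigma>) - E / (2 * \<sigma>') = E / 2 * (1 / \<sigma> - 1 / \<sigma>')" by (simp add: algebra_simps)
    also have "1 / \<sigma> - 1 / \<sigma>' = (\<sigma>' - \<sigma>) / (\<sigma> * \<sigma>')" unfolding split by simp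
    finally show ?thesis using S E0 by (simp add: abs_mult)
  qed
  also have "\<dots> \<le> (norm d * D * (1 + 1 / \<theta>\<^sup>2)) * (2 * a) / (2 * ((\<theta> * s0) * (\<theta> * s0)))"
    using E E0 ds S less_imp_le[OF S(3)] a0 D(1) s0(1) theta_pos by (intro frac_le mult_mono mult_nonneg_nonneg mult_pos_pos) auto
  also have "\<dots> = D * (1 + 1 / \<theta>\<^sup>2) / (\<theta> * s0)\<^sup>2 * a * norm d"
  proof -
    have "(norm d * D * q) * (2 * a) / (2 * (p * p)) = D * q / p\<^sup>2 * a * norm d" for q p :: real
      by (simp add: power2_eq_square mult_ac)
    then show ?thesis .
  qed
  finally have e: "\<bar>E / (2 * \<sigma>) - E / (2 * \<sigma>')\<bar> \<le> D * (1 + 1 / \<theta>\<^sup>2) / (\<theta> * s0)\<^sup>2 * a * norm d" .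
  have "gap X0 Y X1 - gap X0 Y' X1 = inner d (slope X0 Y - slope X0 Y') + (E / (2 * \<sigma>) - E / (2 * \<sigma>'))"
    by (simp add: gap_def d_def E_def \<sigma>_def \<sigma>'_def inner_diff_right)
  moreover have "\<bar>inner d (slope X0 Y - slope X0 Y')\<bar> \<le> norm d * ((1 + 2 / \<theta>) / (\<theta> * s0) * a)"
    using Cauchy_Schwarz_ineq2[of d "slope X0 Y - slope X0 Y'"] slope
    by (meson mult_left_mono norm_ge_zero order_trans)
  ultimately have "\<bar>gap X0 Y X1 - gap X0 Y' X1\<bar>
      \<le> norm d * ((1 + 2 / \<theta>) / (\<theta> * s0) * a) + D * (1 + 1 / \<theta>\<^sup>2) / (\<theta> * s0)\<^sup>2 * a * norm d"
    using e by linarith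
  also have "\<dots> = K\<^sub>T * a * norm d" by (simp add: K\<^sub>T_def algebra_simps)
  finally show ?thesis by (simp add: a_def d_def)
qed

text \<open>This identity is the reason for working with the gap: along a slope segment the only deviation from
linear interpolation is that of \<open>1 / (2 sig)\<close>, with a factor that is the same for all targets.\<close>

lemma gap_interpolation:
  assumes "slope X0 Yl = (1 - l) *\<^sub>R slope X0 Ya + l *\<^sub>R slope X0 Yb"
  shows "gap X0 Yl X1 = (1 - l) * gap X0 Ya X1 + l * gap X0 Yb X1
    + (1 / (2 * sig X0 Yl) - ((1 - l) / (2 * sig X0 Ya) + l / (2 * sig X0 Yb)))
        * ((norm (fst X1 - fst X0))\<^sup>2 + k * (snd X1 - snd X0)\<^sup>2)"
proof -
  define E where "E = (norm (fst X1 - fst X0))\<^sup>2 + k * (snd X1 - snd X0)\<^sup>2"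
  define w where "w = snd X1 - snd X0"
  define t where "t Y = 1 / (2 * sig X0 Y)" for Y
  define p where "p Y = inner (fst X1 - fst X0) (slope X0 Y)" for Y
  have g: "gap X0 Y X1 = p Y + E * t Y - w" for Y
    by (simp add: gap_def E_def w_def t_def p_def)
  have pl: "p Yl = (1 - l) * p Ya + l * p Yb" by (simp add: p_def assms inner_add_right)
  have tl: "(1 - l) / (2 * sig X0 Ya) = (1 - l) * t Ya" "l / (2 * sig X0 Yb) = l * t Yb"
    by (simp_all add: t_def)
  show ?thesis unfolding g pl tl E_def[symmetric] t_def[symmetric]
    by (simp add: algebra_simps)
qed

section \<open>Parallel refractors\<close>

lemma F_iff_cost:
  assumes "\<Sigma> \<subseteq> adm" "u ` \<Omega> \<subseteq> {0..M\<^sub>0}" "x0 \<in> \<Omega>"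
  shows "Y \<in> F \<kappa> \<Omega> \<Sigma> u x0 \<longleftrightarrow> Y \<in> \<Sigma> \<and> (\<forall>x\<in>\<Omega>. c (x0, u x0) Y \<le> c (x, u x) Y)"
proof -
  have "u x \<le> phi \<kappa> x Y (x0, u x0) \<longleftrightarrow> c (x0, u x0) Y \<le> c (x, u x) Y" if yx: "Y \<in> \<Sigma>" "x \<in> \<Omega>" for x
  proof -
    have in_cyl: "(y, u y) \<in> ccyl" if "y \<in> \<Omega>" for y using that assms(2) by auto
    have "Y \<in> adm" using yx assms(1) by auto
    then obtain m where "1 \<le> m" "phi \<kappa> x Y (x0, u x0) - u x = m * (c (x, u x) Y - c (x0, u x0) Y)"
      using phi_cost_ratio[of Y "(x0, u x0)" "(x, u x)"] in_cyl[OF yx(2)] in_cyl[OF assms(3)]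
      by (metis fst_conv snd_conv)
    then show ?thesis by (smt (verit) mult_nonneg_nonneg mult_pos_neg)
  qed
  then show ?thesis unfolding F_def by blast
qed

lemma refractor_lipschitz:
  assumes "\<Sigma> \<subseteq> adm" "parallel_refractor \<kappa> M\<^sub>0 \<Omega> \<Sigma> u" "x \<in> \<Omega>" "x' \<in> \<Omega>"
  shows "\<theta> * \<bar>u x' - u x\<bar> \<le> norm (x' - x)"
proof -
  have u: "u ` \<Omega> \<subseteq> {0..M\<^sub>0}" using assms(2) by (simp add: parallel_refractor_def)
  have one: "\<theta> * (u b - u a) \<le> norm (b - a)" if ab: "a \<in> \<Omega>" "b \<in> \<Omega>" for a b
  proof -
    obtain Y where Y: "Y \<in> F \<kappa> \<Omega> \<Sigma> u a"
      using assms(2) ab(1) unfolding parallel_refractor_def by blast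
    then have "c (a, u a) Y \<le> c (b, u b) Y" "Y \<in> adm"
      using F_iff_cost[OF assms(1) u ab(1)] ab assms(1) by auto
    moreover have "(a, u a) \<in> ccyl" "(b, u b) \<in> ccyl" using ab u by auto
    ultimately show ?thesis using cost_sublevel_lipschitz[of Y "(a, u a)" "(b, u b)"] by simp
  qed
  show ?thesis using one[OF assms(3,4)] one[OF assms(4,3)]
    by (simp add: abs_if norm_minus_commute)
qed

definition K\<^sub>c :: real where "K\<^sub>c = 2 / s0 * (1 + 1 / \<theta>)"

lemma Kc_pos: "0 < K\<^sub>c"
proof -
  have "0 < 1 + 1 / \<theta>" using theta_pos by (simp add: add_pos_pos)
  moreover have "0 < 2 / s0" using s0(1) by simp
  ultimately show ?thesis unfolding K\<^sub>c_def by (rule mult_pos_pos[rotated])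
qed

text \<open>\<open>X\<^sub>a\<close> minimises \<open>c(-, Y\<^sub>a)\<close> on the graph, so \<open>c(X\<^sub>a, Y\<^sub>b) - c(X\<^sub>b, Y\<^sub>b)\<close> is at most the mixed second
difference of the cost, in which the linear terms cancel. Hence \<open>X\<^sub>a\<close> almost minimises \<open>c(-, Y\<^sub>b)\<close>
as well.\<close>

lemma support_cost_comparison:
  assumes S: "\<Sigma> \<subseteq> adm" and u: "parallel_refractor \<kappa> M\<^sub>0 \<Omega> \<Sigma> u"
    and x: "xa \<in> \<Omega>" "xb \<in> \<Omega>" "x \<in> \<Omega>"
    and Y: "Ya \<in> F \<kappa> \<Omega> \<Sigma> u xa" "Yb \<in> F \<kappa> \<Omega> \<Sigma> u xb"
  shows "- (K\<^sub>c * norm (Ya - Yb) * norm (xa - xb)) \<le> c (x, u x) Yb - c (xa, u xa) Yb"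
proof -
  have ur: "u ` \<Omega> \<subseteq> {0..M\<^sub>0}" using u by (simp add: parallel_refractor_def)
  define Xa where "Xa = (xa, u xa)"
  define Xb where "Xb = (xb, u xb)"
  have X: "Xa \<in> ccyl" "Xb \<in> ccyl" using x ur by (auto simp: Xa_def Xb_def)
  have Ys: "Ya \<in> adm" "Yb \<in> adm" using Y S by (auto simp: F_def)
  have Fa: "c Xa Ya \<le> c Xb Ya" and Fb: "c Xb Yb \<le> c (x, u x) Yb"
    using F_iff_cost[OF S ur] Y x unfolding Xa_def Xb_def by auto
  have "norm (Xa - Xb) \<le> norm (xa - xb) + \<bar>u xa - u xb\<bar>"
    using norm_Pair_le[of "xa - xb" "u xa - u xb"] by (simp add: Xa_def Xb_def)
  moreover have "\<bar>u xa - u xb\<bar> \<le> norm (xa - xb) / \<theta>"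
    using refractor_lipschitz[OF S u x(2,1)] theta_pos by (simp add: pos_le_divide_eq mult.commute)
  ultimately have nX: "norm (Xa - Xb) \<le> (1 + 1 / \<theta>) * norm (xa - xb)" by (simp add: algebra_simps)
  have "c Xa Yb - c Xb Yb \<le> (c Xa Yb - c Xb Yb) - (c Xa Ya - c Xb Ya)" using Fa by simp
  also have "\<dots> = (norm (Xa - Yb) - norm (Xb - Yb)) - (norm (Xa - Ya) - norm (Xb - Ya))"
    by (simp add: cost_def algebra_simps)
  also have "\<dots> \<le> 2 / s0 * norm (Xa - Xb) * norm (Yb - Ya)"
    using s0 X Ys by (intro norm_mixed_difference) auto
  also have "\<dots> \<le> 2 / s0 * ((1 + 1 / \<theta>) * norm (xa - xb)) * norm (Yb - Ya)"
    using nX s0 by (intro mult_right_mono mult_left_mono) auto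
  also have "\<dots> = K\<^sub>c * norm (Ya - Yb) * norm (xa - xb)"
    by (simp add: K\<^sub>c_def norm_minus_commute mult_ac)
  finally show ?thesis using Fb by (simp add: Xa_def)
qed

definition K\<^sub>1 :: real where "K\<^sub>1 = \<beta>\<^sub>c * K\<^sub>c / \<alpha>\<^sub>g"

lemma K1_pos: "0 < K\<^sub>1" "K\<^sub>c / \<alpha>\<^sub>g \<le> K\<^sub>1"
proof -
  show "0 < K\<^sub>1" unfolding K\<^sub>1_def using beta_pos(2) Kc_pos alpha_pos by simp
  have "1 * K\<^sub>c \<le> \<beta>\<^sub>c * K\<^sub>c" using beta_pos(2) Kc_pos by (intro mult_right_mono) auto
  then show "K\<^sub>c / \<alpha>\<^sub>g \<le> K\<^sub>1" unfolding K\<^sub>1_def using alpha_pos by (intro divide_right_mono) auto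
qed

text \<open>\<open>N\<close> is the gain provided by regularity at the given \<open>x\<close>.\<close>

lemma gap_lower_local:
  assumes S: "\<Sigma> \<subseteq> adm" and u: "parallel_refractor \<kappa> M\<^sub>0 \<Omega> \<Sigma> u"
    and x: "xa \<in> \<Omega>" "xb \<in> \<Omega>" "x \<in> \<Omega>"
    and Y: "Ya \<in> F \<kappa> \<Omega> \<Sigma> u xa" "Yb \<in> F \<kappa> \<Omega> \<Sigma> u xb" "Yl \<in> adm"
    and N: "0 \<le> N"
    and reg: "min (phi \<kappa> x Ya (xa, u xa)) (phi \<kappa> x Yb (xa, u xa)) + N \<le> phi \<kappa> x Yl (xa, u xa)"
  shows "- (K\<^sub>1 * norm (Ya - Yb) * norm (xa - xb)) + N / \<beta> \<le> gap (xa, u xa) Yl (x, u x)"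
proof -
  have ur: "u ` \<Omega> \<subseteq> {0..M\<^sub>0}" using u by (simp add: parallel_refractor_def)
  define Xa where "Xa = (xa, u xa)"
  define X where "X = (x, u x)"
  have X: "Xa \<in> ccyl" "X \<in> ccyl" using x ur by (auto simp: Xa_def X_def)
  have Ys: "Ya \<in> adm" "Yb \<in> adm" using Y S by (auto simp: F_def)
  define e where "e = K\<^sub>c * norm (Ya - Yb) * norm (xa - xb)"
  have e0: "0 \<le> e" using Kc_pos by (simp add: e_def)
  have be: "0 \<le> \<beta>\<^sub>c * e" using e0 beta_pos(2) by simp
  have "u x \<le> phi \<kappa> x Ya Xa" using Y(1) x by (simp add: F_def Xa_def)
  moreover have "u x - \<beta>\<^sub>c * e \<le> phi \<kappa> x Yb Xa"
  proof -
    obtain m where m: "1 \<le> m" "m \<le> \<beta>\<^sub>c" "phi \<kappa> (fst X) Yb Xa - snd X = m * (c X Yb - c Xa Yb)"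
      using phi_cost_ratio[OF Ys(2) X] .
    have "- e \<le> c X Yb - c Xa Yb"
      using support_cost_comparison[OF S u x Y(1,2)] by (simp add: e_def X_def Xa_def)
    then have "m * (- e) \<le> phi \<kappa> (fst X) Yb Xa - snd X" unfolding m(3)
      using m(1) by (intro mult_left_mono) auto
    moreover have "m * e \<le> \<beta>\<^sub>c * e" using m e0 by (intro mult_right_mono) auto
    ultimately show ?thesis by (simp add: X_def)
  qed
  ultimately have low: "- (\<beta>\<^sub>c * e) + N \<le> phi \<kappa> x Yl Xa - u x"
    using reg be unfolding Xa_def by linarith
  obtain m where m: "\<alpha>\<^sub>g \<le> m" "m \<le> \<beta>" "phi \<kappa> (fst X) Yl Xa - snd X = m * gap Xa Yl X"
    using phi_gap_ratio[OF Y(3) X] .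
  have mpos: "0 < m" using m alpha_pos by linarith
  have "- (\<beta>\<^sub>c * e / \<alpha>\<^sub>g) + N / \<beta> \<le> - (\<beta>\<^sub>c * e / m) + N / m"
    using m mpos alpha_pos be N by (intro add_mono le_imp_neg_le divide_left_mono) auto
  also have "\<dots> = (- (\<beta>\<^sub>c * e) + N) / m" by (simp add: diff_divide_distrib)
  also have "\<dots> \<le> (m * gap Xa Yl X) / m"
    using low mpos m(3) by (intro divide_right_mono) (auto simp: X_def)
  also have "\<dots> = gap Xa Yl X" using mpos by simp
  finally show ?thesis by (simp add: K\<^sub>1_def e_def X_def Xa_def mult_ac)
qed

text \<open>Both gaps at \<open>Y\<^sub>a\<close> and \<open>Y\<^sub>b\<close> are nonnegative up to the error of \<open>support_cost_comparison\<close>, and the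
interpolated gap inherits this. Here the gain comes from a condition on the three targets alone, so
\<open>x\<close> is arbitrary.\<close>

lemma gap_lower_global:
  assumes S: "\<Sigma> \<subseteq> adm" and u: "parallel_refractor \<kappa> M\<^sub>0 \<Omega> \<Sigma> u"
    and x: "xa \<in> \<Omega>" "xb \<in> \<Omega>" "x \<in> \<Omega>"
    and Y: "Ya \<in> F \<kappa> \<Omega> \<Sigma> u xa" "Yb \<in> F \<kappa> \<Omega> \<Sigma> u xb"
    and l: "0 \<le> l" "l \<le> 1"
    and slope: "slope (xa, u xa) Yl = (1 - l) *\<^sub>R slope (xa, u xa) Ya + l *\<^sub>R slope (xa, u xa) Yb"
    and N: "0 \<le> N"
    and conc: "(1 - l) / (2 * sig (xa, u xa) Ya) + l / (2 * sig (xa, u xa) Yb) + N \<le> 1 / (2 * sig (xa, u xa) Yl)"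
  shows "- (K\<^sub>1 * norm (Ya - Yb) * norm (xa - xb)) + N * (norm (x - xa))\<^sup>2 \<le> gap (xa, u xa) Yl (x, u x)"
proof -
  have ur: "u ` \<Omega> \<subseteq> {0..M\<^sub>0}" using u by (simp add: parallel_refractor_def)
  define Xa where "Xa = (xa, u xa)"
  define X where "X = (x, u x)"
  have X: "Xa \<in> ccyl" "X \<in> ccyl" using x ur by (auto simp: Xa_def X_def)
  have Ys: "Ya \<in> adm" "Yb \<in> adm" using Y S by (auto simp: F_def)
  define p where "p = norm (Ya - Yb) * norm (xa - xb)"
  have p0: "0 \<le> p" by (simp add: p_def)
  have "c Xa Ya \<le> c X Ya" using F_iff_cost[OF S ur x(1)] Y(1) x by (auto simp: Xa_def X_def)
  then have a: "0 \<le> gap Xa Ya X" using gap_cost_sign[OF Ys(1) X, of 0] by simp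
  have "- (K\<^sub>c * p / \<alpha>\<^sub>g) \<le> gap Xa Yb X"
    using support_cost_comparison[OF S u x Y] Kc_pos p0
    by (intro gap_cost_sign[OF Ys(2) X]) (auto simp: p_def X_def Xa_def mult_ac)
  moreover have "K\<^sub>c / \<alpha>\<^sub>g * p \<le> K\<^sub>1 * p" using K1_pos(2) p0 by (rule mult_right_mono)
  ultimately have b: "- (K\<^sub>1 * p) \<le> gap Xa Yb X" by simp
  have "l * (K\<^sub>1 * p) \<le> 1 * (K\<^sub>1 * p)" using l p0 K1_pos by (intro mult_right_mono) auto
  moreover have "l * (- (K\<^sub>1 * p)) \<le> l * gap Xa Yb X" using b l by (intro mult_left_mono) auto
  ultimately have b': "- (K\<^sub>1 * p) \<le> l * gap Xa Yb X" by simp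
  define E where "E = (norm (x - xa))\<^sup>2 + k * (u x - u xa)\<^sup>2"
  define \<tau> where "\<tau> = 1 / (2 * sig Xa Yl) - ((1 - l) / (2 * sig Xa Ya) + l / (2 * sig Xa Yb))"
  have E: "(norm (x - xa))\<^sup>2 \<le> E" using k_bounds by (simp add: E_def)
  have \<tau>: "N \<le> \<tau>" using conc by (simp add: \<tau>_def Xa_def)
  have "N * (norm (x - xa))\<^sup>2 \<le> \<tau> * E" using E \<tau> N by (intro mult_mono) auto
  moreover have "gap Xa Yl X = (1 - l) * gap Xa Ya X + l * gap Xa Yb X + \<tau> * E"
    using gap_interpolation[of Xa Yl l Ya Yb X] slope by (simp add: Xa_def X_def \<tau>_def E_def)
  moreover have "0 \<le> (1 - l) * gap Xa Ya X" using a l by simp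
  ultimately have "- (K\<^sub>1 * p) + N * (norm (x - xa))\<^sup>2 \<le> gap Xa Yl X" using b' by linarith
  then show ?thesis by (simp add: p_def X_def Xa_def mult_ac)
qed

text \<open>The structural constant of the theorem.\<close>

definition C\<^sub>s :: real where "C\<^sub>s = \<beta> * (K\<^sub>1 + K\<^sub>T)"

lemma Cs_pos: "0 < C\<^sub>s"
proof -
  have "0 < K\<^sub>1 + K\<^sub>T" using K1_pos(1) KT_nonneg by (rule add_pos_nonneg)
  with beta_pos(1) show ?thesis unfolding C\<^sub>s_def by (rule mult_pos_pos)
qed

lemma refractor_estimate:
  assumes S: "\<Sigma> \<subseteq> adm" and u: "parallel_refractor \<kappa> M\<^sub>0 \<Omega> \<Sigma> u"
    and x: "xa \<in> \<Omega>" "x \<in> \<Omega>" and Y: "Yl \<in> adm" "Y \<in> adm"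
    and P: "0 \<le> P" "0 \<le> N"
    and g: "- (K\<^sub>1 * P) + N \<le> gap (xa, u xa) Yl (x, u x)"
  shows "u x - phi \<kappa> x Y (xa, u xa) \<le> C\<^sub>s * P + C\<^sub>s * norm (Yl - Y) * norm (x - xa) - \<alpha>\<^sub>g * N"
proof -
  have ur: "u ` \<Omega> \<subseteq> {0..M\<^sub>0}" using u by (simp add: parallel_refractor_def)
  define Xa where "Xa = (xa, u xa)"
  define X where "X = (x, u x)"
  have X: "Xa \<in> ccyl" "X \<in> ccyl" using x ur by (auto simp: Xa_def X_def)
  define R where "R = norm (Yl - Y) * norm (x - xa)"
  have R: "0 \<le> R" by (simp add: R_def)
  have "\<bar>gap Xa Yl X - gap Xa Y X\<bar> \<le> K\<^sub>T * norm (Yl - Y) * norm (fst X - fst Xa)"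
    using refractor_lipschitz[OF S u x]
    by (intro gap_change_target[OF Y X]) (simp add: X_def Xa_def)
  then have gY: "- (K\<^sub>1 * P + K\<^sub>T * R) + N \<le> gap Xa Y X"
    using g by (simp add: X_def Xa_def R_def mult_ac)
  obtain m where m: "\<alpha>\<^sub>g \<le> m" "m \<le> \<beta>" "phi \<kappa> (fst X) Y Xa - snd X = m * gap Xa Y X"
    using phi_gap_ratio[OF Y(2) X] .
  have mpos: "0 < m" using m alpha_pos by linarith
  have pr: "0 \<le> K\<^sub>1 * P" "0 \<le> K\<^sub>T * R" "0 \<le> K\<^sub>T * P" "0 \<le> K\<^sub>1 * R"
    using K1_pos(1) KT_nonneg P R by simp_all
  have "- (\<beta> * (K\<^sub>1 * P + K\<^sub>T * R)) + \<alpha>\<^sub>g * N \<le> - (m * (K\<^sub>1 * P + K\<^sub>T * R)) + m * N"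
    using m(1,2) pr(1,2) P(2) by (intro add_mono le_imp_neg_le mult_right_mono) simp_all
  also have "\<dots> = m * (- (K\<^sub>1 * P + K\<^sub>T * R) + N)" by (simp add: algebra_simps)
  also have "\<dots> \<le> m * gap Xa Y X" using gY mpos by (intro mult_left_mono) auto
  finally have 1: "u x - phi \<kappa> x Y Xa \<le> \<beta> * (K\<^sub>1 * P + K\<^sub>T * R) - \<alpha>\<^sub>g * N"
    using m(3) by (simp add: X_def)
  have "\<beta> * (K\<^sub>1 * P + K\<^sub>T * R) \<le> \<beta> * ((K\<^sub>1 + K\<^sub>T) * P + (K\<^sub>1 + K\<^sub>T) * R)"
    using pr beta_pos(1) by (intro mult_left_mono) (simp_all add: distrib_right)
  also have "\<dots> = C\<^sub>s * P + C\<^sub>s * R" by (simp add: C\<^sub>s_def algebra_simps)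
  finally show ?thesis using 1 by (simp add: Xa_def R_def mult_ac)
qed

text \<open>The minimum of the cost over the closed ball is attained inside, because on the boundary and
outside the cost exceeds its value at the centre.\<close>

lemma support_by_sliding:
  assumes S: "\<Sigma> \<subseteq> adm" and u: "parallel_refractor \<kappa> M\<^sub>0 \<Omega> \<Sigma> u" and Y: "Y \<in> \<Sigma>"
    and x0: "x0 \<in> \<Omega>" "0 < \<eta>" "cball x0 \<eta> \<subseteq> \<Omega>"
    and far: "\<And>x. x \<in> \<Omega> \<Longrightarrow> \<eta> \<le> norm (x - x0) \<Longrightarrow> c (x0, u x0) Y < c (x, u x) Y"
  shows "Y \<in> (\<Union>x \<in> ball x0 \<eta>. F \<kappa> \<Omega> \<Sigma> u x)"
proof -
  have ur: "u ` \<Omega> \<subseteq> {0..M\<^sub>0}" using u by (simp add: parallel_refractor_def)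
  have "(1 / \<theta>)-lipschitz_on \<Omega> u"
  proof (rule lipschitz_onI)
    fix x y assume "x \<in> \<Omega>" "y \<in> \<Omega>"
    then show "dist (u x) (u y) \<le> 1 / \<theta> * dist x y"
      using refractor_lipschitz[OF S u, of y x] theta_pos
      by (simp add: dist_norm pos_le_divide_eq mult.commute)
  qed (use theta_pos in simp)
  then have "continuous_on \<Omega> u" by (rule lipschitz_on_continuous_on)
  then have cu: "continuous_on (cball x0 \<eta>) u" using x0(3) by (rule continuous_on_subset)
  have cont: "continuous_on (cball x0 \<eta>) (\<lambda>x. c (x, u x) Y)"
    unfolding cost_def by (auto intro!: continuous_intros cu)
  obtain x where x: "x \<in> cball x0 \<eta>" "\<And>y. y \<in> cball x0 \<eta> \<Longrightarrow> c (x, u x) Y \<le> c (y, u y) Y"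
    using continuous_attains_inf[OF compact_cball _ cont] x0(2) by auto
  have xx0: "c (x, u x) Y \<le> c (x0, u x0) Y" using x(2)[of x0] x0(2) by simp
  have xO: "x \<in> \<Omega>" using x x0 by auto
  have "x \<in> ball x0 \<eta>"
    using far[OF xO] xx0 by (force simp: dist_norm norm_minus_commute)
  moreover have "Y \<in> F \<kappa> \<Omega> \<Sigma> u x"
    unfolding F_iff_cost[OF S ur xO]
  proof (intro conjI ballI Y)
    fix y assume y: "y \<in> \<Omega>"
    show "c (x, u x) Y \<le> c (y, u y) Y"
    proof (cases "\<eta> \<le> norm (y - x0)")
      case True
      then show ?thesis using far[OF y] xx0 by simp
    next
      case False
      then show ?thesis using x(2)[of y] by (simp add: dist_norm norm_minus_commute)
    qed
  qed
  ultimately show ?thesis by blast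
qed

section \<open>Global consequences of regularity in dimension at least two\<close>

text \<open>Membership in \<open>Yseg\<close> only says that the point lies on some ray of the family. It lies on the ray
with parameter \<open>l\<close> because the value of \<open>s\<close> there is positive: the point is higher than \<open>Z\<close>, and
all directions \<open>Lam \<kappa> v\<close> point upwards.\<close>

lemma Ycurve_slope:
  assumes "\<Sigma> \<subseteq> adm" "Z \<in> ccyl" "Ya \<in> \<Sigma>" "Yb \<in> \<Sigma>"
    and "Ycurve \<kappa> s Ya Yb Z l \<in> Yseg \<kappa> \<Sigma> Ya Yb Z"
  shows "Ycurve \<kappa> s Ya Yb Z l \<in> \<Sigma>"
    and "slope Z (Ycurve \<kappa> s Ya Yb Z l) = (1 - l) *\<^sub>R slope Z Ya + l *\<^sub>R slope Z Yb"
proof -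
  define v where "v = vseg \<kappa> Ya Yb Z l"
  have v: "v = (1 - l) *\<^sub>R slope Z Ya + l *\<^sub>R slope Z Yb"
  proof -
    have "Ya \<in> adm" "Yb \<in> adm" using assms(1,3,4) by auto
    then show ?thesis using grad_phi[OF _ assms(2)] by (simp add: v_def vseg_def)
  qed
  define t where "t = s Z (Lam \<kappa> v)"
  have Y: "Ycurve \<kappa> s Ya Yb Z l = Z + t *\<^sub>R Lam \<kappa> v"
    by (simp add: Ycurve_def Let_def v_def t_def)
  show S: "Ycurve \<kappa> s Ya Yb Z l \<in> \<Sigma>" using assms(5) by (simp add: Yseg_def)
  then have "Ycurve \<kappa> s Ya Yb Z l \<in> adm" using assms(1) by blast
  then have "0 < sig Z (Z + t *\<^sub>R Lam \<kappa> v)" using sig_pos(2)[OF _ assms(2)] unfolding Y by blast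
  then have "0 < t * snd (Lam \<kappa> v)"
    using kap by (simp add: sig_def) (smt (verit) mult_nonneg_nonneg norm_ge_zero)
  then have "0 < t" using Lam_snd_pos[of v] by (simp add: zero_less_mult_iff)
  then show "slope Z (Ycurve \<kappa> s Ya Yb Z l) = (1 - l) *\<^sub>R slope Z Ya + l *\<^sub>R slope Z Yb"
    unfolding Y using Lam_ray(2) v by simp
qed

text \<open>The difference of the two functions changes sign along the direction in which their slopes differ.
In dimension at least two a small sphere is connected, so it has a zero there. For \<open>n = 1\<close> a sphere
consists of two points and the functions need not cross again.\<close>

lemma phi_crossing_near:
  assumes Y: "Ya \<in> adm" "Yb \<in> adm" and Z: "Z \<in> cyl M\<^sub>0 \<Omega>"
    and ne: "slope Z Ya \<noteq> slope Z Yb" and n: "2 \<le> CARD('n)" and \<epsilon>: "0 < \<epsilon>"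
  obtains X where "X \<in> cyl M\<^sub>0 \<Omega>" "fst X \<noteq> fst Z" "norm (fst X - fst Z) \<le> \<epsilon>"
    "phi \<kappa> (fst X) Ya Z = snd X" "phi \<kappa> (fst X) Yb Z = snd X"
proof -
  have Zc: "Z \<in> ccyl" using Z by (auto simp: cyl_def)
  define e where "e = sgn (slope Z Ya - slope Z Yb)"
  have e1: "norm e = 1" using ne by (simp add: e_def norm_sgn)
  define f where "f x = phi \<kappa> x Ya Z - phi \<kappa> x Yb Z" for x
  define g where "g r = f (fst Z + r *\<^sub>R e)" for r :: real
  define a where "a = inner e (slope Z Ya - slope Z Yb)"
  have a: "0 < a"
  proof -
    have "a = norm (slope Z Ya - slope Z Yb)"
      using ne by (simp add: a_def e_def sgn_div_norm power2_norm_eq_inner[symmetric] power2_eq_square)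
    then show ?thesis using ne by simp
  qed
  have der: "DERIV g 0 :> a"
  proof -
    have "((\<lambda>x. phi \<kappa> x Ya Z) has_derivative (\<lambda>h. inner h (slope Z Ya))) (at (fst Z))"
      "((\<lambda>x. phi \<kappa> x Yb Z) has_derivative (\<lambda>h. inner h (slope Z Yb))) (at (fst Z))"
      using phi_gderiv sig_pos(2) Y Zc by (auto simp: gderiv_def)
    then have "(f has_derivative (\<lambda>h. inner h (slope Z Ya) - inner h (slope Z Yb))) (at (fst Z))"
      unfolding f_def by (rule has_derivative_diff)
    then have f': "(f has_derivative (\<lambda>h. inner h (slope Z Ya) - inner h (slope Z Yb)))
        (at (fst Z + 0 *\<^sub>R e))" by simp
    have "((\<lambda>r. fst Z + r *\<^sub>R e) has_derivative (\<lambda>r. r *\<^sub>R e)) (at (0::real))"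
      by (auto intro!: derivative_eq_intros)
    from has_derivative_compose[OF this f']
    have "(g has_derivative (\<lambda>r. inner (r *\<^sub>R e) (slope Z Ya) - inner (r *\<^sub>R e) (slope Z Yb))) (at 0)"
      unfolding g_def .
    moreover have "(\<lambda>r. inner (r *\<^sub>R e) (slope Z Ya) - inner (r *\<^sub>R e) (slope Z Yb)) = (*) a"
      by (simp add: fun_eq_iff a_def inner_diff_right algebra_simps)
    ultimately show ?thesis by (simp add: has_field_derivative_def)
  qed
  have g0: "g 0 = 0" using phi_self Y Zc by (simp add: g_def f_def)
  obtain d1 where d1: "0 < d1" "\<And>h. 0 < h \<Longrightarrow> h < d1 \<Longrightarrow> 0 < g h"
    using DERIV_pos_inc_right[OF der a] g0 by auto
  obtain d2 where d2: "0 < d2" "\<And>h. 0 < h \<Longrightarrow> h < d2 \<Longrightarrow> g (- h) < 0"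
    using DERIV_pos_inc_left[OF der a] g0 by auto
  have "open ((\<lambda>x. (x, phi \<kappa> x Ya Z)) -` cyl M\<^sub>0 \<Omega>)"
    by (rule open_vimage) (auto simp: cyl_def dom open_Times intro!: continuous_intros continuous_on_phi)
  moreover have "fst Z \<in> (\<lambda>x. (x, phi \<kappa> x Ya Z)) -` cyl M\<^sub>0 \<Omega>" using Z Zc Y phi_self by simp
  ultimately obtain d3 where d3: "0 < d3" "\<And>x. dist x (fst Z) < d3 \<Longrightarrow> (x, phi \<kappa> x Ya Z) \<in> cyl M\<^sub>0 \<Omega>"
    unfolding open_dist by blast
  define r where "r = min (min d1 d2) (min d3 \<epsilon>) / 2"
  have r: "0 < r" "r < d1" "r < d2" "r < d3" "r \<le> \<epsilon>"
    using d1(1) d2(1) d3(1) \<epsilon> by (auto simp: r_def min_def)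
  have "connected (f ` sphere (fst Z) r)"
    using n by (intro connected_continuous_image connected_sphere)
      (auto simp: f_def intro!: continuous_intros continuous_on_phi)
  moreover have "f (fst Z + r *\<^sub>R e) \<in> f ` sphere (fst Z) r" "f (fst Z + (- r) *\<^sub>R e) \<in> f ` sphere (fst Z) r"
    using r(1) e1 by (auto simp: dist_norm)
  moreover have "0 < f (fst Z + r *\<^sub>R e)" "f (fst Z + (- r) *\<^sub>R e) < 0"
    using d1(2)[OF r(1,2)] d2(2)[OF r(1,3)] unfolding g_def by auto
  ultimately have "0 \<in> f ` sphere (fst Z) r"
    by (meson connectedD_interval less_imp_le)
  then obtain x where x: "norm (x - fst Z) = r" "f x = 0"
    by (auto simp: dist_norm norm_minus_commute)
  show thesis
  proof (rule that)
    show "(x, phi \<kappa> x Ya Z) \<in> cyl M\<^sub>0 \<Omega>" using d3(2) x r by (simp add: dist_norm)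
  qed (use x r in \<open>auto simp: f_def\<close>)
qed

text \<open>At a crossing point the gaps of \<open>Y\<^sub>a\<close> and \<open>Y\<^sub>b\<close> vanish, and by \<open>gap_interpolation\<close> the gap of \<open>Y(\<lambda>)\<close>
is precisely the deviation of \<open>1 / (2 sig)\<close> from its interpolation times a quadratic factor of
order \<open>|x - z|\<^sup>2\<close>, the order of the gain.\<close>

lemma curvature_concave:
  assumes Y: "Ya \<in> adm" "Yb \<in> adm" "Yl \<in> adm" and Z: "Z \<in> cyl M\<^sub>0 \<Omega>"
    and ne: "slope Z Ya \<noteq> slope Z Yb" and n: "2 \<le> CARD('n)" and N: "0 \<le> N" "0 < \<epsilon>"
    and slope: "slope Z Yl = (1 - l) *\<^sub>R slope Z Ya + l *\<^sub>R slope Z Yb"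
    and reg: "\<And>x. x \<in> \<Omega> \<Longrightarrow> norm (x - fst Z) \<le> \<epsilon> \<Longrightarrow>
        min (phi \<kappa> x Ya Z) (phi \<kappa> x Yb Z) + N * (norm (x - fst Z))\<^sup>2 \<le> phi \<kappa> x Yl Z"
  shows "(1 - l) / (2 * sig Z Ya) + l / (2 * sig Z Yb) + N / \<beta> / (1 + 1 / \<theta>\<^sup>2) \<le> 1 / (2 * sig Z Yl)"
proof -
  obtain X where X: "X \<in> cyl M\<^sub>0 \<Omega>" "fst X \<noteq> fst Z" "norm (fst X - fst Z) \<le> \<epsilon>"
    "phi \<kappa> (fst X) Ya Z = snd X" "phi \<kappa> (fst X) Yb Z = snd X"
    using phi_crossing_near[OF Y(1,2) Z ne n N(2)] .
  have c: "Z \<in> ccyl" "X \<in> ccyl" using X Z by (auto simp: cyl_def)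
  define q where "q = (norm (fst X - fst Z))\<^sup>2"
  define E where "E = q + k * (snd X - snd Z)\<^sup>2"
  have q: "0 < q" using X(2) by (simp add: q_def)
  have lip: "\<theta> * \<bar>snd X - snd Z\<bar> \<le> norm (fst X - fst Z)"
    using cost_sublevel_lipschitz[OF Y(1) c] cost_sublevel_lipschitz[OF Y(1) c(2,1)] on_support_graph(2)[OF Y(1) c X(4)]
    by (simp add: abs_if norm_minus_commute)
  have E: "q \<le> E" "E \<le> q * (1 + 1 / \<theta>\<^sup>2)"
    using k_bounds energy_bound[OF lip] by (auto simp: E_def q_def)
  define \<tau> where "\<tau> = 1 / (2 * sig Z Yl) - ((1 - l) / (2 * sig Z Ya) + l / (2 * sig Z Yb))"
  have gl: "gap Z Yl X = \<tau> * E"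
    using gap_interpolation[OF slope, of X] on_support_graph(1)[OF Y(1) c X(4)] on_support_graph(1)[OF Y(2) c X(5)]
    by (simp add: \<tau>_def E_def q_def)
  obtain m where m: "\<alpha>\<^sub>g \<le> m" "m \<le> \<beta>" "phi \<kappa> (fst X) Yl Z - snd X = m * gap Z Yl X"
    using phi_gap_ratio[OF Y(3) c] .
  have mpos: "0 < m" using m alpha_pos by linarith
  have "N * q \<le> m * (\<tau> * E)"
    using reg[of "fst X"] X c m(3) gl by (auto simp: q_def)
  then have "N * q / \<beta> \<le> m * (\<tau> * E) / \<beta>" using beta_pos(1) by (intro divide_right_mono) auto
  also have nn: "0 \<le> m * (\<tau> * E)" using \<open>N * q \<le> m * (\<tau> * E)\<close> N q by (smt (verit) mult_nonneg_nonneg)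
  then have "0 \<le> \<tau> * E" using mpos by (simp add: zero_le_mult_iff)
  then have "0 \<le> \<tau>" using E q by (simp add: zero_le_mult_iff)
  have "m * (\<tau> * E) / \<beta> \<le> \<beta> * (\<tau> * E) / \<beta>"
    using m(2) \<open>0 \<le> \<tau> * E\<close> beta_pos(1) by (intro divide_right_mono mult_right_mono) auto
  also have "\<dots> = \<tau> * E" using beta_pos(1) by simp
  also have "\<dots> \<le> \<tau> * (q * (1 + 1 / \<theta>\<^sup>2))" using E \<open>0 \<le> \<tau>\<close> by (intro mult_left_mono) auto
  finally have "N / \<beta> * q \<le> (\<tau> * (1 + 1 / \<theta>\<^sup>2)) * q" by (simp add: mult_ac)
  then have "N / \<beta> \<le> \<tau> * (1 + 1 / \<theta>\<^sup>2)" using q by (rule mult_right_le_imp_le)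
  moreover have "0 < 1 + 1 / \<theta>\<^sup>2" by (simp add: add_pos_nonneg)
  ultimately have "N / \<beta> / (1 + 1 / \<theta>\<^sup>2) \<le> \<tau>" by (simp only: pos_divide_le_eq)
  then show ?thesis by (simp add: \<tau>_def)
qed

section \<open>Visibility in dimension one\<close>

text \<open>A target point at which \<open>A\<close> and \<open>B\<close> have equal cost lies on the branch of a hyperbola with foci \<open>A\<close>
and \<open>B\<close> that does not depend on the point; \<open>hyperbola_secant\<close> applies with \<open>A\<close> as the origin.\<close>

lemma one_dim_chord_meets_segment:
  assumes one: "CARD('n) = 1" and Y: "Y \<in> adm" "Y' \<in> adm" "Y \<noteq> Y'"
    and A: "A \<in> ccyl" "B \<in> ccyl" "fst A \<noteq> fst B"
    and c: "c A Y = c B Y" "c A Y' = c B Y'"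
  obtains t r where "0 < t" "t < 1" "0 < r"
    "Y' - ((1 - t) *\<^sub>R A + t *\<^sub>R B) = r *\<^sub>R (Y - ((1 - t) *\<^sub>R A + t *\<^sub>R B))"
proof -
  define z where "z = norm (fst B - fst A)"
  define e where "e = sgn (fst B - fst A)"
  define w where "w = snd B - snd A"
  define y where "y Z = inner (fst Z - fst A) e" for Z :: "(real ^ 'n) \<times> real"
  define h where "h Z = snd Z - snd A" for Z :: "(real ^ 'n) \<times> real"
  have z: "0 < z" using A(3) by (simp add: z_def)
  have e1: "norm e = 1" using A(3) by (simp add: e_def norm_sgn)
  have ex: "fst Z - fst A = y Z *\<^sub>R e" for Z unfolding y_def by (rule one_dim_expand[OF one e1])
  have Bz: "fst B - fst A = z *\<^sub>R e" using A(3) by (simp add: z_def e_def sgn_div_norm)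
  have nA: "norm (A - Z) = sqrt ((y Z)\<^sup>2 + (h Z)\<^sup>2)" for Z
  proof -
    have "norm (fst A - fst Z) = \<bar>y Z\<bar>"
      using ex[of Z] e1 by (metis mult.right_neutral norm_minus_commute norm_scaleR)
    then show ?thesis by (simp add: norm_prod_def h_def power2_commute[of "snd A"])
  qed
  have nB: "norm (B - Z) = sqrt ((z - y Z)\<^sup>2 + (w - h Z)\<^sup>2)" for Z
  proof -
    have "fst B - fst Z = (z - y Z) *\<^sub>R e" using ex[of Z] Bz by (simp add: scaleR_left_diff_distrib) (metis diff_diff_eq2 diff_add_cancel)
    then have "norm (fst B - fst Z) = \<bar>z - y Z\<bar>" using e1 by simp
    then show ?thesis by (simp add: norm_prod_def h_def w_def)
  qed
  have cc: "sqrt ((y Z)\<^sup>2 + (h Z)\<^sup>2) = sqrt ((z - y Z)\<^sup>2 + (w - h Z)\<^sup>2) + \<kappa> * w"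
    if "c A Z = c B Z" for Z
    using that unfolding nA[symmetric] nB[symmetric] by (simp add: cost_def w_def algebra_simps)
  have sA: "\<kappa> * sqrt ((y Z)\<^sup>2 + (h Z)\<^sup>2) < h Z" if "Z \<in> adm" for Z
    using sig_pos(2)[OF that A(1)] unfolding nA[symmetric] by (simp add: sig_def h_def)
  have sB: "\<kappa> * sqrt ((z - y Z)\<^sup>2 + (w - h Z)\<^sup>2) < h Z - w" if "Z \<in> adm" for Z
    using sig_pos(2)[OF that A(2)] unfolding nB[symmetric] by (simp add: sig_def h_def w_def)
  have ne: "y Y \<noteq> y Y' \<or> h Y \<noteq> h Y'"
  proof (rule ccontr)
    assume "\<not> ?thesis"
    then have "fst Y - fst A = fst Y' - fst A" "snd Y = snd Y'"
      unfolding ex by (auto simp: h_def)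
    then show False using Y(3) by (simp add: prod_eq_iff)
  qed
  obtain t r where tr: "0 < t" "t < 1" "0 < r" "y Y' - t * z = r * (y Y - t * z)" "h Y' - t * w = r * (h Y - t * w)"
    using hyperbola_secant[OF z kap cc[OF c(1)] cc[OF c(2)] sA[OF Y(1)] sB[OF Y(1)] sA[OF Y(2)] sB[OF Y(2)] ne]
    by blast
  have X: "fst Z - fst ((1 - t) *\<^sub>R A + t *\<^sub>R B) = (y Z - t * z) *\<^sub>R e"
    "snd Z - snd ((1 - t) *\<^sub>R A + t *\<^sub>R B) = h Z - t * w" for Z
  proof -
    have "fst ((1 - t) *\<^sub>R A + t *\<^sub>R B) = fst A + t *\<^sub>R (fst B - fst A)" by (simp add: algebra_simps)
    then have "fst Z - fst ((1 - t) *\<^sub>R A + t *\<^sub>R B) = (fst Z - fst A) - t *\<^sub>R (fst B - fst A)" by simp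
    then show "fst Z - fst ((1 - t) *\<^sub>R A + t *\<^sub>R B) = (y Z - t * z) *\<^sub>R e"
      unfolding Bz ex[of Z] by (simp add: scaleR_left_diff_distrib)
    show "snd Z - snd ((1 - t) *\<^sub>R A + t *\<^sub>R B) = h Z - t * w"
      by (simp add: h_def w_def algebra_simps)
  qed
  show thesis
  proof (rule that[OF tr(1-3)], rule prod_eqI)
    show "fst (Y' - ((1 - t) *\<^sub>R A + t *\<^sub>R B)) = fst (r *\<^sub>R (Y - ((1 - t) *\<^sub>R A + t *\<^sub>R B)))"
      unfolding fst_diff fst_scaleR X tr(4) by simp
    show "snd (Y' - ((1 - t) *\<^sub>R A + t *\<^sub>R B)) = snd (r *\<^sub>R (Y - ((1 - t) *\<^sub>R A + t *\<^sub>R B)))"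
      unfolding snd_diff snd_scaleR X tr(5) by simp
  qed
qed

text \<open>Along the graph of \<open>u\<close> the cost \<open>c(-, Y)\<close> has connected sublevel sets, as long as the end where it is
larger lies below the top of the cylinder. This takes the place of the argument
through crossing points on small spheres.\<close>

lemma one_dim_cost_no_interior_max:
  assumes one: "CARD('n) = 1" and tgt: "target \<kappa> M\<^sub>0 \<delta>\<^sub>0 \<Omega> \<Sigma> s"
    and u: "parallel_refractor \<kappa> M\<^sub>0 \<Omega> \<Sigma> u" and Y: "Y \<in> \<Sigma>"
    and x: "x0 \<in> \<Omega>" "x1 \<in> \<Omega>" "x0 \<noteq> x1" and u0: "u x0 < M\<^sub>0" and \<rho>: "0 < \<rho>" "\<rho> < 1"
    and c1: "c (x1, u x1) Y \<le> c (x0, u x0) Y"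
    and xr: "xr = (1 - \<rho>) *\<^sub>R x0 + \<rho> *\<^sub>R x1"
  shows "c (xr, u xr) Y \<le> c (x0, u x0) Y"
proof (rule ccontr)
  assume "\<not> ?thesis"
  then have cr: "c (x0, u x0) Y < c (xr, u xr) Y" by simp
  have S: "\<Sigma> \<subseteq> adm" using tgt by (rule target_admissible)
  have ur: "u ` \<Omega> \<subseteq> {0..M\<^sub>0}" using u by (simp add: parallel_refractor_def)
  have conv: "convex \<Omega>" using dom(2) one by (simp add: connected_convex_1_gen)
  define x where "x \<tau> = (1 - \<tau>) *\<^sub>R x0 + \<tau> *\<^sub>R x1" for \<tau> :: real
  have xO: "x \<tau> \<in> \<Omega>" if "0 \<le> \<tau>" "\<tau> \<le> 1" for \<tau>
    unfolding x_def using convexD_alt[OF conv] \<open>x0 \<in> \<Omega>\<close> \<open>x1 \<in> \<Omega>\<close> that by blast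
  have xrr: "xr = x \<rho>" by (simp add: x_def xr)
  have xrO: "xr \<in> \<Omega>" using xO \<rho> by (simp add: xrr)
  define G where "G y = (y, u y)" for y
  have GO: "G y \<in> ccyl" if "y \<in> \<Omega>" for y using that ur by (auto simp: G_def)
  \<comment> \<open>\<open>Yr\<close> supports \<open>u\<close> at the supposed interior maximum.\<close>
  obtain Yr where Yr: "Yr \<in> F \<kappa> \<Omega> \<Sigma> u xr" using u xrO unfolding parallel_refractor_def by blast
  have Ys: "Y \<in> adm" "Yr \<in> adm" "Yr \<in> \<Sigma>" using S Y Yr by (auto simp: F_def)
  have Fr: "u y \<le> phi \<kappa> y Yr (G xr)" if "y \<in> \<Omega>" for y using Yr that by (simp add: F_def G_def)
  define f where "f \<tau> = phi \<kappa> (x \<tau>) Y (G x0) - phi \<kappa> (x \<tau>) Yr (G xr)" for \<tau>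
  have x01: "x 0 = x0" "x 1 = x1" by (simp_all add: x_def)
  have f0: "f 0 \<le> 0"
    using phi_self[OF Ys(1) GO[OF \<open>x0 \<in> \<Omega>\<close>]] Fr[OF \<open>x0 \<in> \<Omega>\<close>] by (simp add: f_def x01 G_def)
  have f1: "f 1 \<le> 0"
    using phi_le_iff_cost[OF Ys(1) GO GO, of x0 x1] \<open>x0 \<in> \<Omega>\<close> \<open>x1 \<in> \<Omega>\<close> c1 Fr[of x1]
    by (simp add: f_def x01 G_def)
  have fr: "u xr < phi \<kappa> xr Y (G x0)"
    using phi_le_iff_cost[OF Ys(1) GO GO, of x0 xr] \<open>x0 \<in> \<Omega>\<close> xrO cr by (simp add: G_def)
  then have f\<rho>: "0 < f \<rho>"
    using phi_self[OF Ys(2) GO[OF xrO]] by (simp add: f_def G_def flip: xrr)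
  have contx: "continuous_on UNIV x" unfolding x_def by (intro continuous_intros)
  have contf: "continuous_on T f" for T
    unfolding f_def
    by (intro continuous_on_diff continuous_on_compose2[OF continuous_on_phi[of UNIV]]
        continuous_on_subset[OF contx]) auto
  \<comment> \<open>The ellipse of \<open>Y\<close> through \<open>x0\<close> lies below the supporting one at both ends and above it in between, so they cross on either side of \<open>xr\<close>.\<close>
  obtain a where a: "0 \<le> a" "a \<le> \<rho>" "f a = 0"
    using IVT'[of f 0 0 \<rho>] f0 f\<rho> \<rho> contf by auto
  obtain b where b: "\<rho> \<le> b" "b \<le> 1" "f b = 0"
    using IVT2'[of f 1 0 \<rho>] f1 f\<rho> \<rho> contf by auto
  have ab: "a < \<rho>" "\<rho> < b" using a b f\<rho> by (auto simp: less_le)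
  define t where "t \<tau> = phi \<kappa> (x \<tau>) Yr (G xr)" for \<tau>
  have point: "(x \<tau>, t \<tau>) \<in> ccyl \<and> c (x \<tau>, t \<tau>) Y = c (G x0) Y \<and> c (x \<tau>, t \<tau>) Yr = c (G xr) Yr
      \<and> t \<tau> \<le> (1 - \<tau>) * u x0 + \<tau> * u x1"
    if \<tau>: "0 \<le> \<tau>" "\<tau> \<le> 1" "f \<tau> = 0" for \<tau>
  proof -
    have xt: "x \<tau> \<in> \<Omega>" using xO \<tau> by blast
    \<comment> \<open>The chord of the graph of \<open>u\<close> lies inside the ellipse of \<open>Y\<close>, which bounds the crossing height from above.\<close>
    define P where "P = (1 - \<tau>) *\<^sub>R G x0 + \<tau> *\<^sub>R G x1"
    have P: "P = (x \<tau>, (1 - \<tau>) * u x0 + \<tau> * u x1)" by (simp add: P_def G_def x_def)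
    have uu: "0 \<le> u x0" "u x0 \<le> M\<^sub>0" "0 \<le> u x1" "u x1 \<le> M\<^sub>0" using ur \<open>x0 \<in> \<Omega>\<close> \<open>x1 \<in> \<Omega>\<close> by auto
    have "(1 - \<tau>) * u x0 + \<tau> * u x1 \<le> (1 - \<tau>) * M\<^sub>0 + \<tau> * M\<^sub>0"
      using uu \<tau> by (intro add_mono mult_left_mono) auto
    then have hM: "(1 - \<tau>) * u x0 + \<tau> * u x1 \<le> M\<^sub>0" by (simp add: algebra_simps)
    have h0: "0 \<le> (1 - \<tau>) * u x0 + \<tau> * u x1" using uu \<tau> by simp
    have Pc: "P \<in> ccyl" using xt hM h0 by (simp add: P)
    have "c P Y \<le> (1 - \<tau>) * c (G x0) Y + \<tau> * c (G x1) Y"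
      unfolding P_def using \<tau> by (intro cost_convex) auto
    also have "\<dots> \<le> (1 - \<tau>) * c (G x0) Y + \<tau> * c (G x0) Y"
      using c1 \<tau> by (intro add_mono mult_left_mono) (auto simp: G_def)
    finally have "c P Y \<le> c (G x0) Y" by (simp add: algebra_simps)
    then have "phi \<kappa> (x \<tau>) Y (G x0) \<le> snd P"
      using phi_le_iff_cost[OF Ys(1) GO[OF \<open>x0 \<in> \<Omega>\<close>] Pc] by (simp add: P)
    then have tP: "t \<tau> \<le> (1 - \<tau>) * u x0 + \<tau> * u x1" using \<tau>(3) by (simp add: f_def t_def P)
    have "u (x \<tau>) \<le> t \<tau>" unfolding t_def using Fr[OF xt] .
    moreover have "0 \<le> u (x \<tau>)" using ur xt by auto
    ultimately have T: "(x \<tau>, t \<tau>) \<in> ccyl" using xt tP hM by simp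
    have "c (x \<tau>, t \<tau>) Y = c (G x0) Y"
      using on_support_graph(2)[OF Ys(1) GO[OF \<open>x0 \<in> \<Omega>\<close>] T] \<tau>(3) by (simp add: f_def t_def)
    moreover have "c (x \<tau>, t \<tau>) Yr = c (G xr) Yr"
      using on_support_graph(2)[OF Ys(2) GO[OF xrO] T] by (simp add: t_def)
    ultimately show ?thesis using T tP by blast
  qed
  define A where "A = (x a, t a)"
  define B where "B = (x b, t b)"
  have A: "A \<in> ccyl" "c A Y = c (G x0) Y" "c A Yr = c (G xr) Yr" "snd A \<le> (1 - a) * u x0 + a * u x1"
    using point[of a] a \<rho> by (auto simp: A_def)
  have B: "B \<in> ccyl" "c B Y = c (G x0) Y" "c B Yr = c (G xr) Yr"
    using point[of b] b \<rho> by (auto simp: B_def)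
  have YYr: "Y \<noteq> Yr" using A cr by (auto simp: G_def)
  have AB: "fst A \<noteq> fst B"
  proof -
    have "fst B - fst A = (b - a) *\<^sub>R (x1 - x0)" by (simp add: A_def B_def x_def algebra_simps)
    then show ?thesis using ab \<open>x0 \<noteq> x1\<close> by auto
  qed
  have AM: "snd A < M\<^sub>0"
  proof -
    have "(1 - a) * u x0 < (1 - a) * M\<^sub>0" using u0 ab \<rho> by simp
    moreover have "a * u x1 \<le> a * M\<^sub>0" using ur \<open>x1 \<in> \<Omega>\<close> a by (intro mult_left_mono) auto
    ultimately show ?thesis using A(4) by (simp add: algebra_simps)
  qed
  \<comment> \<open>If both crossings had height zero, convexity would keep the ellipse of \<open>Y\<close> at or below height zero at \<open>xr\<close>, where it lies above \<open>u\<close>.\<close>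
  have pos: "0 < snd A \<or> 0 < snd B"
  proof (rule ccontr)
    assume "\<not> ?thesis"
    then have z: "snd A = 0" "snd B = 0" using A(1) B(1) by (auto simp: mem_Times_iff)
    define \<omega> where "\<omega> = (\<rho> - a) / (b - a)"
    have l: "0 \<le> \<omega>" "\<omega> \<le> 1" using ab by (auto simp: \<omega>_def)
    have "a + \<omega> * (b - a) = \<rho>" using ab by (simp add: \<omega>_def)
    then have "xr = x (a + \<omega> * (b - a))" by (simp add: xrr)
    also have "\<dots> = (1 - \<omega>) *\<^sub>R x a + \<omega> *\<^sub>R x b" by (simp add: x_def algebra_simps)
    finally have P: "(1 - \<omega>) *\<^sub>R A + \<omega> *\<^sub>R B = (xr, 0)" using z by (simp add: A_def B_def)
    have "c (xr, 0) Y \<le> (1 - \<omega>) * c A Y + \<omega> * c B Y" unfolding P[symmetric] using l by (rule cost_convex)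
    also have "\<dots> = c (G x0) Y" using A B by (simp add: algebra_simps)
    finally have "phi \<kappa> xr Y (G x0) \<le> 0"
      using phi_le_iff_cost[OF Ys(1) GO[OF \<open>x0 \<in> \<Omega>\<close>], of "(xr, 0)"] xrO M0 by simp
    moreover have "0 \<le> u xr" using ur xrO by auto
    ultimately show False using fr by simp
  qed
  obtain \<omega> r where \<omega>: "0 < \<omega>" "\<omega> < 1" "0 < r"
    "Yr - ((1 - \<omega>) *\<^sub>R A + \<omega> *\<^sub>R B) = r *\<^sub>R (Y - ((1 - \<omega>) *\<^sub>R A + \<omega> *\<^sub>R B))"
    using one_dim_chord_meets_segment[OF one Ys(1,2) YYr A(1) B(1) AB] A B by metis
  have "(1 - \<omega>) *\<^sub>R A + \<omega> *\<^sub>R B \<in> cyl M\<^sub>0 \<Omega>"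
  proof -
    have hA: "0 \<le> snd A" "snd A < M\<^sub>0" "0 \<le> snd B" "snd B \<le> M\<^sub>0" "fst A \<in> \<Omega>" "fst B \<in> \<Omega>"
      using A(1) B(1) AM by (auto simp: mem_Times_iff)
    have "(1 - \<omega>) * snd A < (1 - \<omega>) * M\<^sub>0" "\<omega> * snd B \<le> \<omega> * M\<^sub>0" using hA \<omega> by auto
    then have "(1 - \<omega>) * snd A + \<omega> * snd B < M\<^sub>0" by (simp add: algebra_simps)
    moreover have "0 < (1 - \<omega>) * snd A + \<omega> * snd B"
      using pos hA \<omega> by (smt (verit) mult_nonneg_nonneg mult_pos_pos)
    moreover have "(1 - \<omega>) *\<^sub>R fst A + \<omega> *\<^sub>R fst B \<in> \<Omega>"
      using hA \<omega> by (intro convexD_alt[OF conv]) auto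
    ultimately show ?thesis by (simp add: cyl_def mem_Times_iff)
  qed
  from visible_point_unique[OF tgt this Y Ys(3) \<omega>(3,4)] YYr show False by simp
qed

section \<open>The estimate and the inclusion\<close>

text \<open>The left-hand side is at most \<open>a\<close> times a quadratic form in \<open>sqrt b\<close> and \<open>X = r sqrt a\<close>, and the
choice of \<open>M\<close> makes this form negative for \<open>X \<ge> M sqrt b\<close>.\<close>

lemma quadratic_dominates:
  fixes a b C C1 M r \<rho> :: real
  assumes pos: "0 < a" "0 < b" "0 < C" "0 < C1" and M: "M = 1 + 2 * C / C1"
    and r: "M * (b powr (1/2) / a powr (1/2)) \<le> r"
    and \<rho>: "\<rho> \<le> a powr (3/2) * b powr (1/2)"
  shows "C * a * b + C * \<rho> * r - C1 * a\<^sup>2 * r\<^sup>2 < 0"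
proof -
  define p where "p = sqrt a"
  define q where "q = sqrt b"
  have p: "0 < p" "a = p\<^sup>2" "a powr (1/2) = p" using pos by (simp_all add: p_def powr_half_sqrt)
  have q: "0 < q" "b = q\<^sup>2" "b powr (1/2) = q" using pos by (simp_all add: q_def powr_half_sqrt)
  have "a powr (3/2) = a powr 1 * a powr (1/2)" unfolding powr_add[symmetric] by simp
  then have a32: "a powr (3/2) = p ^ 3" using pos p by (simp add: power2_eq_square power3_eq_cube)
  have M1: "1 \<le> M" "C1 * M = C1 + 2 * C" using pos by (simp_all add: M distrib_left)
  define X where "X = p * r"
  have MX: "M * q \<le> X" using r p q by (simp add: X_def field_simps)
  have "1 * q \<le> M * q" using M1 q by (intro mult_right_mono) auto
  then have qX: "q \<le> X" "0 < X" using MX q by linarith+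
  have r0: "0 < r" using qX(2) p by (simp add: X_def zero_less_mult_iff)
  have "C * \<rho> * r \<le> C * (p ^ 3 * q) * r"
    using \<rho> pos r0 unfolding a32 q(3) by (intro mult_right_mono mult_left_mono) auto
  then have "C * a * b + C * \<rho> * r - C1 * a\<^sup>2 * r\<^sup>2 \<le> p\<^sup>2 * (C * (q * q) + C * (q * X) - C1 * (X * X))"
    unfolding p(2) q(2) X_def by (simp add: power2_eq_square power3_eq_cube algebra_simps)
  also have "\<dots> < 0"
  proof (rule mult_pos_neg)
    have "C * (q * q) \<le> C * (q * X)" using pos q qX by (intro mult_left_mono) auto
    moreover have "(C1 * (M * q)) * X \<le> (C1 * X) * X"
      using MX pos qX by (intro mult_right_mono mult_left_mono) auto
    moreover have "(C1 * (M * q)) * X = C1 * (q * X) + 2 * (C * (q * X))"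
      using M1(2) by (simp add: mult.assoc[symmetric]) (simp add: algebra_simps)
    moreover have "0 < C1 * (q * X)" using pos q qX by simp
    ultimately show "C * (q * q) + C * (q * X) - C1 * (X * X) < 0" by (simp add: mult.assoc)
  qed (use p in simp)
  finally show ?thesis .
qed

lemma powr_ratio_le_half:
  fixes a b M \<delta> :: real
  assumes "0 < a" "0 < b" "0 < M" "0 < \<delta>" "(2 * M / \<delta>)\<^sup>2 \<le> a / b"
  shows "M * (b powr (1/2) / a powr (1/2)) \<le> \<delta> / 2"
proof -
  have "2 * M / \<delta> \<le> sqrt (a / b)" using assms by (intro real_le_rsqrt) auto
  then have "2 * M * sqrt b \<le> \<delta> * sqrt a"
    using assms by (simp add: real_sqrt_divide field_simps)
  then show ?thesis using assms by (simp add: powr_half_sqrt field_simps)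
qed

text \<open>Near \<open>xa\<close> regularity is applied at \<open>x\<close> itself; away from it, in dimension at least two,
it is applied at crossing points near \<open>xa\<close>. The factor \<open>1 / (1 + 1 / \<theta>\<^sup>2)\<close> in the gain is the loss
incurred in the second case.\<close>

lemma regular_refractor_estimate:
  assumes Z_def: "Z = (xa, u xa)"
    and tgt: "target \<kappa> M\<^sub>0 \<delta>\<^sub>0 \<Omega> \<Sigma> s" and u: "parallel_refractor \<kappa> M\<^sub>0 \<Omega> \<Sigma> u"
    and x: "xb \<in> \<Omega>" "x \<in> \<Omega>" and Z: "Z \<in> cyl M\<^sub>0 \<Omega>"
    and Y: "Ya \<in> F \<kappa> \<Omega> \<Sigma> u xa" "Yb \<in> F \<kappa> \<Omega> \<Sigma> u xb" "Y \<in> \<Sigma>"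
    and l: "l \<in> {1/4..3/4}" and Yl: "Yl = Ycurve \<kappa> s Ya Yb Z l" "Yl \<in> Yseg \<kappa> \<Sigma> Ya Yb Z"
    and c: "0 < c1" "0 < c2"
    and reg: "\<And>x. x \<in> \<Omega> \<Longrightarrow> norm (x - xa) \<le> c2 \<Longrightarrow>
        min (phi \<kappa> x Ya Z) (phi \<kappa> x Yb Z) + c1 * (norm (Ya - Yb))\<^sup>2 * (norm (x - xa))\<^sup>2 \<le> phi \<kappa> x Yl Z"
    and near: "norm (x - xa) \<le> c2 \<or> 2 \<le> CARD('n)"
  shows "u x - phi \<kappa> x Y Z \<le> C\<^sub>s * norm (Ya - Yb) * norm (xa - xb) + C\<^sub>s * norm (Yl - Y) * norm (x - xa)
    - \<alpha>\<^sub>g * (c1 / \<beta> / (1 + 1 / \<theta>\<^sup>2)) * (norm (Ya - Yb))\<^sup>2 * (norm (x - xa))\<^sup>2"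
proof -
  have S: "\<Sigma> \<subseteq> adm" using tgt by (rule target_admissible)
  have xa: "xa \<in> \<Omega>" using Z by (simp add: cyl_def Z_def)
  have Zc: "Z \<in> ccyl" using Z by (auto simp: cyl_def)
  have Ys: "Ya \<in> \<Sigma>" "Yb \<in> \<Sigma>" using Y by (auto simp: F_def)
  have Yla: "Yl \<in> \<Sigma>" and slope: "slope Z Yl = (1 - l) *\<^sub>R slope Z Ya + l *\<^sub>R slope Z Yb"
    using Ycurve_slope[OF S Zc Ys] Yl by auto
  define a where "a = norm (Ya - Yb)"
  define b where "b = norm (xa - xb)"
  define d where "d = norm (x - xa)"
  define q where "q = c1 / \<beta> / (1 + 1 / \<theta>\<^sup>2)"
  have den: "1 \<le> 1 + 1 / \<theta>\<^sup>2" by simp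
  have cb: "0 < c1 / \<beta>" using c beta_pos by simp
  have q: "0 < q" "q \<le> c1 / \<beta>"
  proof -
    have den0: "0 < 1 + 1 / \<theta>\<^sup>2" using den by linarith
    then show "0 < q" unfolding q_def using cb by (rule divide_pos_pos[rotated])
    have "c1 / \<beta> / (1 + 1 / \<theta>\<^sup>2) \<le> c1 / \<beta> / 1"
      using den den0 cb by (intro divide_left_mono) simp_all
    then show "q \<le> c1 / \<beta>" by (simp add: q_def)
  qed
  have "- (K\<^sub>1 * (a * b)) + q * a\<^sup>2 * d\<^sup>2 \<le> gap (xa, u xa) Yl (x, u x)"
  proof (cases "d \<le> c2")
    case True
    have "- (K\<^sub>1 * norm (Ya - Yb) * norm (xa - xb)) + (c1 * a\<^sup>2 * d\<^sup>2) / \<beta> \<le> gap (xa, u xa) Yl (x, u x)"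
      using reg[OF x(2)] True Yla S c unfolding a_def d_def Z_def
      by (intro gap_lower_local[OF S u xa x Y(1,2)]) auto
    moreover have "q * (a\<^sup>2 * d\<^sup>2) \<le> c1 / \<beta> * (a\<^sup>2 * d\<^sup>2)" using q by (intro mult_right_mono) auto
    ultimately show ?thesis by (simp add: a_def b_def mult_ac)
  next
    case False
    then have n: "2 \<le> CARD('n)" using near by (simp add: d_def)
    have l01: "0 \<le> l" "l \<le> 1" using l by auto
    have "(1 - l) / (2 * sig Z Ya) + l / (2 * sig Z Yb) + q * a\<^sup>2 \<le> 1 / (2 * sig Z Yl)"
    proof (cases "slope Z Ya = slope Z Yb")
      case True
      have sp: "0 < sig Z P" if "P \<in> \<Sigma>" for P by (rule sig_pos(2)[OF subsetD[OF S that] Zc])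
      have same: "P = Ya" if "P \<in> \<Sigma>" "slope Z P = slope Z Ya" for P
      proof (rule visible_point_unique[OF tgt Z Ys(1) that(1)])
        show "0 < sig Z P / sig Z Ya" using sp Ys that by simp
        show "P - Z = (sig Z P / sig Z Ya) *\<^sub>R (Ya - Z)"
          using slope_determines_ray sp Ys that by metis
      qed
      have "Yb = Ya" using same Ys True by metis
      moreover have "Yl = Ya" using same[OF Yla] slope True by (simp flip: scaleR_left_distrib)
      ultimately show ?thesis by (simp add: a_def flip: add_divide_distrib)
    next
      case ne: False
      have "(1 - l) / (2 * sig Z Ya) + l / (2 * sig Z Yb) + (c1 * a\<^sup>2) / \<beta> / (1 + 1 / \<theta>\<^sup>2) \<le> 1 / (2 * sig Z Yl)"
        using S Ys Yla c reg slope n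
        by (intro curvature_concave[where \<epsilon> = c2, OF _ _ _ Z ne]) (auto simp: a_def Z_def)
      then show ?thesis by (simp add: q_def)
    qed
    from gap_lower_global[OF S u xa x Y(1,2) l01 slope[unfolded Z_def] _ this[unfolded Z_def]] q
    show ?thesis by (simp add: a_def b_def d_def mult_ac)
  qed
  then have "u x - phi \<kappa> x Y (xa, u xa) \<le> C\<^sub>s * (a * b) + C\<^sub>s * norm (Yl - Y) * norm (x - xa) - \<alpha>\<^sub>g * (q * a\<^sup>2 * d\<^sup>2)"
    using S Yla Y(3) q by (intro refractor_estimate[OF S u xa x(2)]) (auto simp: a_def b_def)
  then show ?thesis by (simp add: a_def b_def d_def q_def Z_def mult_ac)
qed

text \<open>The estimate gives a larger cost at distance at least \<open>\<eta>\<close> from \<open>xa\<close>, for all points if \<open>n \<ge> 2\<close> and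
within \<open>c2\<close> if \<open>n = 1\<close>. In the latter case a farther point with cost no larger than at \<open>xa\<close> would
enclose a point at distance \<open>\<eta>\<close> of strictly larger cost, contrary to
\<open>one_dim_cost_no_interior_max\<close>.\<close>

lemma regular_refractor_support:
  assumes Z_def: "Z = (xa, u xa)"
    and tgt: "target \<kappa> M\<^sub>0 \<delta>\<^sub>0 \<Omega> \<Sigma> s" and u: "parallel_refractor \<kappa> M\<^sub>0 \<Omega> \<Sigma> u"
    and x: "xb \<in> \<Omega>" "xa \<noteq> xb" and Z: "Z \<in> cyl M\<^sub>0 \<Omega>"
    and Y: "Ya \<in> F \<kappa> \<Omega> \<Sigma> u xa" "Yb \<in> F \<kappa> \<Omega> \<Sigma> u xb" "Y \<in> \<Sigma>" "Ya \<noteq> Yb"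
    and l: "l \<in> {1/4..3/4}" and Yl: "Yl = Ycurve \<kappa> s Ya Yb Z l" "Yl \<in> Yseg \<kappa> \<Sigma> Ya Yb Z"
    and c: "0 < c1" "0 < c2"
    and reg: "\<And>x. x \<in> \<Omega> \<Longrightarrow> norm (x - xa) \<le> c2 \<Longrightarrow>
        min (phi \<kappa> x Ya Z) (phi \<kappa> x Yb Z) + c1 * (norm (Ya - Yb))\<^sup>2 * (norm (x - xa))\<^sup>2 \<le> phi \<kappa> x Yl Z"
    and C1: "C1 = \<alpha>\<^sub>g * (c1 / \<beta> / (1 + 1 / \<theta>\<^sup>2))" and M: "M = 1 + 2 * C\<^sub>s / C1"
    and \<eta>: "\<eta> = M * (norm (xa - xb) powr (1/2) / norm (Ya - Yb) powr (1/2))" "\<eta> < c2" "cball xa \<eta> \<subseteq> \<Omega>"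
    and near: "norm (Yl - Y) \<le> norm (Ya - Yb) powr (3/2) * norm (xa - xb) powr (1/2)"
  shows "Y \<in> (\<Union>x \<in> ball xa \<eta>. F \<kappa> \<Omega> \<Sigma> u x)"
proof -
  have S: "\<Sigma> \<subseteq> adm" using tgt by (rule target_admissible)
  have Ya: "Y \<in> adm" using S Y by auto
  have ur: "u ` \<Omega> \<subseteq> {0..M\<^sub>0}" using u by (simp add: parallel_refractor_def)
  have xa: "xa \<in> \<Omega>" "u xa < M\<^sub>0" using Z by (auto simp: cyl_def Z_def)
  have GO: "(y, u y) \<in> ccyl" if "y \<in> \<Omega>" for y using that ur by auto
  have den: "0 < 1 + 1 / \<theta>\<^sup>2" by (simp add: add_pos_nonneg)
  have C1p: "0 < C1" unfolding C1 using alpha_pos beta_pos c den by (intro mult_pos_pos divide_pos_pos) auto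
  have Mp: "0 < M" using C1p Cs_pos by (simp add: M add_pos_pos)
  have \<eta>0: "0 < \<eta>" unfolding \<eta> using Mp x Y by simp
  have above: "c (xa, u xa) Y < c (y, u y) Y"
    if y: "y \<in> \<Omega>" "\<eta> \<le> norm (y - xa)" "norm (y - xa) \<le> c2 \<or> 2 \<le> CARD('n)" for y
  proof -
    have "u y - phi \<kappa> y Y Z \<le> C\<^sub>s * norm (Ya - Yb) * norm (xa - xb) + C\<^sub>s * norm (Yl - Y) * norm (y - xa)
        - C1 * (norm (Ya - Yb))\<^sup>2 * (norm (y - xa))\<^sup>2"
      unfolding C1 Z_def using tgt u x y Z Y l Yl c reg unfolding Z_def
      by (intro regular_refractor_estimate[where s = s and l = l and Yl = Yl, OF refl]) auto
    also have "\<dots> < 0"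
      using x Y Cs_pos C1p y \<eta>(1) near by (intro quadratic_dominates[OF _ _ _ _ M]) auto
    finally have "\<not> phi \<kappa> y Y (xa, u xa) \<le> u y" by (simp add: Z_def)
    then show ?thesis using phi_le_iff_cost[OF Ya GO[OF xa(1)] GO[OF y(1)]] by simp
  qed
  show ?thesis
  proof (rule support_by_sliding[OF S u Y(3) xa(1) \<eta>0 \<eta>(3)])
    fix y assume y: "y \<in> \<Omega>" "\<eta> \<le> norm (y - xa)"
    show "c (xa, u xa) Y < c (y, u y) Y"
    proof (cases "norm (y - xa) \<le> c2 \<or> 2 \<le> CARD('n)")
      case True
      then show ?thesis using above y by blast
    next
      case False
      then have one: "CARD('n) = 1" using zero_less_card_finite[where 'a = 'n] by linarith
      define \<rho> where "\<rho> = \<eta> / norm (y - xa)"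
      have ny: "\<eta> < norm (y - xa)" "0 < norm (y - xa)" using False \<eta>(2) \<eta>0 by auto
      have \<rho>: "0 < \<rho>" "\<rho> < 1" using ny \<eta>0 by (auto simp: \<rho>_def)
      define xr where "xr = (1 - \<rho>) *\<^sub>R xa + \<rho> *\<^sub>R y"
      have "xr - xa = \<rho> *\<^sub>R (y - xa)" by (simp add: xr_def algebra_simps)
      then have nr: "norm (xr - xa) = \<eta>" using \<rho> ny \<eta>0 by (simp add: \<rho>_def)
      then have "xr \<in> \<Omega>" using \<eta>(3) by (auto simp: dist_norm norm_minus_commute)
      then have up: "c (xa, u xa) Y < c (xr, u xr) Y" using above nr \<eta>(2) by simp
      have ne: "xa \<noteq> y" using ny by auto
      show ?thesis
      proof (rule ccontr)
        assume "\<not> ?thesis"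
        then have "c (y, u y) Y \<le> c (xa, u xa) Y" by simp
        from one_dim_cost_no_interior_max[OF one tgt u Y(3) xa(1) y(1) ne xa(2) \<rho> this xr_def] up
        show False by simp
      qed
    qed
  qed
qed

end

text \<open>The radius \<open>\<delta>\<close> keeps the graph of every refractor through \<open>(xs, ts)\<close> inside the neighbourhood of
regularity and strictly inside the cylinder; it depends only on the common Lipschitz constant
\<open>1 / \<theta>\<close> of refractors, not on \<open>u\<close>. In both parts \<open>x0\<close> is the endpoint \<open>xa\<close>.\<close>

theorem theorem5p3:
  fixes \<kappa> M\<^sub>0 \<delta>\<^sub>0 :: real and \<Omega> :: "(real ^ 'n::finite) set"
  assumes "0 < \<kappa>" "\<kappa> < 1" "0 < M\<^sub>0" "0 < \<delta>\<^sub>0" "\<delta>\<^sub>0 < 1"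
    and "open \<Omega>" "connected \<Omega>" "\<Omega> \<noteq> {}" "bounded \<Omega>"
  shows "\<exists>(C :: real) (M :: real \<Rightarrow> real \<Rightarrow> real).
    0 < C \<and> (\<forall>a>0. \<forall>b>0. 0 < M a b) \<and>
    (\<forall>(\<Sigma> :: 'n point set) s xs ts.
      target \<kappa> M\<^sub>0 \<delta>\<^sub>0 \<Omega> \<Sigma> s \<longrightarrow> (xs, ts) \<in> cyl M\<^sub>0 \<Omega> \<longrightarrow> regular_from \<kappa> M\<^sub>0 \<Omega> \<Sigma> s (xs, ts) \<longrightarrow>
      (\<exists>\<delta> C\<^sub>1 C\<^sub>2. 0 < \<delta> \<and> 0 < C\<^sub>1 \<and> 0 < C\<^sub>2 \<and> ball xs \<delta> \<subseteq> \<Omega> \<and>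
        (\<forall>u. parallel_refractor \<kappa> M\<^sub>0 \<Omega> \<Sigma> u \<longrightarrow> u xs = ts \<longrightarrow>
          (\<forall>xa \<in> ball xs \<delta>. \<forall>xb \<in> ball xs \<delta>. \<forall>Ya \<in> F \<kappa> \<Omega> \<Sigma> u xa. \<forall>Yb \<in> F \<kappa> \<Omega> \<Sigma> u xb.
            norm (xa - xb) \<le> norm (Ya - Yb) \<longrightarrow>
            (\<exists>x0 \<in> closed_segment xa xb.
              \<forall>l \<in> {1/4..3/4}. Ycurve \<kappa> s Ya Yb (x0, u x0) l \<in> Yseg \<kappa> \<Sigma> Ya Yb (x0, u x0) \<longrightarrow>
                (\<forall>Y \<in> \<Sigma>. \<forall>x \<in> \<Omega> \<inter> ball x0 C\<^sub>2.
                  u x - phi \<kappa> x Y (x0, u x0)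
                    \<le> C * norm (Ya - Yb) * norm (xa - xb)
                      + C * norm (Ycurve \<kappa> s Ya Yb (x0, u x0) l - Y) * norm (x - x0)
                      - C\<^sub>1 * (norm (Ya - Yb))\<^sup>2 * (norm (x - x0))\<^sup>2))) \<and>
          (\<forall>xa \<in> ball xs (\<delta> / 2). \<forall>xb \<in> ball xs (\<delta> / 2).
            \<forall>Ya \<in> F \<kappa> \<Omega> \<Sigma> u xa. \<forall>Yb \<in> F \<kappa> \<Omega> \<Sigma> u xb.
            xb \<noteq> xa \<longrightarrow>
            norm (Ya - Yb) / norm (xa - xb)
              \<ge> Max {1, (2 * M C C\<^sub>1 / \<delta>)\<^sup>2, (2 * M C C\<^sub>1 / C\<^sub>2)\<^sup>2} \<longrightarrow>
            (\<exists>x0 \<in> closed_segment xa xb.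
              let \<mu> = norm (Ya - Yb) powr (3/2) * norm (xa - xb) powr (1/2);
                  \<eta> = M C C\<^sub>1 * (norm (xa - xb) powr (1/2) / norm (Ya - Yb) powr (1/2))
              in nbhd \<mu> {Ycurve \<kappa> s Ya Yb (x0, u x0) l | l.
                           l \<in> {1/4..3/4} \<and>
                           Ycurve \<kappa> s Ya Yb (x0, u x0) l \<in> Yseg \<kappa> \<Sigma> Ya Yb (x0, u x0)} \<inter> \<Sigma>
                 \<subseteq> (\<Union>x \<in> ball x0 \<eta>. F \<kappa> \<Omega> \<Sigma> u x))))))"
proof -
  interpret cylinder \<kappa> M\<^sub>0 \<delta>\<^sub>0 \<Omega> using assms by unfold_locales
  obtain s0 where s0: "0 < s0" "\<forall>Y\<in>adm. \<forall>X\<in>ccyl. s0 \<le> norm (X - Y)"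
    using far_from_target by blast
  obtain D where D: "\<forall>x\<in>\<Omega>. \<forall>y\<in>\<Omega>. dist x y \<le> D"
    using \<open>bounded \<Omega>\<close> bounded_two_points by blast
  interpret cylinder_bounds \<kappa> M\<^sub>0 \<delta>\<^sub>0 \<Omega> s0 "max 0 D"
  proof unfold_locales
    show "norm (x - x') \<le> max 0 D" if "x \<in> \<Omega>" "x' \<in> \<Omega>" for x x'
      using D that by (force simp: dist_norm)
  qed (use s0 in auto)
  define M where "M C C1 = 1 + 2 * C / C1" for C C1 :: real
  show ?thesis
  proof (rule exI[of _ C\<^sub>s], rule exI[of _ M], intro conjI allI impI)
    show "0 < C\<^sub>s" by (rule Cs_pos)
    show "0 < M a b" if "0 < a" "0 < b" for a b using that by (simp add: M_def add_pos_pos)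
    fix \<Sigma> :: "'n point set" and s xs ts
    assume tgt: "target \<kappa> M\<^sub>0 \<delta>\<^sub>0 \<Omega> \<Sigma> s" and Xs: "(xs, ts) \<in> cyl M\<^sub>0 \<Omega>"
      and reg: "regular_from \<kappa> M\<^sub>0 \<Omega> \<Sigma> s (xs, ts)"
    have S: "\<Sigma> \<subseteq> adm" using tgt by (rule target_admissible)
    obtain U c1 c2 where U: "open U" "(xs, ts) \<in> U" and c: "0 < c1" "0 < c2"
      and R: "\<forall>Ya\<in>\<Sigma>. \<forall>Yb\<in>\<Sigma>. \<forall>Z \<in> U \<inter> cyl M\<^sub>0 \<Omega>. \<forall>l\<in>{1/4..3/4}. \<forall>x\<in>\<Omega>.
           Ycurve \<kappa> s Ya Yb Z l \<in> Yseg \<kappa> \<Sigma> Ya Yb Z \<longrightarrow> norm (x - fst Z) \<le> c2 \<longrightarrow>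
           phi \<kappa> x (Ycurve \<kappa> s Ya Yb Z l) Z
             \<ge> min (phi \<kappa> x Ya Z) (phi \<kappa> x Yb Z) + c1 * (norm (Ya - Yb))\<^sup>2 * (norm (x - fst Z))\<^sup>2"
      using reg unfolding regular_from_def by blast
    have "open (U \<inter> cyl M\<^sub>0 \<Omega>)" using U dom(1) by (auto simp: cyl_def intro!: open_Int open_Times)
    then obtain \<epsilon> where \<epsilon>: "0 < \<epsilon>" "ball (xs, ts) \<epsilon> \<subseteq> U \<inter> cyl M\<^sub>0 \<Omega>"
      using U Xs openE[of "U \<inter> cyl M\<^sub>0 \<Omega>" "(xs, ts)"] by blast
    define L where "L = 1 + 1 / \<theta>"
    have L: "1 \<le> L" using theta_pos by (simp add: L_def)
    define \<delta> where "\<delta> = \<epsilon> / L"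
    define C1 where "C1 = \<alpha>\<^sub>g * (c1 / \<beta> / (1 + 1 / \<theta>\<^sup>2))"
    have \<delta>: "0 < \<delta>" "\<delta> \<le> \<epsilon>" using \<epsilon> L by (auto simp: \<delta>_def field_simps)
    have den: "0 < 1 + 1 / \<theta>\<^sup>2" by (simp add: add_pos_nonneg)
    have C1: "0 < C1" unfolding C1_def using alpha_pos beta_pos c den by (intro mult_pos_pos divide_pos_pos) auto
    have b\<delta>: "ball xs \<delta> \<subseteq> \<Omega>"
    proof
      fix x assume "x \<in> ball xs \<delta>"
      then have "(x, ts) \<in> ball (xs, ts) \<epsilon>" using \<delta> by (simp add: dist_Pair_Pair)
      then show "x \<in> \<Omega>" using \<epsilon> by (auto simp: cyl_def)
    qed
    have near: "(x, u x) \<in> U \<inter> cyl M\<^sub>0 \<Omega>"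
      if u: "parallel_refractor \<kappa> M\<^sub>0 \<Omega> \<Sigma> u" "u xs = ts" and x: "x \<in> ball xs \<delta>" for u x
    proof -
      have xO: "x \<in> \<Omega>" "xs \<in> \<Omega>" using x b\<delta> \<delta> by auto
      have "\<bar>u xs - u x\<bar> \<le> norm (xs - x) / \<theta>"
        using refractor_lipschitz[OF S u(1) xO] theta_pos by (simp add: pos_le_divide_eq mult.commute)
      moreover have "dist (xs, ts) (x, u x) \<le> norm (xs - x) + \<bar>u xs - u x\<bar>"
        using norm_Pair_le[of "xs - x" "ts - u x"] u(2) by (simp add: dist_norm)
      ultimately have "dist (xs, ts) (x, u x) \<le> norm (xs - x) * L" by (simp add: L_def algebra_simps)
      also have "\<dots> < \<delta> * L" using x L by (intro mult_strict_right_mono) (auto simp: dist_norm)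
      also have "\<dots> = \<epsilon>" using L by (simp add: \<delta>_def)
      finally show ?thesis using \<epsilon> by auto
    qed
    have R': "min (phi \<kappa> x Ya (xa, u xa)) (phi \<kappa> x Yb (xa, u xa)) + c1 * (norm (Ya - Yb))\<^sup>2 * (norm (x - xa))\<^sup>2
        \<le> phi \<kappa> x (Ycurve \<kappa> s Ya Yb (xa, u xa) l) (xa, u xa)"
      if "(xa, u xa) \<in> U \<inter> cyl M\<^sub>0 \<Omega>" "Ya \<in> F \<kappa> \<Omega> \<Sigma> u xa" "Yb \<in> F \<kappa> \<Omega> \<Sigma> u xb" "l \<in> {1/4..3/4}"
        "Ycurve \<kappa> s Ya Yb (xa, u xa) l \<in> Yseg \<kappa> \<Sigma> Ya Yb (xa, u xa)" "x \<in> \<Omega>" "norm (x - xa) \<le> c2"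
      for u xa xb Ya Yb l x
    proof -
      have "Ya \<in> \<Sigma>" "Yb \<in> \<Sigma>" using that(2,3) by (auto simp: F_def)
      from R[rule_format, OF this that(1,4,6,5)] that(7) show ?thesis by simp
    qed
    show "\<exists>\<delta> C\<^sub>1 C\<^sub>2. 0 < \<delta> \<and> 0 < C\<^sub>1 \<and> 0 < C\<^sub>2 \<and> ball xs \<delta> \<subseteq> \<Omega> \<and>
        (\<forall>u. parallel_refractor \<kappa> M\<^sub>0 \<Omega> \<Sigma> u \<longrightarrow> u xs = ts \<longrightarrow>
          (\<forall>xa \<in> ball xs \<delta>. \<forall>xb \<in> ball xs \<delta>. \<forall>Ya \<in> F \<kappa> \<Omega> \<Sigma> u xa. \<forall>Yb \<in> F \<kappa> \<Omega> \<Sigma> u xb.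
            norm (xa - xb) \<le> norm (Ya - Yb) \<longrightarrow>
            (\<exists>x0 \<in> closed_segment xa xb.
              \<forall>l \<in> {1/4..3/4}. Ycurve \<kappa> s Ya Yb (x0, u x0) l \<in> Yseg \<kappa> \<Sigma> Ya Yb (x0, u x0) \<longrightarrow>
                (\<forall>Y \<in> \<Sigma>. \<forall>x \<in> \<Omega> \<inter> ball x0 C\<^sub>2.
                  u x - phi \<kappa> x Y (x0, u x0)
                    \<le> C\<^sub>s * norm (Ya - Yb) * norm (xa - xb)
                      + C\<^sub>s * norm (Ycurve \<kappa> s Ya Yb (x0, u x0) l - Y) * norm (x - x0)
                      - C\<^sub>1 * (norm (Ya - Yb))\<^sup>2 * (norm (x - x0))\<^sup>2))) \<and>
          (\<forall>xa \<in> ball xs (\<delta> / 2). \<forall>xb \<in> ball xs (\<delta> / 2).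
            \<forall>Ya \<in> F \<kappa> \<Omega> \<Sigma> u xa. \<forall>Yb \<in> F \<kappa> \<Omega> \<Sigma> u xb.
            xb \<noteq> xa \<longrightarrow>
            norm (Ya - Yb) / norm (xa - xb)
              \<ge> Max {1, (2 * M C\<^sub>s C\<^sub>1 / \<delta>)\<^sup>2, (2 * M C\<^sub>s C\<^sub>1 / C\<^sub>2)\<^sup>2} \<longrightarrow>
            (\<exists>x0 \<in> closed_segment xa xb.
              let \<mu> = norm (Ya - Yb) powr (3/2) * norm (xa - xb) powr (1/2);
                  \<eta> = M C\<^sub>s C\<^sub>1 * (norm (xa - xb) powr (1/2) / norm (Ya - Yb) powr (1/2))
              in nbhd \<mu> {Ycurve \<kappa> s Ya Yb (x0, u x0) l | l.
                           l \<in> {1/4..3/4} \<and>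
                           Ycurve \<kappa> s Ya Yb (x0, u x0) l \<in> Yseg \<kappa> \<Sigma> Ya Yb (x0, u x0)} \<inter> \<Sigma>
                 \<subseteq> (\<Union>x \<in> ball x0 \<eta>. F \<kappa> \<Omega> \<Sigma> u x))))"
    proof (rule exI[of _ \<delta>], rule exI[of _ C1], rule exI[of _ c2],
        intro conjI allI impI \<delta>(1) C1 c(2) b\<delta> ballI)
      fix u xa xb Ya Yb
      assume u: "parallel_refractor \<kappa> M\<^sub>0 \<Omega> \<Sigma> u" "u xs = ts"
        and x: "xa \<in> ball xs \<delta>" "xb \<in> ball xs \<delta>"
        and Y: "Ya \<in> F \<kappa> \<Omega> \<Sigma> u xa" "Yb \<in> F \<kappa> \<Omega> \<Sigma> u xb"
      show "\<exists>x0 \<in> closed_segment xa xb.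
          \<forall>l \<in> {1/4..3/4}. Ycurve \<kappa> s Ya Yb (x0, u x0) l \<in> Yseg \<kappa> \<Sigma> Ya Yb (x0, u x0) \<longrightarrow>
            (\<forall>Y \<in> \<Sigma>. \<forall>x \<in> \<Omega> \<inter> ball x0 c2.
              u x - phi \<kappa> x Y (x0, u x0)
                \<le> C\<^sub>s * norm (Ya - Yb) * norm (xa - xb)
                  + C\<^sub>s * norm (Ycurve \<kappa> s Ya Yb (x0, u x0) l - Y) * norm (x - x0)
                  - C1 * (norm (Ya - Yb))\<^sup>2 * (norm (x - x0))\<^sup>2)"
      proof (intro bexI[of _ xa] ballI impI)
        fix l Y x
        assume l: "l \<in> {1/4..3/4}" "Ycurve \<kappa> s Ya Yb (xa, u xa) l \<in> Yseg \<kappa> \<Sigma> Ya Yb (xa, u xa)"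
          and Yx: "Y \<in> \<Sigma>" "x \<in> \<Omega> \<inter> ball xa c2"
        have Z: "(xa, u xa) \<in> U \<inter> cyl M\<^sub>0 \<Omega>" using near u x by blast
        show "u x - phi \<kappa> x Y (xa, u xa) \<le> C\<^sub>s * norm (Ya - Yb) * norm (xa - xb)
            + C\<^sub>s * norm (Ycurve \<kappa> s Ya Yb (xa, u xa) l - Y) * norm (x - xa)
            - C1 * (norm (Ya - Yb))\<^sup>2 * (norm (x - xa))\<^sup>2"
          unfolding C1_def
        proof (rule regular_refractor_estimate[where u = u and xa = xa, OF refl tgt u(1) _ _ _ Y Yx(1) l(1) refl l(2) c])
          show "norm (x - xa) \<le> c2 \<or> 2 \<le> CARD('n)"
            using Yx(2) by (simp add: dist_norm norm_minus_commute)
        qed (use R'[OF Z Y l] Z x b\<delta> Yx in auto)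
      qed simp
    next
      fix u xa xb Ya Yb
      assume u: "parallel_refractor \<kappa> M\<^sub>0 \<Omega> \<Sigma> u" "u xs = ts"
        and x: "xa \<in> ball xs (\<delta> / 2)" "xb \<in> ball xs (\<delta> / 2)"
        and Y: "Ya \<in> F \<kappa> \<Omega> \<Sigma> u xa" "Yb \<in> F \<kappa> \<Omega> \<Sigma> u xb"
        and ne: "xb \<noteq> xa"
        and big: "Max {1, (2 * M C\<^sub>s C1 / \<delta>)\<^sup>2, (2 * M C\<^sub>s C1 / c2)\<^sup>2} \<le> norm (Ya - Yb) / norm (xa - xb)"
      define \<mu> where "\<mu> = norm (Ya - Yb) powr (3/2) * norm (xa - xb) powr (1/2)"
      define \<eta> where "\<eta> = M C\<^sub>s C1 * (norm (xa - xb) powr (1/2) / norm (Ya - Yb) powr (1/2))"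
      have xd: "xa \<in> ball xs \<delta>" "xb \<in> ball xs \<delta>" using x \<delta> by auto
      have Z: "(xa, u xa) \<in> U \<inter> cyl M\<^sub>0 \<Omega>" using near u xd by blast
      have ratio: "1 \<le> norm (Ya - Yb) / norm (xa - xb)"
        "(2 * M C\<^sub>s C1 / \<delta>)\<^sup>2 \<le> norm (Ya - Yb) / norm (xa - xb)"
        "(2 * M C\<^sub>s C1 / c2)\<^sup>2 \<le> norm (Ya - Yb) / norm (xa - xb)"
        using big by auto
      have b: "0 < norm (xa - xb)" using ne by simp
      have "norm (xa - xb) \<le> norm (Ya - Yb)" using ratio(1) b by (simp only: le_divide_eq_1_pos)
      with b have a: "0 < norm (Ya - Yb)" by linarith
      have Mp: "0 < M C\<^sub>s C1" using Cs_pos C1 by (simp add: M_def add_pos_pos)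
      have \<eta>: "\<eta> \<le> \<delta> / 2" "\<eta> \<le> c2 / 2"
        unfolding \<eta>_def using powr_ratio_le_half[OF a b Mp] \<delta>(1) c(2) ratio by auto
      have cb: "cball xa \<eta> \<subseteq> \<Omega>"
      proof -
        have "cball xa \<eta> \<subseteq> ball xs \<delta>"
        proof
          fix y assume "y \<in> cball xa \<eta>"
          then show "y \<in> ball xs \<delta>"
            using x(1) \<eta>(1) dist_triangle[of xs y xa] by simp
        qed
        then show ?thesis using b\<delta> by blast
      qed
      have main: "Y \<in> (\<Union>x \<in> ball xa \<eta>. F \<kappa> \<Omega> \<Sigma> u x)"
        if l: "l \<in> {1/4..3/4}" "Ycurve \<kappa> s Ya Yb (xa, u xa) l \<in> Yseg \<kappa> \<Sigma> Ya Yb (xa, u xa)"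
          and Yx: "Y \<in> \<Sigma>" "dist (Ycurve \<kappa> s Ya Yb (xa, u xa) l) Y < \<mu>" for l Y
      proof (rule regular_refractor_support[where u = u and xa = xa, OF refl tgt u(1) _ _ _ Y Yx(1) _ l(1) refl l(2) c _ C1_def _ \<eta>_def _ cb])
        show "\<eta> < c2" using \<eta>(2) c by linarith
        show "norm (Ycurve \<kappa> s Ya Yb (xa, u xa) l - Y)
            \<le> norm (Ya - Yb) powr (3/2) * norm (xa - xb) powr (1/2)"
          using Yx(2) by (simp add: \<mu>_def dist_norm)
      qed (use R'[OF Z Y l] Z xd b\<delta> ne a in \<open>auto simp: M_def\<close>)
      show "\<exists>x0 \<in> closed_segment xa xb.
          let \<mu> = norm (Ya - Yb) powr (3/2) * norm (xa - xb) powr (1/2);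
              \<eta> = M C\<^sub>s C1 * (norm (xa - xb) powr (1/2) / norm (Ya - Yb) powr (1/2))
          in nbhd \<mu> {Ycurve \<kappa> s Ya Yb (x0, u x0) l | l.
                       l \<in> {1/4..3/4} \<and>
                       Ycurve \<kappa> s Ya Yb (x0, u x0) l \<in> Yseg \<kappa> \<Sigma> Ya Yb (x0, u x0)} \<inter> \<Sigma>
             \<subseteq> (\<Union>x \<in> ball x0 \<eta>. F \<kappa> \<Omega> \<Sigma> u x)"
        unfolding Let_def \<mu>_def[symmetric] \<eta>_def[symmetric]
      proof (intro bexI[of _ xa] subsetI)
        fix Y
        assume "Y \<in> nbhd \<mu> {Ycurve \<kappa> s Ya Yb (xa, u xa) l | l.
            l \<in> {1/4..3/4} \<and> Ycurve \<kappa> s Ya Yb (xa, u xa) l \<in> Yseg \<kappa> \<Sigma> Ya Yb (xa, u xa)} \<inter> \<Sigma>"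
        then obtain l where "l \<in> {1/4..3/4}" "Ycurve \<kappa> s Ya Yb (xa, u xa) l \<in> Yseg \<kappa> \<Sigma> Ya Yb (xa, u xa)"
          "Y \<in> \<Sigma>" "dist (Ycurve \<kappa> s Ya Yb (xa, u xa) l) Y < \<mu>"
          unfolding nbhd_def by auto
        then show "Y \<in> (\<Union>x \<in> ball xa \<eta>. F \<kappa> \<Omega> \<Sigma> u x)" by (rule main)
      qed simp
    qed
  qed
qed

end
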